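(* Let $G$ be a triangle-free planar graph on $n$ vertices, and let $u_1, u_2, u_3 \in V(G)$ be three distinct vertices. Then the total number of paths of length four in $G$ whose two endpoints are $\{u_1,u_2\}$, $\{u_2,u_3\}$ or $\{u_1,u_3\}$ (i.e. the sum over the three pairs $\{u_i,u_j\}$ of the number of paths of length four joining $u_i$ and $u_j$) is at most $3\left(\frac{n+1}{3}\right)^2-6$. Moreover, for each $n\equiv 2 \pmod 3$ with $n\ge 6$, the graph $H_n$ (with $u_1,u_2,u_3$ the vertices so named in its definition) attains this bound.
   Context: Graphs are finite and simple; a path of length four has four edges and five distinct vertices. For $n\ge 6$, the graph $H_n$ has vertex set the disjoint union $\{u_1,u_2,u_3\}\cup\{z_1,z_2\}\cup A\cup B\cup C$ with $|A|+|B|+|C|=n-5$ and $|A|,|B|,|C|$ as equal as possible (pairwise differing by at most $1$); its edges are: $u_iz_j$ for all $i\in\{1,2,3\}$, $j\in\{1,2\}$; every vertex of $A$ is adjacent to $u_1$ and $u_2$; every vertex of $B$ is adjacent to $u_2$ and $u_3$; every vertex of $C$ is adjacent to $u_1$ and $u_3$; and there are no other edges.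
   Formalization: The upper bound is proved for all n except n = 3, 6, 7, 8, 9, 10, where it is false as printed (for n = 3 it is negative; for 6 ≤ n ≤ 10, K_{2,n-2} with the u_i in the larger part has 6(n-4) such paths); the statement on H_n is unchanged. *)

theory Defs
  imports "HOL-Analysis.Analysis" "Graph_Theory.Graph_Theory"
begin

text \<open>A finite simple graph is a \<^locale>\<open>pair_graph\<close>: a finite loop-free symmetric digraph,
  in which an undirected edge $uv$ is the pair of arcs $(u,v)$, $(v,u)$.\<close>

definition triangle_free :: "'a pair_pre_digraph \<Rightarrow> bool" where
  "triangle_free G \<longleftrightarrow>
     \<not> (\<exists>x y z. (x, y) \<in> parcs G \<and> (y, z) \<in> parcs G \<and> (z, x) \<in> parcs G)"

definition edge_ends :: "'a \<times> 'a \<Rightarrow> 'a set" where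
  "edge_ends e = {fst e, snd e}"

text \<open>A drawing in the plane, taken to be \<^typ>\<open>complex\<close>. The two arcs of an undirected edge
  are drawn as curves with the same image. The last two conditions say that
  an edge passes through no vertex other than its ends, and that distinct edges meet in
  common ends only.\<close>

definition plane_drawing ::
    "'a pair_pre_digraph \<Rightarrow> ('a \<Rightarrow> complex) \<Rightarrow> ('a \<times> 'a \<Rightarrow> real \<Rightarrow> complex) \<Rightarrow> bool" where
  "plane_drawing G p c \<longleftrightarrow>
     inj_on p (pverts G) \<and>
     (\<forall>e \<in> parcs G. arc (c e) \<and> pathstart (c e) = p (fst e) \<and> pathfinish (c e) = p (snd e)) \<and>
     (\<forall>e \<in> parcs G. path_image (c (prod.swap e)) = path_image (c e)) \<and>
     (\<forall>e \<in> parcs G. path_image (c e) \<inter> p ` pverts G = p ` edge_ends e) \<and>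
     (\<forall>e \<in> parcs G. \<forall>f \<in> parcs G. edge_ends e \<noteq> edge_ends f \<longrightarrow>
        path_image (c e) \<inter> path_image (c f) = p ` (edge_ends e \<inter> edge_ends f))"

definition planar :: "'a pair_pre_digraph \<Rightarrow> bool" where
  "planar G \<longleftrightarrow> (\<exists>p c. plane_drawing G p c)"

text \<open>For distinct $u$ and $v$ every undirected path joining them is traversed by exactly one
  directed path from $u$ to $v$, so that each path is counted once.\<close>

definition num_paths4 :: "'a pair_pre_digraph \<Rightarrow> 'a \<Rightarrow> 'a \<Rightarrow> nat" where
  "num_paths4 G u v = card {q. pre_digraph.apath (with_proj G) u q v \<and> length q = 4}"

text \<open>The sets $A$, $B$, $C$ of the graph $H_n$ are \<open>VA ` {..<k}\<close> etc.; their sizes add up to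
  $n-5$ and differ by at most $1$.\<close>

datatype h_vertex = U1 | U2 | U3 | Z1 | Z2 | VA nat | VB nat | VC nat

definition h_A :: "nat \<Rightarrow> h_vertex set" where "h_A n = VA ` {..<(n - 3) div 3}"
definition h_B :: "nat \<Rightarrow> h_vertex set" where "h_B n = VB ` {..<(n - 4) div 3}"
definition h_C :: "nat \<Rightarrow> h_vertex set" where "h_C n = VC ` {..<(n - 5) div 3}"

definition h_edges :: "nat \<Rightarrow> h_vertex rel" where
  "h_edges n = {U1, U2, U3} \<times> {Z1, Z2} \<union> h_A n \<times> {U1, U2} \<union> h_B n \<times> {U2, U3} \<union> h_C n \<times> {U1, U3}"

definition H_graph :: "nat \<Rightarrow> h_vertex pair_pre_digraph" where
  "H_graph n = \<lparr> pverts = {U1, U2, U3} \<union> {Z1, Z2} \<union> h_A n \<union> h_B n \<union> h_C n,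
                 parcs = h_edges n \<union> (h_edges n)\<inverse> \<rparr>"

end

theory Submission
  imports Defs
begin

text \<open>Planarity enters only through the bound of $2|X|-4$ on the number of edges induced by
  a set $X$ of at least three vertices. For a cycle, induction over chord paths (a theta curve
  splits the inside) bounds the number of edges on and inside it; inversion at an interior point
  gives the same bound outside, and the two add up to the claim for a 2-connected graph.

  Let $W$ be the set of vertices other than $u_1,u_2,u_3$, let $h_i(x)$ be the number of common
  neighbours of $x$ and $u_i$ in $W$, and let $t$ be the number of vertices adjacent to all three
  $u_i$. Paths whose middle vertex is some $u_k$ are counted by the common neighbours of pairs of
  the $u_i$; the others are counted by summing, over the middle vertices $x$, the expression
  $\sum_{i<j} h_i h_j$ minus the coincidences of the two neighbours. By sparsity and a Hall-type
  argument all but at most $2$ edges in $W$ can be owned by an end so that each $x$ owns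
  at most $2$ minus the number of its neighbours among the $u_i$. A middle vertex $x$ (a hub) thus
  has few neighbours of its own choice; its other neighbours own their edge to $x$
  and, if adjacent to some $u_i$, are leaves belonging to this hub alone. Charging the paths through $x$ to the hub
  and its leaves gives a contribution below the average allowed per vertex.\<close>

subsection \<open>Capacitated orientations\<close>

text \<open>Let \<open>p\<close> be the number of vertices of W adjacent to at most two u_i, and
  \<open>D\<close> the number of those adjacent to exactly two. Then n + 1 = p + 4 + |Z|, and the
  paths with middle vertex in U number at most (D + 3|Z|)^2/3 - 3|Z|. For D = p and |Z| = 2 this is
  already the bound; H_n is of this kind. The obstacle is that a hub with b leaves carries about
  b^2/3 paths, a quadratic rate as well. As b + D is at most about p, this is linearised to (p/3) b,
  and hubs can be added up: D^2/3 + (p/3)(p - D) stays below p^2/3 by D(p - D)/3. The linear and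
  constant terms then decide. They are coupled by |eps| + |Z| + eU \<le> 2: each missing member of Z
  makes room for an unowned edge or an edge among the u_i. For |Z| = 0 the constant is on the wrong
  side by 2/3, so the charge per vertex must be lowered when \<open>D\<close> is small, and a hub
  that holds all unowned edges exceeds the general charge and is compared with the target
  directly.\<close>

text \<open>A Hall-type theorem with deficiency \<open>r\<close>. The number of members of
  \<open>F\<close> inside \<open>Y\<close> is supermodular in \<open>Y\<close> and
  \<open>sum c Y\<close> is modular, so the sets attaining the bound are closed under union. When
  \<open>e\<close> is added, they decide whether \<open>e\<close> is discarded or which end can own
  it.\<close>

lemma exists_capacitated_owner:
  fixes F :: "'e set" and ends :: "'e \<Rightarrow> 'v set" and c :: "'v \<Rightarrow> nat" and r :: nat
  assumes "finite F" "finite W"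
    and "\<And>f. f \<in> F \<Longrightarrow> ends f \<subseteq> W \<and> ends f \<noteq> {}"
    and "\<And>Y. Y \<subseteq> W \<Longrightarrow> card {f \<in> F. ends f \<subseteq> Y} \<le> sum c Y + r"
  shows "\<exists>X own. X \<subseteq> F \<and> card X \<le> r \<and> (\<forall>f\<in>F - X. own f \<in> ends f) \<and>
           (\<forall>w\<in>W. card {f \<in> F - X. own f = w} \<le> c w)"
  using assms(1,3,4)
proof (induction F arbitrary: c r rule: finite_induct)
  case empty
  then show ?case by simp
next
  case (insert e F c r)
  define i where "i Y = card {f \<in> F. ends f \<subseteq> Y}" for Y
  have fin: "finite {f \<in> F. P f}" for P using insert.hyps by simp
  have i_insert: "card {f \<in> insert e F. ends f \<subseteq> Y} = i Y + (if ends e \<subseteq> Y then 1 else 0)" for Y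
  proof -
    have "{f \<in> insert e F. ends f \<subseteq> Y} = (if ends e \<subseteq> Y then insert e {f \<in> F. ends f \<subseteq> Y} else {f \<in> F. ends f \<subseteq> Y})"
      by auto
    then show ?thesis using insert.hyps by (simp add: i_def)
  qed
  have bound: "i Y + (if ends e \<subseteq> Y then 1 else 0) \<le> sum c Y + r" if "Y \<subseteq> W" for Y
    using insert.prems(2)[OF that] i_insert by simp
  have i_mono: "i Y \<le> i Y'" if "Y \<subseteq> Y'" for Y Y'
    unfolding i_def by (rule card_mono[OF fin]) (use that in auto)
  have i_super: "i Y + i Y' \<le> i (Y \<union> Y') + i (Y \<inter> Y')" for Y Y'
  proof -
    let ?A = "{f \<in> F. ends f \<subseteq> Y}" and ?B = "{f \<in> F. ends f \<subseteq> Y'}"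
    have "i Y + i Y' = card (?A \<union> ?B) + card (?A \<inter> ?B)"
      unfolding i_def by (rule card_Un_Int[OF fin fin])
    moreover have "card (?A \<union> ?B) \<le> i (Y \<union> Y')"
      unfolding i_def by (rule card_mono[OF fin]) auto
    moreover have "card (?A \<inter> ?B) \<le> i (Y \<inter> Y')"
      unfolding i_def by (rule card_mono[OF fin]) auto
    ultimately show ?thesis by linarith
  qed
  define tight where "tight Y \<longleftrightarrow> Y \<subseteq> W \<and> i Y = sum c Y + r" for Y
  have tight_Un: "tight (Y \<union> Y')" if "tight Y" "tight Y'" for Y Y'
  proof -
    have YW: "Y \<subseteq> W" "Y' \<subseteq> W" using that by (auto simp: tight_def)
    have fY: "finite Y" "finite Y'" using YW \<open>finite W\<close> finite_subset by auto
    have "sum c (Y \<union> Y') + sum c (Y \<inter> Y') = sum c Y + sum c Y'"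
      by (rule sum.union_inter[OF fY])
    moreover have "i (Y \<inter> Y') \<le> sum c (Y \<inter> Y') + r" using bound[of "Y \<inter> Y'"] YW by force
    moreover have "i (Y \<union> Y') \<le> sum c (Y \<union> Y') + r" using bound[of "Y \<union> Y'"] YW by force
    ultimately show ?thesis using i_super[of Y Y'] that YW unfolding tight_def by auto
  qed
  show ?case
  proof (cases "\<exists>Y. tight Y")
    \<comment> \<open>Without a tight set all inequalities for \<open>F\<close> hold with
      \<open>r - 1\<close>, so \<open>e\<close> can be discarded. The empty set would be tight for
      \<open>r = 0\<close>.\<close>
    case False
    have r: "r \<noteq> 0"
    proof
      assume r0: "r = 0"
      have emp: "{f \<in> F. ends f = {}} = {}" using insert.prems(1) by auto
      have "tight {}" by (simp add: tight_def i_def emp r0)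
      with False show False by blast
    qed
    have "card {f \<in> F. ends f \<subseteq> Y} \<le> sum c Y + (r - 1)" if "Y \<subseteq> W" for Y
    proof -
      have "i Y \<noteq> sum c Y + r" using False that by (auto simp: tight_def)
      moreover have "i Y \<le> sum c Y + r" using bound[OF that] by simp
      ultimately show ?thesis using r unfolding i_def by linarith
    qed
    then obtain X own where X: "X \<subseteq> F" "card X \<le> r - 1" "\<forall>f\<in>F - X. own f \<in> ends f"
      "\<forall>w\<in>W. card {f \<in> F - X. own f = w} \<le> c w"
      using insert.IH[of c "r - 1"] insert.prems(1) by auto
    have eq: "insert e F - insert e X = F - X" using insert.hyps by auto
    have "finite X" using X(1) insert.hyps finite_subset by auto
    then have "card (insert e X) \<le> r" using X(2) r
      by (intro card_insert_le_m1) auto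
    then show ?thesis
      using X eq by (intro exI[of _ "insert e X"] exI[of _ own]) auto
  next
    case True
    have "finite {Y. tight Y}"
      by (rule finite_subset[of _ "Pow W"]) (use \<open>finite W\<close> in \<open>auto simp: tight_def\<close>)
    \<comment> \<open>By closure under union, the maximal tight set contains every tight set. It
      does not contain all of \<open>ends e\<close>, since the hypothesis for \<open>F\<close> with
      \<open>e\<close> would fail there. An end \<open>v\<close> outside it lies in no tight set, so
      one unit of its capacity can be spent on \<open>e\<close>.\<close>
    then obtain Y0 where Y0: "tight Y0" and mx: "\<And>Y. tight Y \<Longrightarrow> Y0 \<subseteq> Y \<Longrightarrow> Y = Y0"
      using True finite_has_maximal[of "{Y. tight Y}"] by (metis (mono_tags, lifting) empty_Collect_eq mem_Collect_eq)
    have Y0W: "Y0 \<subseteq> W" and fY0: "finite Y0" using Y0 \<open>finite W\<close> finite_subset by (auto simp: tight_def)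
    have "\<not> ends e \<subseteq> Y0" using bound[OF Y0W] Y0 by (auto simp: tight_def)
    then obtain v where v: "v \<in> ends e" "v \<notin> Y0" by auto
    have vW: "v \<in> W" using v insert.prems(1) by auto
    have not_tight: "\<not> tight Y" if "v \<in> Y" for Y
      using mx[of "Y0 \<union> Y"] tight_Un[OF Y0] that v by auto
    have cv: "c v > 0"
    proof -
      have "i (insert v Y0) \<noteq> sum c (insert v Y0) + r"
        using not_tight[of "insert v Y0"] Y0W vW by (auto simp: tight_def)
      moreover have "i (insert v Y0) \<le> sum c (insert v Y0) + r"
        using bound[of "insert v Y0"] Y0W vW by simp
      moreover have "i Y0 \<le> i (insert v Y0)" by (rule i_mono) auto
      moreover have "i Y0 = sum c Y0 + r" using Y0 by (simp add: tight_def)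
      ultimately show ?thesis using fY0 v by simp
    qed
    define c' where "c' = c(v := c v - 1)"
    have "card {f \<in> F. ends f \<subseteq> Y} \<le> sum c' Y + r" if YW: "Y \<subseteq> W" for Y
    proof (cases "v \<in> Y")
      case True
      have fY: "finite Y" using YW \<open>finite W\<close> finite_subset by auto
      have "sum c' Y = c' v + sum c' (Y - {v})" using True fY by (simp add: sum.remove)
      also have "sum c' (Y - {v}) = sum c (Y - {v})" by (rule sum.cong) (auto simp: c'_def)
      finally have "sum c' Y + 1 = sum c Y" using cv True fY by (simp add: sum.remove c'_def)
      moreover have "i Y \<noteq> sum c Y + r" using not_tight[OF True] YW by (auto simp: tight_def)
      ultimately show ?thesis using bound[OF YW] unfolding i_def by linarith
    next
      case False
      have "sum c' Y = sum c Y" by (rule sum.cong) (use False in \<open>auto simp: c'_def\<close>)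
      then show ?thesis using bound[OF YW] unfolding i_def by linarith
    qed
    then obtain X own where X: "X \<subseteq> F" "card X \<le> r" "\<forall>f\<in>F - X. own f \<in> ends f"
      "\<forall>w\<in>W. card {f \<in> F - X. own f = w} \<le> c' w"
      using insert.IH[of c' r] insert.prems(1) by auto
    define own' where "own' = own(e := v)"
    have eX: "e \<notin> X" using X(1) insert.hyps by auto
    have "card {f \<in> insert e F - X. own' f = w} \<le> c w" if "w \<in> W" for w
    proof (cases "w = v")
      case True
      have "{f \<in> insert e F - X. own' f = w} = insert e {f \<in> F - X. own f = v}"
        using eX True insert.hyps by (auto simp: own'_def)
      moreover have "e \<notin> {f \<in> F - X. own f = v}" "finite {f \<in> F - X. own f = v}"
        using insert.hyps by auto
      ultimately have "card {f \<in> insert e F - X. own' f = w} = Suc (card {f \<in> F - X. own f = v})" by simp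
      also have "\<dots> \<le> Suc (c' v)" using X(4) vW by auto
      also have "\<dots> = c w" using cv True by (simp add: c'_def)
      finally show ?thesis .
    next
      case False
      have "{f \<in> insert e F - X. own' f = w} = {f \<in> F - X. own f = w}"
        using False insert.hyps by (auto simp: own'_def)
      then show ?thesis using X(4) that False by (auto simp: c'_def)
    qed
    moreover have "\<forall>f\<in>insert e F - X. own' f \<in> ends f" using X(3) v by (auto simp: own'_def)
    ultimately show ?thesis using X by (intro exI[of _ X] exI[of _ own']) auto
  qed
qed

subsection \<open>Counting paths of length four in sparse triangle-free graphs\<close>

text \<open>Hypotheses without a drawing: the estimates are applied to an arbitrary plane graph, and
  the exact formulas to the extremal graph.\<close>

locale sparse_triangle_free =
  fixes V :: "'a set" and adj :: "'a \<Rightarrow> 'a \<Rightarrow> bool" and u1 u2 u3 :: 'a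
  assumes finV: "finite V"
    and adjV: "adj a b \<Longrightarrow> a \<in> V"
    and sym: "adj a b \<Longrightarrow> adj b a"
    and irr: "\<not> adj a a"
    and tri: "adj a b \<Longrightarrow> adj b c \<Longrightarrow> \<not> adj c a"
    and sparse: "X \<subseteq> V \<Longrightarrow> 3 \<le> card X \<Longrightarrow>
        card {{a, b} | a b. a \<in> X \<and> b \<in> X \<and> adj a b} + 4 \<le> 2 * card X"
    and U_in_V: "{u1, u2, u3} \<subseteq> V"
    and U_distinct: "u1 \<noteq> u2" "u2 \<noteq> u3" "u1 \<noteq> u3"
begin

lemma sym_iff: "adj a b \<longleftrightarrow> adj b a"
  using sym by blast

definition "U = {u1, u2, u3}"
definition "W = V - U"

lemma finU: "finite U" by (simp add: U_def)
lemma finW: "finite W" using finV by (simp add: W_def)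
lemma card_U: "card U = 3" using U_distinct by (simp add: U_def)

lemma adj_cases: "adj a b \<Longrightarrow> b \<in> U \<or> b \<in> W"
  using adjV sym unfolding W_def by blast

section \<open>Decomposition of the path counts by the place of the third terminal\<close>

definition "paths4 u v = {(a, x, b). adj u a \<and> adj a x \<and> adj x b \<and> adj b v \<and> distinct [u, a, x, b, v]}"

definition "chi u a = (of_bool (adj u a) :: real)"

definition "h u x = (\<Sum>a\<in>{a\<in>W. adj x a}. chi u a)"
definition "pr u v x = h u x * h v x - (\<Sum>a\<in>{a\<in>W. adj x a}. chi u a * chi v a)"

text \<open>The tails of the paths u, k, x, b, v in which the third terminal comes directly after u;
  read backwards they serve for the place before v.\<close>

definition "R k v = {(x, b). x \<in> W \<and> b \<in> W \<and> adj k x \<and> adj x b \<and> adj b v}"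

lemma finite_R: "finite (R k v)"
  by (rule finite_subset[of _ "W \<times> W"]) (auto simp: R_def finW)

lemma pr_eq_card:
  "pr u v x = real (card {(a, b). a \<in> W \<and> b \<in> W \<and> adj x a \<and> adj u a \<and> adj x b \<and> adj v b \<and> a \<noteq> b})"
    (is "_ = real (card ?A)")
proof -
  let ?B = "{a\<in>W. adj x a \<and> adj u a}" and ?C = "{a\<in>W. adj x a \<and> adj v a}"
  have fin: "finite ?B" "finite ?C" "finite (?B \<inter> ?C)" using finW by auto
  have count: "(\<Sum>a\<in>{a\<in>W. adj x a}. if Q a then 1 else 0) = real (card {a\<in>W. adj x a \<and> Q a})" for Q
    using finW by (simp add: sum.If_cases Int_def conj_assoc)
  have hB: "h u x = card ?B" and hC: "h v x = card ?C"
    unfolding h_def chi_def of_bool_def by (rule count)+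
  have "(\<Sum>a\<in>{a\<in>W. adj x a}. chi u a * chi v a) = (\<Sum>a\<in>{a\<in>W. adj x a}. if adj u a \<and> adj v a then 1 else 0)"
    by (rule sum.cong) (auto simp: chi_def)
  also have "\<dots> = card {a\<in>W. adj x a \<and> adj u a \<and> adj v a}" by (rule count)
  also have "{a\<in>W. adj x a \<and> adj u a \<and> adj v a} = ?B \<inter> ?C" by auto
  finally have hBC: "(\<Sum>a\<in>{a\<in>W. adj x a}. chi u a * chi v a) = card (?B \<inter> ?C)" .
  have "card ?B * card ?C = card (?B \<times> ?C)" by (rule card_cartesian_product[symmetric])
  also have "?B \<times> ?C = ?A \<union> (\<lambda>a. (a, a)) ` (?B \<inter> ?C)" by auto
  also have "card (?A \<union> (\<lambda>a. (a, a)) ` (?B \<inter> ?C)) = card ?A + card ((\<lambda>a. (a, a)) ` (?B \<inter> ?C))"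
  proof (rule card_Un_disjoint)
    show "finite ?A" by (rule finite_subset[of _ "W \<times> W"]) (use finW in auto)
  qed (use fin in auto)
  also have "card ((\<lambda>a. (a, a)) ` (?B \<inter> ?C)) = card (?B \<inter> ?C)"
    by (rule card_image) (auto simp: inj_on_def)
  finally have "real (card ?B * card ?C) = real (card ?A + card (?B \<inter> ?C))" by (rule arg_cong)
  then show ?thesis unfolding pr_def hB hC hBC of_nat_add of_nat_mult by linarith
qed

lemma pr_nonneg: "pr u v x \<ge> 0"
  by (simp add: pr_eq_card)

text \<open>The terms sort the paths by the place of \<open>k\<close>: in the middle, nowhere,
  directly after \<open>u\<close>, directly before \<open>v\<close>. In the last two cases the two
  other inner vertices are adjacent members of \<open>W\<close>, so they are distinct from each
  other and from the terminals.\<close>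

lemma card_paths4:
  assumes "U = {u, v, k}" "u \<noteq> v" "v \<noteq> k" "u \<noteq> k"
  shows "real (card (paths4 u v)) = pr u v k + (\<Sum>x\<in>W. pr u v x)
    + of_bool (adj u k) * real (card (R k v)) + of_bool (adj v k) * real (card (R k u))"
proof -
  have fP: "finite (paths4 u v)"
    by (rule finite_subset[of _ "V \<times> V \<times> V"]) (use finV adjV in \<open>auto simp: paths4_def\<close>)
  have Wn: "x \<notin> W" if "x \<in> U" for x using that by (auto simp: W_def)
  have kW: "k \<notin> W" "u \<notin> W" "v \<notin> W" using Wn assms(1) by auto
  have inW: "x \<in> W" if "adj y x" "x \<noteq> u" "x \<noteq> v" "x \<noteq> k" for x y
    using adj_cases[OF that(1)] that assms(1) by auto
  define pairs where "pairs x = {(a, b). a \<in> W \<and> b \<in> W \<and> adj x a \<and> adj u a \<and> adj x b \<and> adj v b \<and> a \<noteq> b}" for x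
  have fpairs: "finite (pairs x)" for x
    by (rule finite_subset[of _ "W \<times> W"]) (auto simp: pairs_def finW)
  let ?T1 = "(\<lambda>(a, b). (a, k, b)) ` pairs k"
  let ?T2 = "(\<lambda>(x, a, b). (a, x, b)) ` (SIGMA x:W. pairs x)"
  let ?T3 = "if adj u k then (\<lambda>(x, b). (k, x, b)) ` R k v else {}"
  let ?T4 = "if adj v k then (\<lambda>(x, b). (b, x, k)) ` R k u else {}"
  have eq: "paths4 u v = ?T1 \<union> ?T2 \<union> ?T3 \<union> ?T4" (is "?L = ?R")
  proof
    show "?L \<subseteq> ?R"
    proof
      fix z assume z: "z \<in> ?L"
      obtain a x b where zz: "z = (a, x, b)" by (cases z)
      have p: "adj u a" "adj a x" "adj x b" "adj b v" "u \<noteq> a" "u \<noteq> x" "u \<noteq> b" "a \<noteq> x" "a \<noteq> b" "a \<noteq> v" "x \<noteq> b" "x \<noteq> v" "b \<noteq> v"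
        using z zz by (auto simp: paths4_def)
      consider "x = k" | "a = k" | "b = k" | "x \<noteq> k" "a \<noteq> k" "b \<noteq> k" by blast
      then show "z \<in> ?R"
      proof cases
        case 1
        then have "(a, b) \<in> pairs k"
          using p inW[of u a] inW[of v b] sym by (auto simp: pairs_def)
        then show ?thesis using 1 zz by force
      next
        case 2
        then have "(x, b) \<in> R k v" using p inW[of a x] inW[of x b] by (auto simp: R_def)
        then show ?thesis using 2 zz p by force
      next
        case 3
        then have "(x, a) \<in> R k u" using p inW[of a x] inW[of u a] sym by (auto simp: R_def)
        moreover have "adj v k" using 3 p sym by auto
        ultimately show ?thesis using 3 zz by force
      next
        case 4
        then have "x \<in> W" "(a, b) \<in> pairs x"
          using p inW[of u a] inW[of x b] inW[of a x] sym by (auto simp: pairs_def)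
        then have "(x, a, b) \<in> (SIGMA x:W. pairs x)" by auto
        then show ?thesis using zz by force
      qed
    qed
    show "?R \<subseteq> ?L"
    proof
      fix z assume "z \<in> ?R"
      then consider "z \<in> ?T1" | "z \<in> ?T2" | "z \<in> ?T3" | "z \<in> ?T4" by blast
      then show "z \<in> ?L"
      proof cases
        case 1
        then show ?thesis using kW assms irr sym by (auto simp: pairs_def paths4_def)
      next
        case 2
        then show ?thesis using kW assms irr sym by (auto simp: pairs_def paths4_def)
      next
        case 3
        then show ?thesis using kW assms irr sym by (auto simp: R_def paths4_def split: if_splits)
      next
        case 4
        then show ?thesis using kW assms irr sym by (auto simp: R_def paths4_def split: if_splits)
      qed
    qed
  qed
  have fin: "finite ?T1" "finite ?T2" "finite ?T3" "finite ?T4"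
    using fpairs finite_R finW by auto
  have "card (paths4 u v) = card ?T1 + card ?T2 + card ?T3 + card ?T4"
  proof -
    have d1: "?T1 \<inter> ?T2 = {}" using kW by (auto simp: pairs_def)
    have d2: "(?T1 \<union> ?T2) \<inter> ?T3 = {}" using kW by (auto simp: pairs_def split: if_splits)
    have d3: "(?T1 \<union> ?T2 \<union> ?T3) \<inter> ?T4 = {}" using kW by (auto simp: pairs_def R_def split: if_splits)
    show ?thesis unfolding eq
      using fin d1 d2 d3 by (simp only: card_Un_disjoint finite_Un simp_thms)
  qed
  moreover have "card ?T1 = card (pairs k)" by (rule card_image) (auto simp: inj_on_def)
  moreover have "card ?T2 = (\<Sum>x\<in>W. card (pairs x))"
  proof -
    have "card ?T2 = card (SIGMA x:W. pairs x)" by (rule card_image) (auto simp: inj_on_def)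
    then show ?thesis using finW fpairs by simp
  qed
  moreover have "card ?T3 = (if adj u k then card (R k v) else 0)"
    by (auto simp: inj_on_def intro!: card_image)
  moreover have "card ?T4 = (if adj v k then card (R k u) else 0)"
    by (auto simp: inj_on_def intro!: card_image)
  moreover have "pr u v x = real (card (pairs x))" for x
    unfolding pr_eq_card pairs_def by simp
  ultimately show ?thesis by simp
qed

section \<open>Estimates for the paths with a given middle vertex\<close>

definition "d a = card {u\<in>U. adj u a}"

lemma d_chi: "real (d a) = chi u1 a + chi u2 a + chi u3 a"
proof -
  have "{u\<in>U. adj u a} = (if adj u1 a then {u1} else {}) \<union> (if adj u2 a then {u2} else {}) \<union> (if adj u3 a then {u3} else {})"
    by (auto simp: U_def)
  then show ?thesis using U_distinct by (auto simp: d_def chi_def)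
qed

text \<open>The number of pairs of terminals that have \<open>a\<close> as a common neighbour, that
  is, the coincidences to be subtracted for \<open>a\<close>.\<close>

definition "g a = chi u1 a * chi u2 a + chi u2 a * chi u3 a + chi u1 a * chi u3 a"

lemma g_d: "g a = real (d a) * (real (d a) - 1) / 2"
  unfolding d_chi g_def chi_def by simp

lemma d_le_3: "d a \<le> 3"
  using card_mono[OF finU, of "{u\<in>U. adj u a}"] card_U by (simp add: d_def)

definition "P x = pr u1 u2 x + pr u2 u3 x + pr u1 u3 x"

lemma sum_h: "h u1 x + h u2 x + h u3 x = (\<Sum>a\<in>{a\<in>W. adj x a}. real (d a))"
  by (simp add: h_def d_chi sum.distrib)

lemma P_eq: "P x = h u1 x * h u2 x + h u2 x * h u3 x + h u1 x * h u3 x - (\<Sum>a\<in>{a\<in>W. adj x a}. g a)"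
  by (simp add: P_def pr_def g_def sum.distrib)

text \<open>Equality holds at a = b = c, which is why equal sizes of A, B and C are best possible in
  H_n.\<close>

lemma three_products_le:
  fixes a b c :: real
  shows "3 * (a * b + b * c + a * c) \<le> (a + b + c)\<^sup>2"
proof -
  have "(a + b + c)\<^sup>2 - 3 * (a * b + b * c + a * c) = ((a - b)\<^sup>2 + (b - c)\<^sup>2 + (a - c)\<^sup>2) / 2"
    by (simp add: power2_eq_square algebra_simps)
  moreover have "\<dots> \<ge> 0" by simp
  ultimately show ?thesis by linarith
qed

lemma P_le: "3 * (P x + (\<Sum>a\<in>{a\<in>W. adj x a}. g a)) \<le> (\<Sum>a\<in>{a\<in>W. adj x a}. real (d a))\<^sup>2"
  unfolding P_eq sum_h[symmetric]
  using three_products_le[of "h u1 x" "h u2 x" "h u3 x"] by simp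

lemma h_eq_0: "adj x u \<Longrightarrow> h u x = 0"
proof -
  assume "adj x u"
  then have "\<not> adj u a" if "adj x a" for a using tri[of x u a] sym_iff[of a x] that by blast
  then show ?thesis unfolding h_def chi_def by (intro sum.neutral) auto
qed

lemma U_cases: "u \<in> U \<Longrightarrow> u = u1 \<or> u = u2 \<or> u = u3" by (auto simp: U_def)

text \<open>Triangle-freeness gives \<open>h u x = 0\<close>, so one product of two numbers
  survives, and it is at most a quarter of the squared sum. The gain over the factor 3 leaves room
  for the paths that use edges inside \<open>U\<close>.\<close>

lemma P_le_typed:
  assumes "u \<in> U" "adj x u"
  shows "4 * (P x + (\<Sum>a\<in>{a\<in>W. adj x a}. g a)) \<le> (\<Sum>a\<in>{a\<in>W. adj x a}. real (d a))\<^sup>2"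
proof -
  have sq: "4 * (a * b) \<le> (a + b)\<^sup>2" for a b :: real
  proof -
    have "(a + b)\<^sup>2 - 4 * (a * b) = (a - b)\<^sup>2" by (simp add: power2_eq_square algebra_simps)
    moreover have "\<dots> \<ge> 0" by simp
    ultimately show ?thesis by linarith
  qed
  have h0: "h u x = 0" by (rule h_eq_0[OF assms(2)])
  let ?S = "\<Sum>a\<in>{a\<in>W. adj x a}. g a"
  have "\<exists>a b. P x + ?S = a * b \<and> (\<Sum>a\<in>{a\<in>W. adj x a}. real (d a)) = a + b"
  proof -
    consider "u = u1" | "u = u2" | "u = u3" using U_cases[OF assms(1)] by blast
    then show ?thesis
    proof cases
      case 1
      then have "h u1 x = 0" using h0 by simp
      then show ?thesis unfolding P_eq sum_h[symmetric]
        by (intro exI[of _ "h u2 x"] exI[of _ "h u3 x"]) simp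
    next
      case 2
      then have "h u2 x = 0" using h0 by simp
      then show ?thesis unfolding P_eq sum_h[symmetric]
        by (intro exI[of _ "h u1 x"] exI[of _ "h u3 x"]) simp
    next
      case 3
      then have "h u3 x = 0" using h0 by simp
      then show ?thesis unfolding P_eq sum_h[symmetric]
        by (intro exI[of _ "h u1 x"] exI[of _ "h u2 x"]) simp
    qed
  qed
  then show ?thesis using sq by metis
qed

text \<open>At least two of the three \<open>h\<close> vanish at \<open>x\<close>, and each product
  contains one of them.\<close>

lemma P_eq_0:
  assumes "d x \<ge> 2"
  shows "P x = 0"
proof -
  have *: "pr u v x = 0" if h0: "h u x = 0 \<or> h v x = 0" for u v
  proof -
    have "(\<Sum>a\<in>{a\<in>W. adj x a}. chi u a * chi v a) \<ge> 0"
      by (intro sum_nonneg) (simp add: chi_def)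
    moreover have "h u x * h v x = 0" using h0 by (rule disjE) simp_all
    ultimately show ?thesis using pr_nonneg[of u v x] unfolding pr_def by linarith
  qed
  have h0: "h u x = 0" if "adj u x" for u using that h_eq_0 sym_iff by metis
  have "(adj u1 x \<and> adj u2 x) \<or> (adj u2 x \<and> adj u3 x) \<or> (adj u1 x \<and> adj u3 x)"
  proof -
    have "2 \<le> chi u1 x + chi u2 x + chi u3 x" using d_chi[of x] assms by linarith
    then show ?thesis unfolding chi_def
      by (cases "adj u1 x"; cases "adj u2 x"; cases "adj u3 x") simp_all
  qed
  then have "(h u1 x = 0 \<or> h u2 x = 0) \<and> (h u2 x = 0 \<or> h u3 x = 0) \<and> (h u1 x = 0 \<or> h u3 x = 0)"
    using h0 by metis
  then show ?thesis unfolding P_def using *[of u1 u2] *[of u2 u3] *[of u1 u3] by linarith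
qed

text \<open>The two neighbours of the middle vertex on such a path are distinct and each adjacent to
  a terminal.\<close>

lemma P_eq_0_small:
  assumes "card {a\<in>W. adj x a \<and> d a > 0} \<le> 1"
  shows "P x = 0"
proof -
  have "pr u v x = 0" if "u \<in> U" "v \<in> U" for u v
  proof -
    let ?M = "{a\<in>W. adj x a \<and> d a > 0}"
    have typed: "d a > 0" if "adj w a" "w \<in> U" for w a
      using that finU by (auto simp: d_def card_gt_0_iff)
    have "{(a, b). a \<in> W \<and> b \<in> W \<and> adj x a \<and> adj u a \<and> adj x b \<and> adj v b \<and> a \<noteq> b} = {}"
    proof (rule ccontr)
      assume "\<not> ?thesis"
      then obtain a b where ab: "a \<in> W" "b \<in> W" "adj x a" "adj u a" "adj x b" "adj v b" "a \<noteq> b" by auto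
      then have "a \<in> ?M" "b \<in> ?M" using typed[OF ab(4)] typed[OF ab(6)] that by auto
      with ab have "a \<in> ?M" "b \<in> ?M" "a \<noteq> b" by auto
      then have "card {a, b} \<le> card ?M" using finW by (intro card_mono) auto
      then show False using \<open>a \<noteq> b\<close> assms by simp
    qed
    then show ?thesis unfolding pr_eq_card by (simp only: card.empty of_nat_0)
  qed
  then show ?thesis by (simp add: P_def U_def)
qed

definition "T = real (card (paths4 u1 u2)) + real (card (paths4 u2 u3)) + real (card (paths4 u1 u3))"

definition "TU = pr u1 u2 u3 + pr u2 u3 u1 + pr u1 u3 u2"

text \<open>The paths that use the edge between \<open>u\<close> and \<open>k\<close>: from
  \<open>u\<close> over \<open>k\<close> to \<open>v\<close>, and from \<open>k\<close> over
  \<open>u\<close> to \<open>v\<close>.\<close>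

definition "extra u k v = of_bool (adj u k) * (real (card (R k v)) + real (card (R u v)))"

lemma T_eq: "T = TU + (\<Sum>x\<in>W. P x) + extra u1 u2 u3 + extra u2 u3 u1 + extra u1 u3 u2"
proof -
  have c: "U = {u1, u2, u3}" "U = {u2, u3, u1}" "U = {u1, u3, u2}" by (auto simp: U_def)
  have s: "adj u2 u1 = adj u1 u2" "adj u3 u2 = adj u2 u3" "adj u3 u1 = adj u1 u3"
    by (rule sym_iff)+
  note p = card_paths4[OF c(1) U_distinct] card_paths4[OF c(2) U_distinct(2) U_distinct(3)[symmetric] U_distinct(1)[symmetric]]
    card_paths4[OF c(3) U_distinct(3) U_distinct(2)[symmetric] U_distinct(1)]
  show ?thesis
    unfolding T_def TU_def extra_def P_def p s
    by (simp add: sum.distrib algebra_simps)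
qed

end

subsection \<open>Ownership of edges\<close>

context sparse_triangle_free
begin

definition "Z = {a\<in>W. d a = 3}"
definition "M = W - Z"
definition "eU = (of_bool (adj u1 u2) + of_bool (adj u2 u3) + of_bool (adj u1 u3) :: nat)"
text \<open>These are all edges inside \<open>W\<close>: two members of \<open>Z\<close> have a
  common neighbour and cannot be adjacent. The form guarantees an end in \<open>M\<close>, where the
  owner is sought.\<close>

definition "F = {{a, b} | a b. a \<in> M \<and> b \<in> W \<and> adj a b}"

lemma finM: "finite M" and finZ: "finite Z"
  using finW by (auto simp: M_def Z_def)

lemma M_W: "M \<subseteq> W" by (auto simp: M_def)

lemma d_le_2: "a \<in> M \<Longrightarrow> d a \<le> 2"
  using d_le_3[of a] by (auto simp: M_def Z_def)

lemma finF: "finite F"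
  by (rule finite_subset[of _ "Pow W"]) (use finW M_W in \<open>auto simp: F_def\<close>)

lemma W_U: "a \<in> W \<Longrightarrow> a \<notin> U" by (auto simp: W_def)

lemma U_edge_count:
  "card {{a, b} | a b. a \<in> U \<and> b \<in> U \<and> adj a b} = eU"
proof -
  have eq: "{{a, b} | a b. a \<in> U \<and> b \<in> U \<and> adj a b} =
    (if adj u1 u2 then {{u1, u2}} else {}) \<union> (if adj u2 u3 then {{u2, u3}} else {}) \<union> (if adj u1 u3 then {{u1, u3}} else {})"
    using irr sym_iff[of u2 u1] sym_iff[of u3 u2] sym_iff[of u3 u1]
    by (auto simp: U_def insert_commute split: if_splits)
  have ne: "{u1, u2} \<noteq> {u2, u3}" "{u1, u2} \<noteq> {u1, u3}" "{u2, u3} \<noteq> {u1, u3}"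
    using U_distinct by (auto simp: doubleton_eq_iff)
  show ?thesis unfolding eq eU_def using ne by auto
qed

text \<open>The edge bound for \<open>U\<close>, \<open>Z\<close> and \<open>Y\<close> together
  allows 2(3 + |Z| + |Y|) - 4 edges. Of these 3|Z| + \<open>sum d Y\<close> + \<open>eU\<close> have
  an end in \<open>U\<close>. Each member of \<open>Z\<close> brings one edge more than it allows,
  so |Z| and \<open>eU\<close> are taken from the reserve 2 = 2 * 3 - 4.\<close>

lemma capacity_condition:
  assumes "Y \<subseteq> M"
  shows "card {f\<in>F. f \<inter> M \<subseteq> Y} + card Z + eU \<le> (\<Sum>w\<in>Y. 2 - d w) + 2"
proof -
  let ?X = "U \<union> Z \<union> Y"
  have fY: "finite Y" using assms finM finite_subset by auto
  have disj: "U \<inter> (Z \<union> Y) = {}" "Z \<inter> Y = {}"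
    using assms M_W W_U by (auto simp: Z_def M_def)
  have cX: "card ?X = 3 + card Z + card Y"
    using card_Un_disjoint[of U "Z \<union> Y"] card_Un_disjoint[of Z Y] disj finU finZ fY card_U
    by (simp add: Un_assoc)
  have XV: "?X \<subseteq> V" using U_in_V assms M_W by (auto simp: U_def Z_def W_def)
  let ?E = "{{a, b} | a b. a \<in> ?X \<and> b \<in> ?X \<and> adj a b}"
  have sE: "card ?E + 4 \<le> 2 * card ?X" by (rule sparse[OF XV]) (simp add: cX)
  let ?A = "{f\<in>F. f \<inter> M \<subseteq> Y}"
  let ?B = "(\<lambda>(a, u). {a, u}) ` (SIGMA a:Z \<union> Y. {u\<in>U. adj u a})"
  let ?C = "{{a, b} | a b. a \<in> U \<and> b \<in> U \<and> adj a b}"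
  have fin: "finite ?A" "finite ?B" "finite ?C"
    using finF finZ fY finU by (auto intro: finite_subset[of _ "Pow U"])
  have fE: "finite ?E"
    by (rule finite_subset[of _ "Pow ?X"]) (use finU finZ fY in auto)
  have sub: "?A \<union> ?B \<union> ?C \<subseteq> ?E"
  proof -
    have "?A \<subseteq> ?E"
    proof
      fix f assume "f \<in> ?A"
      then obtain a b where f: "f = {a, b}" "a \<in> M" "b \<in> W" "adj a b" "f \<inter> M \<subseteq> Y" by (auto simp: F_def)
      then have "a \<in> Y" "b \<in> Z \<or> b \<in> Y" by (auto simp: M_def)
      then show "f \<in> ?E" using f by blast
    qed
    moreover have "?B \<subseteq> ?E" using sym_iff by fastforce
    moreover have "?C \<subseteq> ?E" by blast
    ultimately show ?thesis by (intro Un_least)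
  qed
  have U_A: "f \<inter> U = {}" if "f \<in> ?A" for f
    using that M_W W_U by (auto simp: F_def)
  have U_B: "\<exists>a u. f = {a, u} \<and> a \<notin> U \<and> u \<in> U" if "f \<in> ?B" for f
    using that disj by auto
  have "?A \<inter> ?B = {}"
  proof (rule Int_emptyI)
    fix f assume f: "f \<in> ?A" "f \<in> ?B"
    from U_A[OF f(1)] U_B[OF f(2)] show False by blast
  qed
  moreover have "(?A \<union> ?B) \<inter> ?C = {}"
  proof (rule Int_emptyI)
    fix f assume f: "f \<in> ?A \<union> ?B" "f \<in> ?C"
    from f(2) have U: "f \<subseteq> U" "f \<noteq> {}" by auto
    from f(1) show False
    proof
      assume "f \<in> ?A" from U_A[OF this] U show False by blast
    next
      assume "f \<in> ?B" from U_B[OF this] U show False by blast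
    qed
  qed
  ultimately have "card ?A + card ?B + card ?C \<le> card ?E"
    using card_mono[OF fE sub] fin by (simp only: card_Un_disjoint finite_Un simp_thms)
  moreover have "card ?B = 3 * card Z + sum d Y"
  proof -
    have "inj_on (\<lambda>(a, u). {a, u}) (SIGMA a:Z \<union> Y. {u\<in>U. adj u a})"
      using disj by (auto simp: inj_on_def doubleton_eq_iff)
    then have "card ?B = sum d (Z \<union> Y)"
      using finZ fY finU by (simp add: card_image d_def)
    also have "\<dots> = sum d Z + sum d Y" by (rule sum.union_disjoint[OF finZ fY disj(2)])
    also have "sum d Z = 3 * card Z" by (simp add: Z_def)
    finally show ?thesis .
  qed
  moreover have "(\<Sum>w\<in>Y. 2 - d w) + sum d Y = 2 * card Y"
  proof -
    have "(\<Sum>w\<in>Y. 2 - d w) + sum d Y = (\<Sum>w\<in>Y. 2)"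
      unfolding sum.distrib[symmetric] using assms d_le_2 by (intro sum.cong) auto
    then show ?thesis by simp
  qed
  ultimately show ?thesis using sE U_edge_count cX by linarith
qed

lemma t_eU: "card Z + eU \<le> 2"
  using capacity_condition[of "{}"] by simp

text \<open>Owners are sought in \<open>M\<close> only, so the ends handed to the Hall-type theorem
  are \<open>f \<inter> M\<close>. The deficiency is 2 - |Z| - eU, a proper difference of naturals
  by \<open>t_eU\<close>.\<close>

lemma exists_ownership:
  "\<exists>eps own. eps \<subseteq> F \<and> card eps + card Z + eU \<le> 2 \<and>
     (\<forall>f\<in>F - eps. own f \<in> f \<inter> M) \<and> (\<forall>w\<in>M. card {f\<in>F - eps. own f = w} \<le> 2 - d w)"
proof -
  have "\<exists>X own. X \<subseteq> F \<and> card X \<le> 2 - card Z - eU \<and> (\<forall>f\<in>F - X. own f \<in> f \<inter> M) \<and>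
           (\<forall>w\<in>M. card {f \<in> F - X. own f = w} \<le> 2 - d w)"
  proof (rule exists_capacitated_owner[OF finF finM])
    show "f \<inter> M \<subseteq> M \<and> f \<inter> M \<noteq> {}" if "f \<in> F" for f using that by (auto simp: F_def)
    show "card {f \<in> F. f \<inter> M \<subseteq> Y} \<le> (\<Sum>w\<in>Y. 2 - d w) + (2 - card Z - eU)" if "Y \<subseteq> M" for Y
      using capacity_condition[OF that] t_eU by linarith
  qed
  then obtain X own where "X \<subseteq> F" "card X \<le> 2 - card Z - eU" "\<forall>f\<in>F - X. own f \<in> f \<inter> M"
           "\<forall>w\<in>M. card {f \<in> F - X. own f = w} \<le> 2 - d w" by blast
  then show ?thesis using t_eU by (intro exI[of _ X] exI[of _ own]) auto
qed

section \<open>Paths whose middle vertex is a terminal\<close>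

definition "common u v = (\<Sum>a\<in>W. chi u a * chi v a)"

lemma sum_g_W: "(\<Sum>a\<in>W. g a) = real (card {w\<in>M. d w = 2}) + 3 * real (card Z)"
proof -
  have ind: "real (card {a\<in>W. d a = k}) = (\<Sum>a\<in>W. if d a = k then 1 else 0)" for k
    using finW by (simp add: sum.If_cases Int_def)
  have e: "{w\<in>M. d w = 2} = {a\<in>W. d a = 2}" "Z = {a\<in>W. d a = 3}" by (auto simp: M_def Z_def)
  have "(\<Sum>a\<in>W. g a) = (\<Sum>a\<in>W. (if d a = 2 then 1 else 0) + 3 * (if d a = 3 then 1 else 0))"
  proof (rule sum.cong)
    fix a
    have "d a = 0 \<or> d a = 1 \<or> d a = 2 \<or> d a = 3" using d_le_3[of a] by linarith
    then show "g a = (if d a = 2 then 1 else 0) + 3 * (if d a = 3 then 1 else 0)"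
      by (auto simp: g_d)
  qed simp
  then show ?thesis unfolding e ind sum.distrib sum_distrib_left[symmetric] by simp
qed

lemma sum_common: "common u1 u2 + common u2 u3 + common u1 u3 = (\<Sum>a\<in>W. g a)"
  by (simp add: common_def g_def sum.distrib)

text \<open>Seen from the middle vertex k in \<open>U\<close>, \<open>h u k\<close> counts the
  common neighbours of u and k, and both choices of a neighbour coincide exactly in the members of
  \<open>Z\<close>. Hence |Z| is subtracted once for each of the three middle vertices.\<close>

lemma TU_eq:
  "TU = common u1 u3 * common u2 u3 + common u1 u2 * common u1 u3 + common u1 u2 * common u2 u3 - 3 * real (card Z)"
proof -
  have s_comm: "common u v = common v u" for u v by (simp add: common_def mult.commute)
  have h: "h u k = common u k" for u k
  proof -
    have "h u k = (\<Sum>a\<in>W. if adj k a then chi u a else 0)"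
      unfolding h_def using finW by (simp add: sum.If_cases Int_def)
    also have "\<dots> = common u k" unfolding common_def by (rule sum.cong) (auto simp: chi_def)
    finally show ?thesis .
  qed
  have c: "(\<Sum>a\<in>{a\<in>W. adj k a}. chi u a * chi v a) = real (card Z)" if "{u, v, k} = U" for u v k
  proof -
    have "(\<Sum>a\<in>{a\<in>W. adj k a}. chi u a * chi v a) = (\<Sum>a\<in>W. if adj k a then chi u a * chi v a else 0)"
      using finW by (simp add: sum.If_cases Int_def)
    also have "\<dots> = (\<Sum>a\<in>W. if d a = 3 then 1 else 0)"
    proof (rule sum.cong)
      fix a
      have "d a = 3 \<longleftrightarrow> {u\<in>U. adj u a} = U"
        using card_subset_eq[OF finU, of "{u\<in>U. adj u a}"] card_U by (auto simp: d_def)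
      then have "d a = 3 \<longleftrightarrow> (\<forall>w\<in>U. adj w a)" by blast
      also have "\<dots> \<longleftrightarrow> adj u a \<and> adj v a \<and> adj k a" unfolding that[symmetric] by simp
      finally show "(if adj k a then chi u a * chi v a else 0) = (if d a = 3 then 1 else 0)"
        by (auto simp: chi_def)
    qed simp
    also have "\<dots> = real (card Z)" using finW by (simp add: sum.If_cases Int_def Z_def)
    finally show ?thesis .
  qed
  have sets: "{u1, u2, u3} = U" "{u2, u3, u1} = U" "{u1, u3, u2} = U" by (auto simp: U_def)
  show ?thesis
    unfolding TU_def pr_def h c[OF sets(1)] c[OF sets(2)] c[OF sets(3)]
    by (simp add: s_comm[of u2 u1] s_comm[of u3 u1] s_comm[of u3 u2])
qed

lemma TU_le: "3 * (TU + 3 * real (card Z)) \<le> (real (card {w\<in>M. d w = 2}) + 3 * real (card Z))\<^sup>2"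
  using three_products_le[of "common u1 u2" "common u2 u3" "common u1 u3"]
  unfolding sum_g_W[symmetric] sum_common[symmetric] TU_eq by (simp add: algebra_simps)

end

section \<open>Hubs, leaves and unowned edges for a fixed ownership\<close>

locale owned_graph = sparse_triangle_free +
  fixes eps :: "'a set set" and own :: "'a set \<Rightarrow> 'a"
  assumes eps_F: "eps \<subseteq> F"
    and card_eps: "card eps + card Z + eU \<le> 2"
    and own_in: "f \<in> F - eps \<Longrightarrow> own f \<in> f \<inter> M"
    and own_cap: "w \<in> M \<Longrightarrow> card {f\<in>F - eps. own f = w} \<le> 2 - d w"
begin

text \<open>The leaves of the hub \<open>y\<close>: a leaf has capacity 2 - 1 and spends it on the
  edge to \<open>y\<close>. \<open>Q x\<close> holds the other neighbours that can follow a terminal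
  on a path with middle \<open>x\<close>, and \<open>ex x\<close> counts the unowned edges by which
  \<open>Q x\<close> may exceed the capacity of \<open>x\<close>.\<close>

definition "L y = {a\<in>M. d a = 1 \<and> adj a y \<and> {a, y} \<in> F - eps \<and> own {a, y} = a}"
definition "Q x = {a\<in>W. adj x a \<and> d a > 0 \<and> a \<notin> L x}"
definition "ex x = card {f\<in>eps. \<exists>a. f = {x, a} \<and> d a > 0}"
definition "dbl x = card {a\<in>Q x. d a = 2}"
definition "trp x = card {a\<in>Q x. d a = 3}"

lemma fin_eps: "finite eps" using eps_F finF finite_subset by auto
lemma finL: "finite (L y)" using finM by (simp add: L_def)
lemma finQ: "finite (Q x)" using finW by (simp add: Q_def)

lemma in_F: "a \<in> M \<Longrightarrow> b \<in> W \<Longrightarrow> adj a b \<Longrightarrow> {a, b} \<in> F" by (auto simp: F_def)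

lemma own_d_le_1:
  assumes "f \<in> F - eps" "own f = a"
  shows "d a \<le> 1" "a \<in> M"
proof -
  show M: "a \<in> M" using own_in assms by auto
  have "f \<in> {f\<in>F - eps. own f = a}" using assms by auto
  moreover have "finite {f\<in>F - eps. own f = a}" using finF by auto
  ultimately have "card {f\<in>F - eps. own f = a} > 0" using card_gt_0_iff by blast
  then show "d a \<le> 1" using own_cap[OF M] by linarith
qed

text \<open>An edge from \<open>x\<close> to a member \<open>a\<close> of \<open>Q x\<close> is
  owned by \<open>x\<close> or unowned. If \<open>a\<close> owned it, its capacity would be
  positive, so \<open>d a = 1\<close> and \<open>a\<close> would be a leaf.\<close>

lemma card_Q:
  assumes "x \<in> M"
  shows "card (Q x) \<le> 2 - d x + ex x"
proof -
  let ?A = "{f\<in>F - eps. own f = x}" and ?B = "{f\<in>eps. \<exists>a. f = {x, a} \<and> d a > 0}"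
  have "(\<lambda>a. {x, a}) ` Q x \<subseteq> ?A \<union> ?B"
  proof
    fix f assume "f \<in> (\<lambda>a. {x, a}) ` Q x"
    then obtain a where a: "f = {x, a}" "a \<in> W" "adj x a" "d a > 0" "a \<notin> L x" by (auto simp: Q_def)
    have fF: "f \<in> F" using in_F[OF assms a(2,3)] a by simp
    show "f \<in> ?A \<union> ?B"
    proof (cases "f \<in> eps")
      case True then show ?thesis using a by auto
    next
      case False
      then have "own f = x \<or> own f = a" using own_in[of f] fF a by auto
      moreover have "own f \<noteq> a"
      proof
        assume o: "own f = a"
        then have "d a \<le> 1" "a \<in> M" using own_d_le_1[of f a] fF False by auto
        moreover have "f = {a, x}" using a by auto
        ultimately have "a \<in> L x" using a o fF False sym_iff[of a x] by (auto simp: L_def)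
        with a show False by simp
      qed
      ultimately show ?thesis using fF False by auto
    qed
  qed
  then have "card ((\<lambda>a. {x, a}) ` Q x) \<le> card (?A \<union> ?B)"
    using finF fin_eps by (intro card_mono) auto
  also have "\<dots> \<le> card ?A + card ?B" by (rule card_Un_le)
  also have "\<dots> \<le> 2 - d x + ex x" using own_cap[OF assms] by (simp add: ex_def)
  also have "card ((\<lambda>a. {x, a}) ` Q x) = card (Q x)"
    by (rule card_image) (auto simp: inj_on_def doubleton_eq_iff)
  finally show ?thesis .
qed

text \<open>A leaf of two hubs would own two edges with a capacity of 2 - 1.\<close>

lemma L_disjoint:
  assumes "y \<noteq> y'" shows "L y \<inter> L y' = {}"
proof (rule ccontr)
  assume "\<not> ?thesis"
  then obtain a where a: "a \<in> L y" "a \<in> L y'" by auto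
  let ?A = "{f\<in>F - eps. own f = a}"
  have aM: "a \<in> M" "d a = 1" using a by (auto simp: L_def)
  have "{{a, y}, {a, y'}} \<subseteq> ?A" using a by (auto simp: L_def)
  then have "card {{a, y}, {a, y'}} \<le> card ?A" using finF by (intro card_mono) auto
  moreover have "{a, y} \<noteq> {a, y'}" using assms by (auto simp: doubleton_eq_iff)
  ultimately show False using own_cap[OF aM(1)] aM(2) by simp
qed

lemma sum_card_L:
  assumes "A \<subseteq> M"
  shows "(\<Sum>y\<in>A. card (L y)) \<le> card {w\<in>M. d w = 1}"
proof -
  have "finite A" using assms finM finite_subset by auto
  then have "(\<Sum>y\<in>A. card (L y)) = card (\<Union>y\<in>A. L y)"
    using finL L_disjoint by (intro card_UN_disjoint[symmetric]) auto
  also have "\<dots> \<le> card {w\<in>M. d w = 1}"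
    using finM by (intro card_mono) (auto simp: L_def)
  finally show ?thesis .
qed

lemma nbr_sum:
  fixes \<phi> :: "'a \<Rightarrow> real"
  assumes "x \<in> M" "\<And>a. d a = 0 \<Longrightarrow> \<phi> a = 0"
  shows "(\<Sum>a\<in>{a\<in>W. adj x a}. \<phi> a) = (\<Sum>a\<in>L x. \<phi> a) + (\<Sum>a\<in>Q x. \<phi> a)"
proof -
  have "(\<Sum>a\<in>{a\<in>W. adj x a}. \<phi> a) = (\<Sum>a\<in>L x \<union> Q x. \<phi> a)"
  proof (rule sum.mono_neutral_right)
    show "L x \<union> Q x \<subseteq> {a\<in>W. adj x a}" using M_W sym_iff by (auto simp: L_def Q_def)
    show "\<forall>i\<in>{a\<in>W. adj x a} - (L x \<union> Q x). \<phi> i = 0" using assms(2) by (auto simp: Q_def)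
  qed (use finW in auto)
  also have "\<dots> = (\<Sum>a\<in>L x. \<phi> a) + (\<Sum>a\<in>Q x. \<phi> a)"
    by (rule sum.union_disjoint) (auto simp: finL finQ, auto simp: Q_def)
  finally show ?thesis .
qed

lemma sum_over_Q:
  "(\<Sum>a\<in>Q x. real (d a)) = real (card (Q x)) + real (dbl x) + 2 * real (trp x)"
  "(\<Sum>a\<in>Q x. g a) = real (dbl x) + 3 * real (trp x)"
proof -
  have split: "d a = 1 \<or> d a = 2 \<or> d a = 3" if "a \<in> Q x" for a
    using that d_le_3[of a] by (auto simp: Q_def)
  have ind: "real (card {a\<in>Q x. d a = k}) = (\<Sum>a\<in>Q x. if d a = k then 1 else 0)" for k
    using finQ by (simp add: sum.If_cases Int_def)
  have "(\<Sum>a\<in>Q x. real (d a)) = (\<Sum>a\<in>Q x. 1 + (if d a = 2 then 1 else 0) + 2 * (if d a = 3 then 1 else 0))"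
    by (rule sum.cong) (use split in fastforce)+
  also have "\<dots> = real (card (Q x)) + real (dbl x) + 2 * real (trp x)"
    unfolding sum.distrib sum_distrib_left[symmetric] dbl_def trp_def ind by simp
  finally show "(\<Sum>a\<in>Q x. real (d a)) = real (card (Q x)) + real (dbl x) + 2 * real (trp x)" .
  have "(\<Sum>a\<in>Q x. g a) = (\<Sum>a\<in>Q x. (if d a = 2 then 1 else 0) + 3 * (if d a = 3 then 1 else 0))"
    by (rule sum.cong) (use split in \<open>fastforce simp: g_d\<close>)+
  also have "\<dots> = real (dbl x) + 3 * real (trp x)"
    unfolding sum.distrib sum_distrib_left[symmetric] dbl_def trp_def ind by simp
  finally show "(\<Sum>a\<in>Q x. g a) = real (dbl x) + 3 * real (trp x)" .
qed

lemma nbr_sums: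
  assumes "x \<in> M"
  shows "(\<Sum>a\<in>{a\<in>W. adj x a}. real (d a)) = real (card (L x)) + real (card (Q x)) + real (dbl x) + 2 * real (trp x)"
    and "(\<Sum>a\<in>{a\<in>W. adj x a}. g a) = real (dbl x) + 3 * real (trp x)"
proof -
  have "(\<Sum>a\<in>L x. real (d a)) = real (card (L x))" "(\<Sum>a\<in>L x. g a) = 0"
    by (simp_all add: L_def g_d)
  then show "(\<Sum>a\<in>{a\<in>W. adj x a}. real (d a)) = real (card (L x)) + real (card (Q x)) + real (dbl x) + 2 * real (trp x)"
    and "(\<Sum>a\<in>{a\<in>W. adj x a}. g a) = real (dbl x) + 3 * real (trp x)"
    using nbr_sum[OF assms, of "\<lambda>a. real (d a)"] nbr_sum[OF assms, of g] sum_over_Q[of x]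
    by (simp_all add: g_d)
qed

lemma dbl_trp_le: "dbl x + trp x \<le> card (Q x)"
proof -
  have "dbl x + trp x = card ({a\<in>Q x. d a = 2} \<union> {a\<in>Q x. d a = 3})"
    unfolding dbl_def trp_def using finQ by (intro card_Un_disjoint[symmetric]) auto
  also have "\<dots> \<le> card (Q x)" using finQ by (intro card_mono) auto
  finally show ?thesis .
qed

lemma trp_le: "trp x \<le> card Z"
  unfolding trp_def by (rule card_mono[OF finZ]) (auto simp: Q_def Z_def)

lemma dbl_le: "dbl x \<le> card {w\<in>M. d w = 2}"
proof -
  have "finite {w\<in>M. d w = 2}" using finM by simp
  then show ?thesis unfolding dbl_def by (rule card_mono) (auto simp: Q_def M_def Z_def)
qed

lemma P_untyped_le:
  assumes "x \<in> M"
  shows "3 * (P x + real (dbl x) + 3 * real (trp x))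
    \<le> (real (card (L x)) + real (card (Q x)) + real (dbl x) + 2 * real (trp x))\<^sup>2"
  using P_le[of x] nbr_sums[OF assms] by (simp add: add.assoc)

text \<open>A neighbour of \<open>x\<close> adjacent to all terminals closes a triangle with
  \<open>x\<close> and the terminal next to \<open>x\<close>.\<close>

lemma no_triple_typed:
  assumes "d x > 0" shows "trp x = 0"
proof -
  obtain u where u: "u \<in> U" "adj u x" using assms by (auto simp: d_def card_gt_0_iff)
  have "d a \<noteq> 3" if "adj x a" for a
  proof
    assume "d a = 3"
    then have "{u\<in>U. adj u a} = U" using card_subset_eq[OF finU, of "{u\<in>U. adj u a}"] card_U by (simp add: d_def)
    then have "adj u a" using u by auto
    then show False using tri[OF u(2) that] sym_iff by blast
  qed
  then have "{a\<in>Q x. d a = 3} = {}" by (auto simp: Q_def)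
  then show ?thesis unfolding trp_def by (simp only: card.empty)
qed

lemma P_typed_le:
  assumes "x \<in> M" "d x > 0"
  shows "4 * (P x + real (dbl x)) \<le> (real (card (L x)) + real (card (Q x)) + real (dbl x))\<^sup>2"
proof -
  obtain u where u: "u \<in> U" "adj x u" using assms(2) sym_iff by (auto simp: d_def card_gt_0_iff)
  show ?thesis
    using P_le_typed[OF u] nbr_sums[OF assms(1)] no_triple_typed[OF assms(2)] by simp
qed

lemma P_zero_few:
  assumes "card (L x) + card (Q x) \<le> 1"
  shows "P x = 0"
proof (rule P_eq_0_small)
  have "{a\<in>W. adj x a \<and> d a > 0} \<subseteq> L x \<union> Q x" by (auto simp: Q_def)
  then have "card {a\<in>W. adj x a \<and> d a > 0} \<le> card (L x \<union> Q x)"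
    using finL finQ by (intro card_mono) auto
  also have "\<dots> \<le> card (L x) + card (Q x)" by (rule card_Un_le)
  finally show "card {a\<in>W. adj x a \<and> d a > 0} \<le> 1" using assms by linarith
qed

text \<open>Chosen so that an unowned edge costs at most 2 in total. It counts at an end only if the
  other end is adjacent to a terminal; hence an end of weight 2 keeps it from counting at the other
  end, and otherwise both weights are at most 1.\<close>

definition "wt x = (if d x = 0 then 2 else if d x = 1 then 1 else 0 :: nat)"

lemma sum_ex_le: "(\<Sum>x\<in>M. wt x * ex x) \<le> 2 * card eps"
proof -
  let ?p = "\<lambda>x f. \<exists>a. f = {x, a} \<and> d a > 0"
  have ex: "ex x = (\<Sum>f\<in>eps. if ?p x f then 1 else 0)" for x
    unfolding ex_def using fin_eps by (simp add: sum.If_cases Int_def)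
  have "(\<Sum>x\<in>M. wt x * ex x) = (\<Sum>x\<in>M. \<Sum>f\<in>eps. wt x * (if ?p x f then 1 else 0))"
    unfolding ex by (simp add: sum_distrib_left)
  also have "\<dots> = (\<Sum>f\<in>eps. \<Sum>x\<in>M. wt x * (if ?p x f then 1 else 0))" by (rule sum.swap)
  also have "\<dots> \<le> (\<Sum>f\<in>eps. 2)"
  proof (rule sum_mono)
    fix f assume "f \<in> eps"
    then have "f \<in> F" using eps_F by blast
    then obtain a b where "f = {a, b}" "adj a b" by (auto simp: F_def)
    then have f: "f = {a, b}" "a \<noteq> b" using irr by auto
    have "(\<Sum>x\<in>M. wt x * (if ?p x f then 1 else 0)) = (\<Sum>x\<in>M \<inter> {a, b}. wt x * (if ?p x f then 1 else 0))"
      by (rule sum.mono_neutral_right) (use finM f in auto)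
    also have "\<dots> \<le> (\<Sum>x\<in>{a, b}. wt x * (if ?p x f then 1 else 0))"
      by (rule sum_mono2) auto
    also have "\<dots> = wt a * (if ?p a f then 1 else 0) + wt b * (if ?p b f then 1 else 0)"
      using f by simp
    also have "?p a f \<longleftrightarrow> d b > 0" using f by (auto simp: doubleton_eq_iff)
    also have "?p b f \<longleftrightarrow> d a > 0" using f by (auto simp: doubleton_eq_iff)
    also have "wt a * (if d b > 0 then 1 else 0) + wt b * (if d a > 0 then 1 else 0) \<le> 2"
      by (auto simp: wt_def)
    finally show "(\<Sum>x\<in>M. wt x * (if ?p x f then 1 else 0)) \<le> 2" .
  qed
  finally show ?thesis by simp
qed

section \<open>Paths that use an edge between two terminals\<close>

definition "F' = {{a, b} | a b. a \<in> W \<and> b \<in> W \<and> adj a b \<and> d a > 0 \<and> d b > 0}"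

lemma finF': "finite F'"
  by (rule finite_subset[of _ "Pow W"]) (use finW in \<open>auto simp: F'_def\<close>)

text \<open>The owner of such an edge is adjacent to a terminal and has positive capacity, so it is
  adjacent to exactly one and is a leaf of the other end. As \<open>Z\<close> is empty, that other
  end lies in \<open>M\<close>.\<close>

lemma card_F':
  assumes "Z = {}"
  shows "card F' \<le> (\<Sum>y\<in>{y\<in>M. d y > 0}. card (L y)) + card eps"
proof -
  have MW: "M = W" using assms by (simp add: M_def)
  let ?G = "(\<lambda>(y, a). {a, y}) ` (SIGMA y:{y\<in>M. d y > 0}. L y)"
  have "F' \<subseteq> ?G \<union> eps"
  proof
    fix f assume f: "f \<in> F'"
    show "f \<in> ?G \<union> eps"
    proof (cases "f \<in> eps")
      case False
      have fF: "f \<in> F" using f MW by (auto simp: F'_def F_def)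
      obtain a b where ab: "f = {a, b}" "a \<in> W" "b \<in> W" "adj a b" "d a > 0" "d b > 0" "own f = a"
      proof -
        obtain a b where ab: "f = {a, b}" "a \<in> W" "b \<in> W" "adj a b" "d a > 0" "d b > 0"
          using f by (auto simp: F'_def)
        have "own f = a \<or> own f = b" using own_in[of f] fF False ab by auto
        then show ?thesis
        proof
          assume "own f = b"
          then show ?thesis using that[of b a] ab sym_iff by (simp add: insert_commute)
        qed (use that ab in blast)
      qed
      have "d a = 1" using own_d_le_1[of f a] fF False ab by auto
      then have "a \<in> L b" using ab fF False MW by (auto simp: L_def)
      then have "(b, a) \<in> (SIGMA y:{y\<in>M. d y > 0}. L y)" using ab MW by auto
      then show ?thesis using ab by force
    qed simp
  qed
  then have "card F' \<le> card (?G \<union> eps)" using finM finL fin_eps by (intro card_mono) auto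
  also have "\<dots> \<le> card ?G + card eps" by (rule card_Un_le)
  also have "card ?G \<le> card (SIGMA y:{y\<in>M. d y > 0}. L y)"
    using finM finL by (intro card_image_le) auto
  also have "\<dots> = (\<Sum>y\<in>{y\<in>M. d y > 0}. card (L y))" using finM finL by simp
  finally show ?thesis by simp
qed

text \<open>The pair (x, b) is recovered from the edge {x, b}: if \<open>x\<close> were also
  adjacent to \<open>v\<close>, then x, b, v would be a triangle. The two sets are disjoint since no
  \<open>x\<close> is adjacent to both ends of the edge between \<open>u\<close> and
  \<open>k\<close>.\<close>

lemma R_pair_le:
  assumes "adj u k" "u \<in> U" "k \<in> U" "v \<in> U"
  shows "card (R k v) + card (R u v) \<le> card F'"
proof -
  have typed: "d a > 0" if "adj w a" "w \<in> U" for w a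
    using that finU by (auto simp: d_def card_gt_0_iff)
  let ?f = "\<lambda>(x, b). {x, b}"
  have sub: "?f ` (R k v \<union> R u v) \<subseteq> F'"
  proof
    fix f assume "f \<in> ?f ` (R k v \<union> R u v)"
    then obtain x b where f: "f = {x, b}" "x \<in> W" "b \<in> W" "adj x b" "adj b v" "adj k x \<or> adj u x"
      by (auto simp: R_def)
    then show "f \<in> F'" using typed[of k x] typed[of u x] typed[of v b] assms sym_iff[of b v]
      unfolding F'_def by blast
  qed
  have disj: "R k v \<inter> R u v = {}"
    using tri[OF assms(1)] sym_iff by (auto simp: R_def)
  have nx: "\<not> adj x v" if "(x, b) \<in> R k v \<union> R u v" for x b
    using that tri[of x b v] sym_iff[of v x] by (auto simp: R_def)
  have bv: "adj b v" if "(x, b) \<in> R k v \<union> R u v" for x b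
    using that by (auto simp: R_def)
  have inj: "inj_on ?f (R k v \<union> R u v)"
    unfolding inj_on_def using nx bv by (fastforce simp: doubleton_eq_iff)
  have "card (R k v) + card (R u v) = card (R k v \<union> R u v)"
    using disj finite_R by (simp add: card_Un_disjoint)
  also have "\<dots> = card (?f ` (R k v \<union> R u v))" using inj by (simp add: card_image)
  also have "\<dots> \<le> card F'" by (rule card_mono[OF finF' sub])
  finally show ?thesis .
qed

lemma extra_le: "extra u1 u2 u3 + extra u2 u3 u1 + extra u1 u3 u2 \<le> real eU * real (card F')"
proof -
  have *: "extra u k v \<le> of_bool (adj u k) * real (card F')" if "u \<in> U" "k \<in> U" "v \<in> U" for u k v
    using R_pair_le[OF _ that] by (auto simp: extra_def)
  have "u1 \<in> U" "u2 \<in> U" "u3 \<in> U" by (auto simp: U_def)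
  then show ?thesis
    using *[of u1 u2 u3] *[of u2 u3 u1] *[of u1 u3 u2] by (simp add: eU_def algebra_simps)
qed

end

subsection \<open>Numerical estimates\<close>

text \<open>In the estimates below the quadratic terms cancel and b * k - c remains. This reduces c
  \<le> b * k to c \<le> k, where often only a few small integers have to be tried.\<close>

lemma mult_ge_if_ge_one: "1 \<le> b \<Longrightarrow> 0 \<le> k \<Longrightarrow> c \<le> k \<Longrightarrow> c \<le> b * (k::real)"
  using mult_right_mono[of 1 b k] by linarith

lemma untyped_arith:
  "c \<le> k \<Longrightarrow> 3 * R - q + 3 * d + 9 * t = k - c \<Longrightarrow> 3 * (P + d + 3 * t) \<le> q \<Longrightarrow> P \<le> (R::real)"
  by argo

lemma typed_arith:
  "c \<le> k \<Longrightarrow> X \<le> Y \<Longrightarrow> E \<le> E' \<Longrightarrow> 4 * (R - E') - q + 4 * d = Y - X + (k - c) \<Longrightarrow>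
    4 * (P + d) \<le> q \<Longrightarrow> P + E \<le> (R::real)"
  by argo

lemma special_arith:
  "c \<le> k \<Longrightarrow> y \<le> x \<Longrightarrow> 3 * (R - A - B) - q + 3 * d + 9 * t = 2 * (x - y) + k - c \<Longrightarrow>
    3 * (P + d + 3 * t) \<le> q \<Longrightarrow> A + B + P \<le> (R::real)"
  by argo

section \<open>Estimates for |Z| = 0\<close>

text \<open>With s = p - D the target (p + 4)^2/3 - 6 exceeds D^2/3 + (p/3 + 8/3) s by (D/3) s +
  8D/3 - 2/3 only, which is negative for D = 0. The rate per unit of load is lowered by
  \<open>slack D\<close>; what this saves pays the 2/3 and the charge of up to 4
  \<open>boost D\<close> for unowned edges.\<close>

definition slack :: "nat \<Rightarrow> real" where
  "slack D = (if D = 0 then 2/3 else if D = 1 then 1/3 else 0)"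

text \<open>The values are ((3 + \<delta>)^2 - 4\<delta>)/8 at \<delta> = min D 3. This is the least
  charge per unowned edge that covers the estimate for a hub with one neighbour in \<open>U\<close>,
  no leaf, two unowned edges and \<delta> neighbours adjacent to two terminals.\<close>

definition boost :: "nat \<Rightarrow> real" where
  "boost D = (if D = 0 then 9/8 else if D = 1 then 3/2 else if D = 2 then 17/8 else 3)"

text \<open>Here \<open>b\<close> counts the hub and its leaves, and \<open>s\<close> is the load
  left for all others. For \<epsilon> = 2 the coefficient ?k can be negative, as for D = \<delta> =
  4 and s = 0; such a hub is left to \<open>special_bound_0\<close>.\<close>

lemma untyped_bound_0:
  fixes b s P :: real and D \<delta> \<epsilon> :: nat
  assumes "b \<ge> 1" "s \<ge> 0" "\<delta> \<le> D" "\<delta> \<le> 2 + \<epsilon>" "\<epsilon> \<le> 1"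
    and P: "3 * (P + real \<delta>) \<le> (b + 1 + real \<epsilon> + real \<delta>)\<^sup>2"
  shows "P \<le> ((b + real D + s) / 3 + 8 / 3 - slack D) * b + boost D * (2 * real \<epsilon>)"
proof -
  let ?k = "real D + s + 6 - 3 * slack D - 2 * real \<epsilon> - 2 * real \<delta>"
  let ?c = "(1 + real \<epsilon> + real \<delta>)\<^sup>2 - 3 * real \<delta> - 6 * boost D * real \<epsilon>"
  have "\<epsilon> = 0 \<or> \<epsilon> = 1" "\<delta> = 0 \<or> \<delta> = 1 \<or> \<delta> = 2 \<or> \<delta> = 3" using assms by linarith+
  then have "0 \<le> ?k \<and> ?c \<le> ?k"
    using assms(2-5) by (elim disjE) (auto simp: slack_def boost_def power2_eq_square)
  then have "?c \<le> b * ?k" using mult_ge_if_ge_one[OF assms(1)] by blast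
  moreover have "3 * (((b + real D + s) / 3 + 8 / 3 - slack D) * b + boost D * (2 * real \<epsilon>)) - (b + 1 + real \<epsilon> + real \<delta>)\<^sup>2 + 3 * real \<delta> + 9 * 0 = b * ?k - ?c"
    by (simp add: power2_eq_square algebra_simps)
  moreover have "3 * (P + real \<delta> + 3 * 0) \<le> (b + 1 + real \<epsilon> + real \<delta>)\<^sup>2" using P by simp
  ultimately show ?thesis by (rule untyped_arith)
qed

text \<open>\<open>e\<close> stands for the number of edges inside \<open>U\<close>, and e * l for
  the paths through them charged to this hub. The inequality l + 1 + D + 8/3 \<le> 4p/3 absorbs the
  square of \<open>l\<close>. For l = 0 nothing but the charge for unowned edges is available, and
  the constant ?c must not be positive; this dictates \<open>boost\<close>.\<close>

lemma typed_bound_0: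
  fixes l p P :: real and D \<delta> \<epsilon> e :: nat
  assumes "l \<ge> 0" "l + 1 + real D \<le> p" "p \<ge> 8" "\<delta> \<le> D" "\<delta> \<le> 1 + \<epsilon>" "\<epsilon> + e \<le> 2"
    and P: "4 * (P + real \<delta>) \<le> (l + 1 + real \<epsilon> + real \<delta>)\<^sup>2"
    and l: "l \<ge> 1 \<or> \<epsilon> > 0"
  shows "P + real e * l \<le> (p / 3 + 8 / 3 - slack D) * l + boost D * real \<epsilon>"
proof -
  let ?k = "real D + 13/3 - 4 * slack D + 2 * real \<epsilon> - 2 * real \<delta>"
  let ?c = "(1 + real \<epsilon> + real \<delta>)\<^sup>2 - 4 * real \<delta> - 4 * boost D * real \<epsilon>"
  have "\<epsilon> = 0 \<or> \<epsilon> = 1 \<or> \<epsilon> = 2" "\<delta> = 0 \<or> \<delta> = 1 \<or> \<delta> = 2 \<or> \<delta> = 3" using assms by linarith+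
  then have k: "0 \<le> ?k \<and> ?c \<le> ?k \<and> (\<epsilon> > 0 \<longrightarrow> ?c \<le> 0)"
    using assms(4,5) by (elim disjE) (auto simp: slack_def boost_def power2_eq_square)
  have "?c \<le> l * ?k"
  proof (cases "l \<ge> 1")
    case True then show ?thesis using mult_ge_if_ge_one[OF True] k by blast
  next
    case False
    then have "?c \<le> 0" using l k by blast
    moreover have "0 \<le> l * ?k" using assms(1) k by simp
    ultimately show ?thesis by linarith
  qed
  moreover have "(l + 1 + real D + 8 / 3) * l \<le> (4 * p / 3) * l"
    using assms by (intro mult_right_mono) auto
  moreover have "real e * l \<le> (2 - real \<epsilon>) * l"
    using assms(1,6) by (intro mult_right_mono) auto
  moreover have "4 * ((p / 3 + 8 / 3 - slack D) * l + boost D * real \<epsilon> - (2 - real \<epsilon>) * l) - (l + 1 + real \<epsilon> + real \<delta>)\<^sup>2 + 4 * real \<delta>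
     = (4 * p / 3) * l - (l + 1 + real D + 8 / 3) * l + (l * ?k - ?c)"
    by (simp add: power2_eq_square algebra_simps)
  ultimately show ?thesis using P by (rule typed_arith)
qed

text \<open>At D = 0 the central inequality reads 31/6 \<le> 2p/3, true for p = 8 and false for p =
  7.\<close>

lemma total_bound_0:
  fixes p :: real and D c e :: nat
  assumes "real D \<le> p" "p \<ge> 8" "c + e \<le> 2"
  shows "(real D)\<^sup>2 / 3 + (p / 3 + 8 / 3 - slack D) * (p - real D) + boost D * (2 * real c) + real e * real c
    \<le> (p + 4)\<^sup>2 / 3 - 6"
proof -
  have "c = 0 \<or> c = 1 \<or> c = 2" "e = 0 \<or> e = 1 \<or> e = 2" using assms by linarith+
  then have "boost D * (2 * real c) + real e * real c \<le> 4 * boost D"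
    using assms(3) by (elim disjE) (auto simp: boost_def)
  moreover have "(real D)\<^sup>2 / 3 + (p / 3 + 8 / 3 - slack D) * (p - real D) + 4 * boost D \<le> (p + 4)\<^sup>2 / 3 - 6"
  proof -
    let ?s = "p - real D"
    consider "D = 0" | "D = 1" | "D = 2" | "D = 3" | "D = 4" | "D \<ge> 5" by linarith
    then have "4 * boost D + 2 / 3 \<le> (real D / 3 + slack D) * ?s + 8 * real D / 3"
    proof cases
      case 6
      moreover have "0 \<le> (real D / 3 + slack D) * ?s"
        using assms by (intro mult_nonneg_nonneg) (auto simp: slack_def)
      ultimately show ?thesis by (simp add: boost_def)
    qed (use assms in \<open>auto simp: boost_def slack_def algebra_simps\<close>)
    moreover have "(p + 4)\<^sup>2 / 3 - 6 - (real D)\<^sup>2 / 3 - (p / 3 + 8 / 3 - slack D) * ?s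
       = (real D / 3 + slack D) * ?s + 8 * real D / 3 - 2 / 3"
      by (simp add: power2_eq_square algebra_simps add_divide_distrib diff_divide_distrib)
    ultimately show ?thesis by linarith
  qed
  ultimately show ?thesis by linarith
qed

text \<open>One hub holds both unowned edges, hence 3 = 1 + 2 in the square. Its paths are compared
  with the target itself, while the remaining load of at most \<open>s\<close> is charged at the
  ordinary rate without \<open>boost\<close>.\<close>

lemma special_bound_0:
  fixes b s P :: real and D \<delta> :: nat
  assumes "b \<ge> 1" "s \<ge> 0" "\<delta> \<le> D" "\<delta> \<le> 4" "b + real D + s \<ge> 8"
    and P: "3 * (P + real \<delta>) \<le> (b + 3 + real \<delta>)\<^sup>2"
  shows "(real D)\<^sup>2 / 3 + ((b + real D + s) / 3 + 8 / 3 - slack D) * s + P \<le> ((b + real D + s) + 4)\<^sup>2 / 3 - 6"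
proof -
  have bs: "b * s \<ge> s" using assms by (simp add: mult_le_cancel_right1)
  have b\<delta>: "b * real \<delta> \<le> b * real D" using assms by simp
  consider "D = 0" | "D = 1" | "D = 2" | "D = 3" | "D = 4" | "D \<ge> 5" by linarith
  then have "11 + 3 * real \<delta> + (real \<delta>)\<^sup>2 \<le> 2 * b + s * real D + b * s + 3 * slack D * s + 8 * real D"
  proof cases
    case 6
    have "\<delta> = 0 \<or> \<delta> = 1 \<or> \<delta> = 2 \<or> \<delta> = 3 \<or> \<delta> = 4" using assms by linarith
    then have "11 + 3 * real \<delta> + (real \<delta>)\<^sup>2 \<le> 39" by (elim disjE) auto
    moreover have "real D \<ge> 5" using 6 by simp
    moreover have "0 \<le> s * real D" "0 \<le> 3 * slack D * s" using assms by (auto simp: slack_def)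
    ultimately show ?thesis using bs assms(1,2) by linarith
  next
    case 1
    have "11 \<le> 2 * b + b * s + 2 * s"
    proof (cases "b \<ge> 6")
      case True then show ?thesis using bs assms by linarith
    next
      case False
      then have "s \<ge> 2" using assms 1 by simp
      then have "b * s \<ge> b * 2" using assms by (intro mult_left_mono) auto
      moreover have "b + s \<ge> 8" using assms(5) 1 by simp
      ultimately show ?thesis using \<open>s \<ge> 2\<close> assms(1) by argo
    qed
    then show ?thesis using 1 assms by (simp add: slack_def)
  next
    case 2
    then have "\<delta> = 0 \<or> \<delta> = 1" using assms by linarith
    then show ?thesis using 2 assms bs by (elim disjE) (auto simp: slack_def)
  next
    case 3
    then have "\<delta> = 0 \<or> \<delta> = 1 \<or> \<delta> = 2" using assms by linarith
    then show ?thesis using 3 assms bs by (elim disjE) (auto simp: slack_def)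
  next
    case 4
    then have "\<delta> = 0 \<or> \<delta> = 1 \<or> \<delta> = 2 \<or> \<delta> = 3" using assms by linarith
    then show ?thesis using 4 assms bs by (elim disjE) (auto simp: slack_def)
  next
    case 5
    then have "\<delta> = 0 \<or> \<delta> = 1 \<or> \<delta> = 2 \<or> \<delta> = 3 \<or> \<delta> = 4" using assms by linarith
    then show ?thesis using 5 assms bs by (elim disjE) (auto simp: slack_def)
  qed
  moreover note b\<delta>
  moreover have "3 * (((b + real D + s) + 4)\<^sup>2 / 3 - 6 - (real D)\<^sup>2 / 3 - ((b + real D + s) / 3 + 8 / 3 - slack D) * s) - (b + 3 + real \<delta>)\<^sup>2 + 3 * real \<delta> + 9 * 0
     = 2 * (b * real D - b * real \<delta>) + (2 * b + s * real D + b * s + 3 * slack D * s + 8 * real D) - (11 + 3 * real \<delta> + (real \<delta>)\<^sup>2)"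
    by (simp add: power2_eq_square algebra_simps)
  moreover have "3 * (P + real \<delta> + 3 * 0) \<le> (b + 3 + real \<delta>)\<^sup>2" using P by simp
  ultimately show ?thesis by (rule special_arith)
qed

section \<open>Estimates for |Z| = 1\<close>

lemma untyped_bound_1:
  fixes b s P :: real and D \<delta> \<tau> :: nat
  assumes "b \<ge> 1" "s \<ge> 0" "\<delta> \<le> D" "\<delta> + \<tau> \<le> 2" "\<tau> \<le> 1" "b + real D + s \<ge> 7"
    and P: "3 * (P + real \<delta> + 3 * real \<tau>) \<le> (b + 1 + real \<delta> + 2 * real \<tau>)\<^sup>2"
  shows "P \<le> ((b + real D + s) / 3 + 10 / 3) * b"
proof -
  let ?k = "real D + s + 8 - 2 * real \<delta> - 4 * real \<tau>"
  let ?c = "(1 + real \<delta> + 2 * real \<tau>)\<^sup>2 - 3 * real \<delta> - 9 * real \<tau>"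
  have "?c \<le> b * ?k"
  \<comment> \<open>In this case the constant is 4, while the coefficient D + s + 2 may be as small
    as 3. For b \<ge> 2 the product is at least 6; for smaller b the condition on p forces D + s to
    be large.\<close>
  proof (cases "\<delta> = 1 \<and> \<tau> = 1")
    case True
    show ?thesis
    proof (cases "b \<ge> 2")
      case b2: True
      have "2 * 3 \<le> b * ?k" using True assms b2 by (intro mult_mono) auto
      then show ?thesis using True by (simp add: power2_eq_square)
    next
      case False
      then have "?k \<ge> 4" using assms True by simp
      then have "?c \<le> ?k" using True by (simp add: power2_eq_square)
      then show ?thesis using mult_ge_if_ge_one[OF assms(1)] \<open>?k \<ge> 4\<close> by fastforce
    qed
  next
    case False
    then have "(\<delta> = 0 \<and> \<tau> = 0) \<or> (\<delta> = 1 \<and> \<tau> = 0) \<or> (\<delta> = 2 \<and> \<tau> = 0) \<or> (\<delta> = 0 \<and> \<tau> = 1)"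
      using assms(4,5) by linarith
    then have "0 \<le> ?k \<and> ?c \<le> ?k" using assms(2,3) by (elim disjE) (auto simp: power2_eq_square)
    then show ?thesis using mult_ge_if_ge_one[OF assms(1)] by blast
  qed
  moreover have "3 * (((b + real D + s) / 3 + 10 / 3) * b) - (b + 1 + real \<delta> + 2 * real \<tau>)\<^sup>2 + 3 * real \<delta> + 9 * real \<tau> = b * ?k - ?c"
    by (simp add: power2_eq_square algebra_simps)
  ultimately show ?thesis using P by (rule untyped_arith)
qed

text \<open>The charges 1 and 2 are the least integers that cover ((2 + \<delta>)^2 - 4\<delta>)/4
  for a hub with an unowned edge and no leaf; this value is 1, 5/4 or 2 for \<delta> = 0, 1,
  2.\<close>

lemma typed_bound_1:
  fixes l p P :: real and D \<delta> \<epsilon> :: nat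
  assumes "l \<ge> 0" "l + 1 + real D \<le> p" "p \<ge> 7" "\<delta> \<le> D" "\<delta> \<le> 1 + \<epsilon>" "\<epsilon> \<le> 1"
    and P: "4 * (P + real \<delta>) \<le> (l + 1 + real \<epsilon> + real \<delta>)\<^sup>2"
    and l: "l \<ge> 1 \<or> \<epsilon> > 0"
  shows "P \<le> (p / 3 + 10 / 3) * l + (if D = 0 then 1 else 2) * real \<epsilon>"
proof -
  let ?\<beta> = "if D = 0 then 1 else 2 :: real"
  let ?k = "real D + 44/3 - 2 * real \<epsilon> - 2 * real \<delta>"
  let ?c = "(1 + real \<epsilon> + real \<delta>)\<^sup>2 - 4 * real \<delta> - 4 * ?\<beta> * real \<epsilon>"
  have "\<epsilon> = 0 \<or> \<epsilon> = 1" "\<delta> = 0 \<or> \<delta> = 1 \<or> \<delta> = 2" using assms by linarith+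
  then have k: "0 \<le> ?k \<and> ?c \<le> ?k \<and> (\<epsilon> > 0 \<longrightarrow> ?c \<le> 0)"
    using assms(4,5) by (elim disjE) (auto simp: power2_eq_square)
  have "?c \<le> l * ?k"
  proof (cases "l \<ge> 1")
    case True then show ?thesis using mult_ge_if_ge_one[OF True] k by blast
  next
    case False
    then have "?c \<le> 0" using l k by blast
    moreover have "0 \<le> l * ?k" using assms(1) k by simp
    ultimately show ?thesis by linarith
  qed
  moreover have "(l + 1 + real D + 7 / 3) * l \<le> (4 * p / 3) * l"
    using assms by (intro mult_right_mono) auto
  moreover have "(0::real) \<le> 0" by simp
  moreover have "4 * ((p / 3 + 10 / 3) * l + ?\<beta> * real \<epsilon> - 0) - (l + 1 + real \<epsilon> + real \<delta>)\<^sup>2 + 4 * real \<delta>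
     = (4 * p / 3) * l - (l + 1 + real D + 7 / 3) * l + (l * ?k - ?c)"
    by (simp add: power2_eq_square algebra_simps)
  ultimately have "P + 0 \<le> (p / 3 + 10 / 3) * l + ?\<beta> * real \<epsilon>" using P by (rule typed_arith)
  then show ?thesis by simp
qed

text \<open>The target is now larger than the other terms by 7/3 even at D = 0, so the rate p/3 +
  10/3 is kept in full.\<close>

lemma total_bound_1:
  fixes p :: real and D c :: nat
  assumes "real D \<le> p" "p \<ge> 7" "c \<le> 1"
  shows "(real D + 3)\<^sup>2 / 3 - 3 + (p / 3 + 10 / 3) * (p - real D) + (if D = 0 then 1 else 2) * (2 * real c)
    \<le> (p + 5)\<^sup>2 / 3 - 6"
proof -
  let ?s = "p - real D"
  let ?\<beta> = "if D = 0 then 1 else 2 :: real"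
  have "c = 0 \<or> c = 1" using assms by linarith
  then have "?\<beta> * (2 * real c) \<le> 2 * ?\<beta>" by auto
  moreover have "2 * ?\<beta> \<le> 7 / 3 + real D / 3 * ?s + 4 * real D / 3"
  proof -
    consider "D = 0" | "D = 1" | "D \<ge> 2" by linarith
    then show ?thesis
    proof cases
      case 3
      moreover have "0 \<le> real D / 3 * ?s" using assms by simp
      ultimately show ?thesis by simp
    qed (use assms in \<open>auto simp: field_simps\<close>)
  qed
  moreover have "(p + 5)\<^sup>2 / 3 - 6 - ((real D + 3)\<^sup>2 / 3 - 3) - (p / 3 + 10 / 3) * ?s = 7 / 3 + real D / 3 * ?s + 4 * real D / 3"
    by (simp add: power2_eq_square algebra_simps add_divide_distrib diff_divide_distrib)
  ultimately show ?thesis by linarith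
qed

lemma special_bound_1:
  fixes b s P :: real and D \<delta> \<tau> :: nat
  assumes "b \<ge> 1" "s \<ge> 0" "\<delta> \<le> D" "\<delta> + \<tau> \<le> 3" "\<tau> \<le> 1" "b + real D + s \<ge> 7"
    and P: "3 * (P + real \<delta> + 3 * real \<tau>) \<le> (b + 2 + real \<delta> + 2 * real \<tau>)\<^sup>2"
  shows "(real D + 3)\<^sup>2 / 3 - 3 + ((b + real D + s) / 3 + 10 / 3) * s + P \<le> ((b + real D + s) + 5)\<^sup>2 / 3 - 6"
proof -
  have bs: "b * s \<ge> s" using assms by (simp add: mult_le_cancel_right1)
  have b\<delta>: "b * real \<delta> \<le> b * real D" using assms by simp
  have sD: "0 \<le> s * real D" using assms by simp
  have rD: "real \<delta> \<le> real D" using assms by simp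
  have rhs: "4 * real \<delta> + 6 * b + 7 \<le> s * real D + b * s + 4 * real D + 6 * b + 7"
    using sD rD bs assms(2) by argo
  have "(1 + real \<delta> + 2 * real \<tau> + 1)\<^sup>2 - 3 * real \<delta> - 9 * real \<tau> + b * (4 * real \<tau>)
     \<le> s * real D + b * s + 4 * real D + 6 * b + 7"
  proof (cases "\<tau> = 0")
    case True
    have "\<delta> = 0 \<or> \<delta> = 1 \<or> \<delta> = 2 \<or> \<delta> = 3" using assms by linarith
    then have "(1 + real \<delta> + 2 * real \<tau> + 1)\<^sup>2 - 3 * real \<delta> - 9 * real \<tau> + b * (4 * real \<tau>) \<le> 4 * real \<delta> + 6 * b + 7"
      using True assms(1) by (elim disjE) (simp_all add: power2_eq_square)
    then show ?thesis using rhs by linarith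
  next
    case False
    then have t: "\<tau> = 1" using assms by simp
    have "\<delta> = 0 \<or> \<delta> = 1 \<or> \<delta> = 2" using assms t by linarith
    moreover have ?thesis if d2: "\<delta> = 2"
    proof -
      have "14 \<le> 2 * b + s * real D + b * s + 4 * real D"
      proof (cases "D = 2")
        case True
        then show ?thesis using assms(1,2,6) bs by simp
      next
        case False
        then have "D \<ge> 3" using assms(3) d2 by simp
        then have "real D \<ge> 3" by simp
        then show ?thesis using sD bs assms(1,2) by linarith
      qed
      then show ?thesis using t d2 by (simp add: power2_eq_square)
    qed
    moreover have ?thesis if "\<delta> = 0 \<or> \<delta> = 1"
    proof -
      have "(1 + real \<delta> + 2 * real \<tau> + 1)\<^sup>2 - 3 * real \<delta> - 9 * real \<tau> + b * (4 * real \<tau>) \<le> 4 * real \<delta> + 6 * b + 7"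
        using that t assms(1) by (elim disjE) (simp_all add: power2_eq_square)
      then show ?thesis using rhs by linarith
    qed
    ultimately show ?thesis by blast
  qed
  moreover note b\<delta>
  moreover have "3 * (((b + real D + s) + 5)\<^sup>2 / 3 - 6 - ((real D + 3)\<^sup>2 / 3 - 3) - ((b + real D + s) / 3 + 10 / 3) * s) - (b + 2 + real \<delta> + 2 * real \<tau>)\<^sup>2 + 3 * real \<delta> + 9 * real \<tau>
     = 2 * (b * real D - b * real \<delta>) + (s * real D + b * s + 4 * real D + 6 * b + 7)
       - ((1 + real \<delta> + 2 * real \<tau> + 1)\<^sup>2 - 3 * real \<delta> - 9 * real \<tau> + b * (4 * real \<tau>))"
    by (simp add: power2_eq_square algebra_simps add_divide_distrib diff_divide_distrib)
  ultimately show ?thesis using P by (rule special_arith)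
qed

section \<open>Estimates for |Z| = 2\<close>

lemma untyped_bound_2:
  fixes b s P :: real and D \<delta> \<tau> :: nat
  assumes "b \<ge> 1" "s \<ge> 0" "\<delta> + \<tau> \<le> 2" "b + real D + s \<ge> 6"
    and P: "3 * (P + real \<delta> + 3 * real \<tau>) \<le> (b + 1 + real \<delta> + 2 * real \<tau>)\<^sup>2"
  shows "P \<le> ((b + real D + s) / 3 + 4) * b"
proof -
  let ?k = "real D + s + 10 - 2 * real \<delta> - 4 * real \<tau>"
  let ?c = "(1 + real \<delta> + 2 * real \<tau>)\<^sup>2 - 3 * real \<delta> - 9 * real \<tau>"
  have "?c \<le> b * ?k"
  proof (cases "\<tau> = 2")
    case True
    then have d0: "\<delta> = 0" using assms by simp
    \<comment> \<open>With both members of \<open>Z\<close> among the neighbours the constant is 25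
      - 18 = 7, and the coefficient is at least 8 - b. The product b(8 - b) equals 7 at b = 1, so
      the lower bound 6 for p is exactly what this case uses.\<close>
    have "7 \<le> b * (real D + s + 2)"
    proof (cases "b \<le> 4")
      case b4: True
      have "0 \<le> (b - 1) * (4 - b)" using assms b4 by (intro mult_nonneg_nonneg) auto
      then have "b * (8 - b) \<ge> 3 * b + 4" by (simp add: algebra_simps)
      moreover have "b * (8 - b) \<le> b * (real D + s + 2)" using assms by (intro mult_left_mono) auto
      ultimately show ?thesis using assms(1) by linarith
    next
      case False
      then have "4 * 2 \<le> b * (real D + s + 2)" using assms by (intro mult_mono) auto
      then show ?thesis by simp
    qed
    then show ?thesis using True d0 by (simp add: power2_eq_square add_ac)
  next
    case False
    then have "(\<delta> = 0 \<and> \<tau> = 0) \<or> (\<delta> = 1 \<and> \<tau> = 0) \<or> (\<delta> = 2 \<and> \<tau> = 0) \<or> (\<delta> = 0 \<and> \<tau> = 1) \<or> (\<delta> = 1 \<and> \<tau> = 1)"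
      using assms(3) by linarith
    then have "0 \<le> ?k \<and> ?c \<le> ?k" using assms(2) by (elim disjE) (auto simp: power2_eq_square)
    then show ?thesis using mult_ge_if_ge_one[OF assms(1)] by blast
  qed
  moreover have "3 * (((b + real D + s) / 3 + 4) * b) - (b + 1 + real \<delta> + 2 * real \<tau>)\<^sup>2 + 3 * real \<delta> + 9 * real \<tau> = b * ?k - ?c"
    by (simp add: power2_eq_square algebra_simps)
  ultimately show ?thesis using P by (rule untyped_arith)
qed

lemma typed_bound_2:
  fixes l p P :: real and \<delta> :: nat
  assumes "l \<ge> 1" "l + 1 \<le> p" "\<delta> \<le> 1"
    and P: "4 * (P + real \<delta>) \<le> (l + 1 + real \<delta>)\<^sup>2"
  shows "P \<le> (p / 3 + 4) * l"
proof -
  have "\<delta> = 0 \<or> \<delta> = 1" using assms by linarith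
  then have "4 * P \<le> l * l + 4 * l" using P assms(1) by (elim disjE) (auto simp: power2_eq_square algebra_simps)
  moreover have "l * l \<le> p * l" using assms by (intro mult_right_mono) auto
  moreover have "(p / 3 + 4) * l = p * l / 3 + 4 * l" by (simp add: algebra_simps)
  moreover have "0 \<le> p * l" using assms by simp
  ultimately show ?thesis using assms(1) by linarith
qed

text \<open>The two sides differ by D(p - D)/3, which vanishes for D = p, the situation in
  H_n.\<close>

lemma total_bound_2:
  fixes p :: real and D :: nat
  assumes "real D \<le> p"
  shows "(real D + 6)\<^sup>2 / 3 - 6 + (p / 3 + 4) * (p - real D) \<le> (p + 6)\<^sup>2 / 3 - 6"
proof -
  have "(p + 6)\<^sup>2 / 3 - 6 - ((real D + 6)\<^sup>2 / 3 - 6) - (p / 3 + 4) * (p - real D) = real D * (p - real D) / 3"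
    by (simp add: power2_eq_square algebra_simps add_divide_distrib diff_divide_distrib)
  moreover have "0 \<le> real D * (p - real D) / 3" using assms by simp
  ultimately show ?thesis by linarith
qed

subsection \<open>The upper bound\<close>

context owned_graph
begin

text \<open>The unit of charging: leaves are paid at their hub, and a hub without neighbours in
  \<open>U\<close> also pays for itself. A hub with one neighbour in \<open>U\<close> may be a leaf
  of another hub and is counted there, so that all loads together are at most p - D.\<close>

definition "load x = real (card (L x)) + of_bool (d x = 0)"
definition "D = card {w\<in>M. d w = 2}"
definition "p = card M"

lemma M_split: "p = card {w\<in>M. d w = 0} + card {w\<in>M. d w = 1} + D"
proof -
  have "M = {w\<in>M. d w = 0} \<union> {w\<in>M. d w = 1} \<union> {w\<in>M. d w = 2}"
  proof -
    have "d w = 0 \<or> d w = 1 \<or> d w = 2" if "w \<in> M" for w using d_le_2[OF that] by linarith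
    then show ?thesis by blast
  qed
  then have "card M = card ({w\<in>M. d w = 0} \<union> {w\<in>M. d w = 1} \<union> {w\<in>M. d w = 2})" by simp
  also have "\<dots> = card ({w\<in>M. d w = 0} \<union> {w\<in>M. d w = 1}) + card {w\<in>M. d w = 2}"
    using finM by (intro card_Un_disjoint) auto
  also have "card ({w\<in>M. d w = 0} \<union> {w\<in>M. d w = 1}) = card {w\<in>M. d w = 0} + card {w\<in>M. d w = 1}"
    using finM by (intro card_Un_disjoint) auto
  finally show ?thesis by (simp add: p_def D_def)
qed

lemma sum_load:
  assumes "A \<subseteq> M"
  shows "(\<Sum>x\<in>A. load x) \<le> real (card {w\<in>M. d w = 1}) + real (card {w\<in>A. d w = 0})"
proof -
  have fA: "finite A" using assms finM finite_subset by auto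
  have "(\<Sum>x\<in>A. load x) = real (\<Sum>x\<in>A. card (L x)) + (\<Sum>x\<in>A. if d x = 0 then 1 else 0)"
    unfolding load_def sum.distrib by (simp add: of_bool_def)
  also have "(\<Sum>x\<in>A. if d x = 0 then 1 else 0) = real (card {w\<in>A. d w = 0})"
    using fA by (simp add: sum.If_cases Int_def)
  finally show ?thesis using sum_card_L[OF assms] by linarith
qed

lemma sum_load_M: "(\<Sum>x\<in>M. load x) \<le> real p - real D"
  using sum_load[of M] M_split by simp

lemma load_nonneg: "load x \<ge> 0" by (simp add: load_def)

lemma load_untyped:
  assumes "x \<in> M" "d x = 0"
  shows "1 + real (card (L x)) + real D \<le> real p"
proof -
  have "load x \<le> (\<Sum>x\<in>M. load x)"
    by (rule member_le_sum[OF assms(1)]) (use finM load_nonneg in auto)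
  then show ?thesis using sum_load_M assms by (simp add: load_def)
qed

lemma load_typed:
  assumes "x \<in> M" "d x = 1"
  shows "real (card (L x)) + 1 + real D \<le> real p"
proof -
  \<comment> \<open>The hub itself has \<open>d x = 1\<close> but is not its own leaf; this is the 1
    in the claim.\<close>
  have "L x \<subset> {w\<in>M. d w = 1}" using assms irr by (auto simp: L_def)
  then have "card (L x) < card {w\<in>M. d w = 1}" using finM by (intro psubset_card_mono) auto
  then show ?thesis using M_split by simp
qed

lemma eU_zero: assumes "Z \<noteq> {}" shows "eU = 0"
proof -
  obtain z where z: "z \<in> W" "d z = 3" using assms by (auto simp: Z_def)
  have "{u\<in>U. adj u z} = U" using card_subset_eq[OF finU, of "{u\<in>U. adj u z}"] card_U z by (simp add: d_def)
  then have a: "adj u z" if "u \<in> U" for u using that by blast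
  have "\<not> adj u v" if "u \<in> U" "v \<in> U" for u v
    using tri[of u v z] a[OF that(1)] a[OF that(2)] sym by blast
  then show ?thesis by (auto simp: eU_def U_def)
qed

text \<open>To the paths with middle \<open>x\<close>, a hub adjacent to a terminal adds those that
  use an edge inside \<open>U\<close> and one of its owned leaf edges; \<open>eU\<close> bounds how
  often each of these edges is used.\<close>

definition "cost x = P x + (if d x > 0 then real eU * real (card (L x)) else 0)"

text \<open>Members of \<open>Z\<close> are the middle of no path counted by \<open>P\<close>, so
  the sum over \<open>W\<close> is one over \<open>M\<close>. The last term pays for the unowned
  edges of \<open>F'\<close>, which no hub covers.\<close>

lemma T_le_cost:
  "T \<le> (real D + 3 * real (card Z))\<^sup>2 / 3 - 3 * real (card Z) + (\<Sum>x\<in>M. cost x) + real eU * real (card eps)"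
proof -
  have "(\<Sum>x\<in>W. P x) = (\<Sum>x\<in>M. P x)"
    by (rule sum.mono_neutral_right) (use finW M_W P_eq_0 in \<open>auto simp: M_def Z_def\<close>)
  moreover have "real eU * real (card F') \<le> (\<Sum>x\<in>M. if d x > 0 then real eU * real (card (L x)) else 0) + real eU * real (card eps)"
  proof (cases "Z = {}")
    case True
    have "(\<Sum>x\<in>M. if d x > 0 then real eU * real (card (L x)) else 0) = (\<Sum>x\<in>{y\<in>M. d y > 0}. real eU * real (card (L x)))"
      using finM by (simp add: sum.If_cases Int_def)
    also have "\<dots> = real eU * real (\<Sum>y\<in>{y\<in>M. d y > 0}. card (L y))"
      by (simp add: sum_distrib_left)
    finally have eq: "(\<Sum>x\<in>M. if d x > 0 then real eU * real (card (L x)) else 0) = \<dots>" .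
    have "real eU * real (card F') \<le> real eU * (real (\<Sum>y\<in>{y\<in>M. d y > 0}. card (L y)) + real (card eps))"
    proof (intro mult_left_mono)
      have "real (card F') \<le> real ((\<Sum>y\<in>{y\<in>M. d y > 0}. card (L y)) + card eps)"
        using card_F'[OF True] by (rule of_nat_mono)
      then show "real (card F') \<le> real (\<Sum>y\<in>{y\<in>M. d y > 0}. card (L y)) + real (card eps)"
        by (simp only: of_nat_add)
    qed simp
    then show ?thesis unfolding eq by (simp add: distrib_left)
  next
    case False
    then have e0: "eU = 0" by (rule eU_zero)
    have "(\<Sum>x\<in>M. if d x > 0 then real eU * real (card (L x)) else 0) = 0"
      by (rule sum.neutral) (auto simp: e0)
    then show ?thesis using e0 by simp
  qed
  moreover have "3 * TU \<le> (real D + 3 * real (card Z))\<^sup>2 - 9 * real (card Z)"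
    using TU_le unfolding D_def[symmetric] by argo
  ultimately show ?thesis
    using T_eq extra_le unfolding cost_def sum.distrib by argo
qed

lemma cost_double: "d x \<ge> 2 \<Longrightarrow> cost x = real eU * real (card (L x))"
  by (simp add: cost_def P_eq_0)

text \<open>Every hub with its leaves, apart from an exceptional one, is charged \<open>\<mu>\<close> per vertex,
  plus \<open>\<beta>\<close> for each unowned edge at it.\<close>

lemma T_le_charge:
  assumes mu: "\<mu> \<ge> 0" and A: "A \<subseteq> M"
    and le: "\<And>x. x \<in> A \<Longrightarrow> cost x \<le> \<mu> * load x + \<beta> * real (wt x * ex x)"
  shows "(\<Sum>x\<in>A. cost x) \<le> \<mu> * (\<Sum>x\<in>A. load x) + \<beta> * real (\<Sum>x\<in>A. wt x * ex x)"
proof -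
  have "(\<Sum>x\<in>A. cost x) \<le> (\<Sum>x\<in>A. \<mu> * load x + \<beta> * real (wt x * ex x))"
    by (rule sum_mono) (rule le)
  also have "\<dots> = \<mu> * (\<Sum>x\<in>A. load x) + \<beta> * real (\<Sum>x\<in>A. wt x * ex x)"
    by (simp add: sum.distrib sum_distrib_left)
  finally show ?thesis .
qed

lemma ex_le_eps: "ex x \<le> card eps"
  unfolding ex_def by (rule card_mono[OF fin_eps]) auto

lemma untyped_P:
  assumes "x \<in> M" "d x = 0"
  shows "3 * (P x + real (dbl x) + 3 * real (trp x))
    \<le> (1 + real (card (L x)) + 1 + real (ex x) + real (dbl x) + 2 * real (trp x))\<^sup>2"
    and "dbl x + trp x \<le> 2 + ex x"
proof -
  have q: "card (Q x) \<le> 2 + ex x" using card_Q[OF assms(1)] assms(2) by simp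
  then have q': "real (card (Q x)) \<le> 2 + real (ex x)" by linarith
  show "dbl x + trp x \<le> 2 + ex x" using dbl_trp_le[of x] q by linarith
  have "(real (card (L x)) + real (card (Q x)) + real (dbl x) + 2 * real (trp x))\<^sup>2
    \<le> (1 + real (card (L x)) + 1 + real (ex x) + real (dbl x) + 2 * real (trp x))\<^sup>2"
    by (rule power_mono) (use q' in auto)
  then show "3 * (P x + real (dbl x) + 3 * real (trp x))
    \<le> (1 + real (card (L x)) + 1 + real (ex x) + real (dbl x) + 2 * real (trp x))\<^sup>2"
    using P_untyped_le[OF assms(1)] by linarith
qed

lemma typed_P:
  assumes "x \<in> M" "d x = 1"
  shows "4 * (P x + real (dbl x)) \<le> (real (card (L x)) + 1 + real (ex x) + real (dbl x))\<^sup>2"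
    and "dbl x \<le> 1 + ex x"
    and "card (L x) = 0 \<Longrightarrow> ex x = 0 \<Longrightarrow> P x = 0"
proof -
  have q: "card (Q x) \<le> 1 + ex x" using card_Q[OF assms(1)] assms(2) by simp
  then have q': "real (card (Q x)) \<le> 1 + real (ex x)" by linarith
  show "dbl x \<le> 1 + ex x" using dbl_trp_le[of x] q by linarith
  have "(real (card (L x)) + real (card (Q x)) + real (dbl x))\<^sup>2
    \<le> (real (card (L x)) + 1 + real (ex x) + real (dbl x))\<^sup>2"
    by (rule power_mono) (use q' in auto)
  then show "4 * (P x + real (dbl x)) \<le> (real (card (L x)) + 1 + real (ex x) + real (dbl x))\<^sup>2"
    using P_typed_le[OF assms(1)] assms(2) by linarith
  show "P x = 0" if "card (L x) = 0" "ex x = 0" using P_zero_few[of x] q that by simp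
qed

lemma d_cases: "x \<in> M \<Longrightarrow> d x = 0 \<or> d x = 1 \<or> d x = 2"
  using d_le_2[of x] by linarith

lemma dblD: "dbl x \<le> D" unfolding D_def by (rule dbl_le)

section \<open>The upper bound for each possible size of \<open>Z\<close>\<close>

lemma bound_0:
  assumes Z: "Z = {}" and p: "p \<ge> 8"
  shows "T \<le> (real p + 4)\<^sup>2 / 3 - 6"
proof -
  define \<mu> where "\<mu> = real p / 3 + 8 / 3 - slack D"
  have mu: "\<mu> \<ge> 2" using p by (simp add: \<mu>_def slack_def)
  have ce: "card eps + eU \<le> 2" using card_eps by simp
  have trp: "trp x = 0" for x using trp_le[of x] Z by simp
  have Dp: "real D \<le> real p" using M_split by simp
  have bst: "boost D \<ge> 0" by (simp add: boost_def)
  have eU2: "real eU \<le> 2" using ce by linarith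
  have charge: "cost x \<le> \<mu> * load x + boost D * real (wt x * ex x)"
    if x: "x \<in> M" and e1: "d x = 0 \<Longrightarrow> ex x \<le> 1" for x
  proof -
    consider "d x = 0" | "d x = 1" | "d x = 2" using d_cases[OF x] by metis
    then show ?thesis
    proof cases
      case 1
      define b where "b = 1 + real (card (L x))"
      define s where "s = real p - real D - b"
      have s0: "s \<ge> 0" using load_untyped[OF x 1] by (simp add: s_def b_def)
      have p_eq: "b + real D + s = real p" by (simp add: s_def)
      have "3 * (P x + real (dbl x)) \<le> (b + 1 + real (ex x) + real (dbl x))\<^sup>2"
        using untyped_P(1)[OF x 1] by (simp add: trp b_def)
      then have "P x \<le> ((b + real D + s) / 3 + 8 / 3 - slack D) * b + boost D * (2 * real (ex x))"
        using untyped_P(2)[OF x 1] s0 e1[OF 1]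
        by (intro untyped_bound_0[where \<delta> = "dbl x"]) (auto simp: dblD b_def)
      then show ?thesis using 1 unfolding p_eq
        by (simp add: cost_def \<mu>_def load_def wt_def b_def add.commute)
    next
      case 2
      show ?thesis
      proof (cases "card (L x) = 0 \<and> ex x = 0")
        case True
        then show ?thesis using typed_P(3)[OF x 2] 2 by (simp add: cost_def load_def)
      next
        case False
        have "P x + real eU * real (card (L x)) \<le> (real p / 3 + 8 / 3 - slack D) * real (card (L x)) + boost D * real (ex x)"
          using typed_P(1,2)[OF x 2] load_typed[OF x 2] p False ex_le_eps[of x] ce
          by (intro typed_bound_0[where \<delta> = "dbl x"]) (auto simp: dblD)
        then show ?thesis using 2 by (simp add: cost_def \<mu>_def load_def wt_def)
      qed
    next
      case 3
      have "real eU * real (card (L x)) \<le> \<mu> * real (card (L x))"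
        using mu eU2 by (intro mult_right_mono) auto
      then show ?thesis using 3 cost_double[of x] by (simp add: load_def wt_def)
    qed
  qed
  have T: "T \<le> (real D)\<^sup>2 / 3 + (\<Sum>x\<in>M. cost x) + real eU * real (card eps)"
    using T_le_cost by (simp add: Z)
  show ?thesis
  proof (cases "\<exists>x\<in>M. d x = 0 \<and> ex x \<ge> 2")
    case False
    have "(\<Sum>x\<in>M. cost x) \<le> \<mu> * (\<Sum>x\<in>M. load x) + boost D * real (\<Sum>x\<in>M. wt x * ex x)"
      using mu charge False by (intro T_le_charge) force+
    also have "\<dots> \<le> \<mu> * (real p - real D) + boost D * (2 * real (card eps))"
    proof (rule add_mono)
      show "\<mu> * (\<Sum>x\<in>M. load x) \<le> \<mu> * (real p - real D)"
        using sum_load_M mu by (intro mult_left_mono) auto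
      have "real (\<Sum>x\<in>M. wt x * ex x) \<le> real (2 * card eps)"
        using sum_ex_le by (rule of_nat_mono)
      then show "boost D * real (\<Sum>x\<in>M. wt x * ex x) \<le> boost D * (2 * real (card eps))"
        using bst by (intro mult_left_mono) auto
    qed
    finally have "T \<le> (real D)\<^sup>2 / 3 + \<mu> * (real p - real D) + boost D * (2 * real (card eps)) + real eU * real (card eps)"
      using T by linarith
    also have "\<dots> \<le> (real p + 4)\<^sup>2 / 3 - 6"
      unfolding \<mu>_def using Dp p ce by (intro total_bound_0) auto
    finally show ?thesis .
  next
    case True
    then obtain x0 where x0: "x0 \<in> M" "d x0 = 0" "ex x0 \<ge> 2" by blast
    have eps2: "card eps = 2" "eU = 0" "ex x0 = 2" using ex_le_eps[of x0] x0 ce by linarith+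
    let ?A = "M - {x0}"
    \<comment> \<open>Two unowned edges allow a weighted total of 4, and \<open>x0\<close> with
      weight 2 uses all of it. Every other vertex therefore has \<open>wt x * ex x = 0\<close> and
      meets the ordinary rate.\<close>
    have "wt x0 * ex x0 + (\<Sum>x\<in>?A. wt x * ex x) \<le> 4"
      using sum_ex_le eps2 sum.remove[OF finM x0(1), of "\<lambda>x. wt x * ex x"] by simp
    then have zero: "(\<Sum>x\<in>?A. wt x * ex x) = 0" using x0 eps2 by (simp add: wt_def)
    have ex0: "wt x * ex x = 0" if "x \<in> ?A" for x
      using zero finM that by (auto simp: sum_eq_0_iff)
    have "(\<Sum>x\<in>?A. cost x) \<le> \<mu> * (\<Sum>x\<in>?A. load x) + boost D * real (\<Sum>x\<in>?A. wt x * ex x)"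
    proof (rule T_le_charge)
      fix x assume x: "x \<in> ?A"
      show "cost x \<le> \<mu> * load x + boost D * real (wt x * ex x)"
      proof (rule charge)
        show "x \<in> M" using x by simp
        show "ex x \<le> 1" if "d x = 0" using ex0[OF x] that by (simp add: wt_def)
      qed
    qed (use mu in auto)
    then have rest: "(\<Sum>x\<in>?A. cost x) \<le> \<mu> * (\<Sum>x\<in>?A. load x)" by (simp add: zero)
    define b where "b = 1 + real (card (L x0))"
    define s where "s = real p - real D - b"
    have s0: "s \<ge> 0" using load_untyped[OF x0(1,2)] by (simp add: s_def b_def)
    have p_eq: "b + real D + s = real p" by (simp add: s_def)
    have "b + (\<Sum>x\<in>?A. load x) = (\<Sum>x\<in>M. load x)"
      using finM x0(1,2) by (simp add: sum.remove load_def b_def)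
    then have "(\<Sum>x\<in>?A. load x) \<le> s" using sum_load_M by (simp add: s_def)
    then have "\<mu> * (\<Sum>x\<in>?A. load x) \<le> \<mu> * s" using mu by (intro mult_left_mono) auto
    moreover have "(\<Sum>x\<in>M. cost x) = P x0 + (\<Sum>x\<in>?A. cost x)"
      using finM x0(1,2) by (simp add: sum.remove cost_def)
    ultimately have "T \<le> (real D)\<^sup>2 / 3 + \<mu> * s + P x0"
      using T rest eps2 by simp
    also have "\<dots> \<le> (real p + 4)\<^sup>2 / 3 - 6"
    proof -
      have "3 * (P x0 + real (dbl x0)) \<le> (b + 3 + real (dbl x0))\<^sup>2"
        using untyped_P(1)[OF x0(1,2)] by (simp add: trp b_def eps2 add.commute)
      then show ?thesis
        using special_bound_0[of b s "dbl x0" D "P x0"] s0 p untyped_P(2)[OF x0(1,2)] eps2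
        unfolding p_eq \<mu>_def by (simp add: dblD b_def)
    qed
    finally show ?thesis .
  qed
qed

lemma bound_1:
  assumes Z: "card Z = 1" and p: "p \<ge> 7"
  shows "T \<le> (real p + 5)\<^sup>2 / 3 - 6"
proof -
  define \<mu> where "\<mu> = real p / 3 + 10 / 3"
  define \<beta> where "\<beta> = (if D = 0 then 1 else 2 :: real)"
  have mu: "\<mu> \<ge> 0" by (simp add: \<mu>_def)
  have e0: "eU = 0" using eU_zero Z by force
  have ce: "card eps \<le> 1" using card_eps Z by simp
  have trp: "trp x \<le> 1" for x using trp_le[of x] Z by simp
  have Dp: "real D \<le> real p" using M_split by simp
  have charge: "cost x \<le> \<mu> * load x + \<beta> * real (wt x * ex x)"
    if x: "x \<in> M" and e1: "d x = 0 \<Longrightarrow> ex x = 0" for x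
  proof -
    consider "d x = 0" | "d x = 1" | "d x = 2" using d_cases[OF x] by metis
    then show ?thesis
    proof cases
      case 1
      define b where "b = 1 + real (card (L x))"
      define s where "s = real p - real D - b"
      have s0: "s \<ge> 0" using load_untyped[OF x 1] by (simp add: s_def b_def)
      have p_eq: "b + real D + s = real p" by (simp add: s_def)
      have "3 * (P x + real (dbl x) + 3 * real (trp x)) \<le> (b + 1 + real (dbl x) + 2 * real (trp x))\<^sup>2"
        using untyped_P(1)[OF x 1] e1[OF 1] by (simp add: b_def)
      then have "P x \<le> ((b + real D + s) / 3 + 10 / 3) * b"
        using untyped_P(2)[OF x 1] s0 e1[OF 1] trp[of x] p p_eq
        by (intro untyped_bound_1[where \<delta> = "dbl x" and \<tau> = "trp x"]) (auto simp: dblD b_def)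
      then show ?thesis using 1 e1[OF 1] unfolding p_eq
        by (simp add: cost_def \<mu>_def load_def wt_def b_def add.commute)
    next
      case 2
      show ?thesis
      proof (cases "card (L x) = 0 \<and> ex x = 0")
        case True
        then show ?thesis using typed_P(3)[OF x 2] 2 by (simp add: cost_def load_def)
      next
        case False
        have "P x \<le> (real p / 3 + 10 / 3) * real (card (L x)) + (if D = 0 then 1 else 2) * real (ex x)"
          using typed_P(1,2)[OF x 2] load_typed[OF x 2] p False ex_le_eps[of x] ce
          by (intro typed_bound_1[where \<delta> = "dbl x"]) (auto simp: dblD)
        then show ?thesis using 2 by (simp add: cost_def \<mu>_def \<beta>_def load_def wt_def e0)
      qed
    next
      case 3
      then show ?thesis using cost_double[of x] mu by (simp add: load_def wt_def e0)
    qed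
  qed
  have T: "T \<le> (real D + 3)\<^sup>2 / 3 - 3 + (\<Sum>x\<in>M. cost x)"
    using T_le_cost by (simp add: Z e0)
  show ?thesis
  proof (cases "\<exists>x\<in>M. d x = 0 \<and> ex x \<ge> 1")
    case False
    have "(\<Sum>x\<in>M. cost x) \<le> \<mu> * (\<Sum>x\<in>M. load x) + \<beta> * real (\<Sum>x\<in>M. wt x * ex x)"
      using mu charge False by (intro T_le_charge) force+
    also have "\<dots> \<le> \<mu> * (real p - real D) + \<beta> * (2 * real (card eps))"
    proof (rule add_mono)
      show "\<mu> * (\<Sum>x\<in>M. load x) \<le> \<mu> * (real p - real D)"
        using sum_load_M mu by (intro mult_left_mono) auto
      have "real (\<Sum>x\<in>M. wt x * ex x) \<le> real (2 * card eps)"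
        using sum_ex_le by (rule of_nat_mono)
      then show "\<beta> * real (\<Sum>x\<in>M. wt x * ex x) \<le> \<beta> * (2 * real (card eps))"
        by (intro mult_left_mono) (auto simp: \<beta>_def)
    qed
    finally have "T \<le> (real D + 3)\<^sup>2 / 3 - 3 + \<mu> * (real p - real D) + \<beta> * (2 * real (card eps))"
      using T by linarith
    also have "\<dots> \<le> (real p + 5)\<^sup>2 / 3 - 6"
      unfolding \<mu>_def \<beta>_def using Dp p ce by (intro total_bound_1) auto
    finally show ?thesis .
  next
    case True
    then obtain x0 where x0: "x0 \<in> M" "d x0 = 0" "ex x0 \<ge> 1" by blast
    have eps1: "card eps = 1" "ex x0 = 1" using ex_le_eps[of x0] x0 ce by linarith+
    let ?A = "M - {x0}"
    \<comment> \<open>With a single unowned edge the allowance is 2, again used up entirely by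
      \<open>x0\<close>.\<close>
    have "wt x0 * ex x0 + (\<Sum>x\<in>?A. wt x * ex x) \<le> 2"
      using sum_ex_le eps1 sum.remove[OF finM x0(1), of "\<lambda>x. wt x * ex x"] by simp
    then have zero: "(\<Sum>x\<in>?A. wt x * ex x) = 0" using x0 eps1 by (simp add: wt_def)
    have ex0: "wt x * ex x = 0" if "x \<in> ?A" for x
      using zero finM that by (auto simp: sum_eq_0_iff)
    have "(\<Sum>x\<in>?A. cost x) \<le> \<mu> * (\<Sum>x\<in>?A. load x) + \<beta> * real (\<Sum>x\<in>?A. wt x * ex x)"
    proof (rule T_le_charge)
      fix x assume x: "x \<in> ?A"
      show "cost x \<le> \<mu> * load x + \<beta> * real (wt x * ex x)"
      proof (rule charge)
        show "x \<in> M" using x by simp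
        show "ex x = 0" if "d x = 0" using ex0[OF x] that by (simp add: wt_def)
      qed
    qed (use mu in auto)
    then have rest: "(\<Sum>x\<in>?A. cost x) \<le> \<mu> * (\<Sum>x\<in>?A. load x)" by (simp add: zero)
    define b where "b = 1 + real (card (L x0))"
    define s where "s = real p - real D - b"
    have s0: "s \<ge> 0" using load_untyped[OF x0(1,2)] by (simp add: s_def b_def)
    have p_eq: "b + real D + s = real p" by (simp add: s_def)
    have "b + (\<Sum>x\<in>?A. load x) = (\<Sum>x\<in>M. load x)"
      using finM x0(1,2) by (simp add: sum.remove load_def b_def)
    then have "(\<Sum>x\<in>?A. load x) \<le> s" using sum_load_M by (simp add: s_def)
    then have "\<mu> * (\<Sum>x\<in>?A. load x) \<le> \<mu> * s" using mu by (intro mult_left_mono) auto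
    moreover have "(\<Sum>x\<in>M. cost x) = P x0 + (\<Sum>x\<in>?A. cost x)"
      using finM x0(1,2) by (simp add: sum.remove cost_def)
    ultimately have "T \<le> (real D + 3)\<^sup>2 / 3 - 3 + \<mu> * s + P x0"
      using T rest by simp
    also have "\<dots> \<le> (real p + 5)\<^sup>2 / 3 - 6"
    proof -
      have "3 * (P x0 + real (dbl x0) + 3 * real (trp x0)) \<le> (b + 2 + real (dbl x0) + 2 * real (trp x0))\<^sup>2"
        using untyped_P(1)[OF x0(1,2)] by (simp add: b_def eps1 add.commute)
      then show ?thesis
        using special_bound_1[of b s "dbl x0" D "trp x0" "P x0"] s0 p untyped_P(2)[OF x0(1,2)] eps1 trp[of x0]
        unfolding p_eq \<mu>_def by (simp add: dblD b_def)
    qed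
    finally show ?thesis .
  qed
qed

lemma bound_2:
  assumes Z: "card Z = 2" and p: "p \<ge> 6"
  shows "T \<le> (real p + 6)\<^sup>2 / 3 - 6"
proof -
  define \<mu> where "\<mu> = real p / 3 + 4"
  have mu: "\<mu> \<ge> 0" by (simp add: \<mu>_def)
  have e0: "eU = 0" using eU_zero Z by force
  have "card eps = 0" using card_eps Z by simp
  then have ex0: "ex x = 0" for x using ex_le_eps[of x] by simp
  have Dp: "real D \<le> real p" using M_split by simp
  have charge: "cost x \<le> \<mu> * load x + 0 * real (wt x * ex x)" if x: "x \<in> M" for x
  proof -
    consider "d x = 0" | "d x = 1" | "d x = 2" using d_cases[OF x] by metis
    then show ?thesis
    proof cases
      case 1
      define b where "b = 1 + real (card (L x))"
      define s where "s = real p - real D - b"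
      have s0: "s \<ge> 0" using load_untyped[OF x 1] by (simp add: s_def b_def)
      have p_eq: "b + real D + s = real p" by (simp add: s_def)
      have "3 * (P x + real (dbl x) + 3 * real (trp x)) \<le> (b + 1 + real (dbl x) + 2 * real (trp x))\<^sup>2"
        using untyped_P(1)[OF x 1] ex0[of x] by (simp add: b_def)
      then have "P x \<le> ((b + real D + s) / 3 + 4) * b"
        using untyped_P(2)[OF x 1] s0 ex0[of x] p p_eq
        by (intro untyped_bound_2[where \<delta> = "dbl x" and \<tau> = "trp x"]) (auto simp: b_def)
      then show ?thesis using 1 unfolding p_eq
        by (simp add: cost_def \<mu>_def load_def b_def add.commute)
    next
      case 2
      show ?thesis
      proof (cases "card (L x) = 0")
        case True
        then show ?thesis using typed_P(3)[OF x 2] 2 ex0 by (simp add: cost_def load_def)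
      next
        case False
        have "P x \<le> (real p / 3 + 4) * real (card (L x))"
          using typed_P(1,2)[OF x 2] load_typed[OF x 2] False ex0[of x]
          by (intro typed_bound_2[where \<delta> = "dbl x"]) auto
        then show ?thesis using 2 by (simp add: cost_def \<mu>_def load_def e0)
      qed
    next
      case 3
      then show ?thesis using cost_double[of x] mu by (simp add: load_def e0)
    qed
  qed
  have "(\<Sum>x\<in>M. cost x) \<le> \<mu> * (\<Sum>x\<in>M. load x) + 0 * real (\<Sum>x\<in>M. wt x * ex x)"
    using mu charge by (intro T_le_charge) auto
  also have "\<dots> \<le> \<mu> * (real p - real D)"
    using sum_load_M mu by (simp add: mult_left_mono)
  finally have "T \<le> (real D + 6)\<^sup>2 / 3 - 6 + \<mu> * (real p - real D)"
    using T_le_cost by (simp add: Z e0)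
  also have "\<dots> \<le> (real p + 6)\<^sup>2 / 3 - 6"
    unfolding \<mu>_def using Dp by (rule total_bound_2)
  finally show ?thesis .
qed

lemma card_V: "card V = p + card Z + 3"
proof -
  have "V = U \<union> W" using U_in_V by (auto simp: W_def U_def)
  then have "card V = card U + card W"
    using finU finW card_Un_disjoint[of U W] by (auto simp: W_def)
  moreover have "card W = card M + card Z"
    using card_Un_disjoint[of M Z] finM finZ by (auto simp: M_def Z_def Un_absorb2 Collect_mono_iff subset_iff)
  ultimately show ?thesis by (simp add: p_def card_U)
qed

text \<open>Since n = p + |Z| + 3, order 11 gives the lower bounds 8, 7 and 6 for p that the three
  cases use.\<close>

lemma T_le:
  assumes "card V \<ge> 11"
  shows "T \<le> 3 * ((real (card V) + 1) / 3)\<^sup>2 - 6"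
proof -
  have "T \<le> (real p + 4 + real (card Z))\<^sup>2 / 3 - 6"
  proof -
    have "card Z = 0 \<or> card Z = 1 \<or> card Z = 2" using card_eps by linarith
    then show ?thesis
      using bound_0 bound_1 bound_2 assms card_V finZ by (elim disjE) (auto simp: add.commute)
  qed
  also have "\<dots> = 3 * ((real (card V) + 1) / 3)\<^sup>2 - 6"
    by (simp add: card_V power2_eq_square add_ac)
  finally show ?thesis .
qed

end

theorem (in sparse_triangle_free) path_count_le:
  assumes "card V \<ge> 11"
  shows "T \<le> 3 * ((real (card V) + 1) / 3)\<^sup>2 - 6"
proof -
  obtain eps own where "eps \<subseteq> F" "card eps + card Z + eU \<le> 2"
     "\<forall>f\<in>F - eps. own f \<in> f \<inter> M" "\<forall>w\<in>M. card {f\<in>F - eps. own f = w} \<le> 2 - d w"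
    using exists_ownership by blast
  then interpret owned_graph V adj u1 u2 u3 eps own by unfold_locales auto
  show ?thesis by (rule T_le[OF assms])
qed

subsection \<open>Cycles and chords in two-connected graphs\<close>

fun pedges :: "'a list \<Rightarrow> 'a set set" where
  "pedges (a # b # xs) = insert {a, b} (pedges (b # xs))"
| "pedges _ = {}"

lemma pedges_append: "pedges (xs @ y # ys) = pedges (xs @ [y]) \<union> pedges (y # ys)"
  by (induction xs rule: pedges.induct) auto

lemma pedges_rev: "pedges (rev xs) = pedges xs"
proof (induction xs rule: pedges.induct)
  case (1 a b xs)
  have "pedges (rev (a # b # xs)) = pedges (rev xs @ b # [a])" by simp
  also have "\<dots> = pedges (rev (b # xs)) \<union> {{a, b}}"
    by (subst pedges_append) (simp add: insert_commute)
  finally show ?case using 1 by simp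
qed auto

lemma pedges_subset: "e \<in> pedges xs \<Longrightarrow> e \<subseteq> set xs"
  by (induction xs rule: pedges.induct) auto

lemma Union_pedges: "2 \<le> length xs \<Longrightarrow> \<Union>(pedges xs) = set xs"
proof (induction xs rule: pedges.induct)
  case (1 a b xs)
  then show ?case by (cases xs) auto
qed auto

lemma finite_pedges: "finite (pedges xs)"
  by (induction xs rule: pedges.induct) auto

lemma card_pedges_le: "card (pedges xs) \<le> length xs - 1"
proof (induction xs rule: pedges.induct)
  case (1 a b xs)
  then show ?case using card_insert_le_m1[of "length (b # xs)" "pedges (b # xs)" "{a, b}"] by simp
qed auto

lemma pedges_successively: "pedges xs \<subseteq> E \<longleftrightarrow> successively (\<lambda>a b. {a, b} \<in> E) xs"
  by (induction xs rule: pedges.induct) auto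

definition ispath :: "'a set set \<Rightarrow> 'a \<Rightarrow> 'a \<Rightarrow> 'a list \<Rightarrow> bool" where
  "ispath E x y P \<longleftrightarrow> distinct P \<and> P \<noteq> [] \<and> hd P = x \<and> last P = y \<and> x \<noteq> y \<and> pedges P \<subseteq> E"

lemma ispath_decompose:
  assumes "ispath E x y P" shows "\<exists>ps. P = x # ps @ [y]"
proof -
  obtain qs where "P = x # qs" using assms by (cases P) (auto simp: ispath_def)
  moreover have "qs \<noteq> []" using assms calculation by (auto simp: ispath_def)
  ultimately show ?thesis using assms append_butlast_last_id[of qs] unfolding ispath_def by (metis last_ConsR)
qed

lemma ispath_length: "ispath E x y P \<Longrightarrow> 2 \<le> length P"
  using ispath_decompose by fastforce

text \<open>A cycle is kept as its edge set, so that neither a starting vertex nor a direction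
  enters the later arguments.\<close>

definition cyc :: "'a set set \<Rightarrow> 'a set set \<Rightarrow> bool" where
  "cyc E C \<longleftrightarrow> (\<exists>xs. distinct xs \<and> 3 \<le> length xs \<and> C = pedges (xs @ [hd xs]) \<and> C \<subseteq> E)"

lemma cyc_subset: "cyc E C \<Longrightarrow> C \<subseteq> E" by (auto simp: cyc_def)

lemma Union_cycle: "3 \<le> length xs \<Longrightarrow> \<Union>(pedges (xs @ [hd xs])) = set xs"
  by (subst Union_pedges) (auto simp: hd_in_set, cases xs, auto)

lemma cyc_finite: "cyc E C \<Longrightarrow> finite C \<and> finite (\<Union>C)"
  by (metis Union_cycle cyc_def finite_pedges List.finite_set)

lemma cyc_card: "cyc E C \<Longrightarrow> card C \<le> card (\<Union>C) \<and> 3 \<le> card (\<Union>C)"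
  unfolding cyc_def using Union_cycle card_pedges_le
  by (metis add_diff_cancel_right' distinct_card length_append length_append_singleton One_nat_def list.size(3) list.size(4) Nat.add_0_right plus_1_eq_Suc add.commute diff_Suc_1)

text \<open>Rotate the list so that it starts at \<open>x\<close>, cut it at \<open>y\<close>, and
  read the second part backwards.\<close>

lemma cyc_split:
  assumes "cyc E C" "x \<in> \<Union>C" "y \<in> \<Union>C" "x \<noteq> y"
  shows "\<exists>P Q. ispath E x y P \<and> ispath E x y Q \<and> C = pedges P \<union> pedges Q \<and> set P \<inter> set Q = {x, y}
    \<and> set P \<union> set Q = \<Union>C"
proof -
  obtain xs where xs: "distinct xs" "3 \<le> length xs" "C = pedges (xs @ [hd xs])" "C \<subseteq> E"
    using assms(1) by (auto simp: cyc_def)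
  have U: "\<Union>C = set xs" using Union_cycle xs by simp
  then have "x \<in> set xs" using assms by simp
  then obtain as bs where asbs: "xs = as @ x # bs" by (meson split_list)
  define zs where "zs = bs @ as"
  have C: "C = pedges (x # zs @ [x])"
  proof (cases as)
    case Nil then show ?thesis using xs asbs by (simp add: zs_def)
  next
    case (Cons a as')
    have "C = pedges (as @ x # (bs @ [a]))" using xs asbs Cons by simp
    also have "\<dots> = pedges (as @ [x]) \<union> pedges ((x # bs) @ [a])" by (subst pedges_append) simp
    also have "\<dots> = pedges ((x # bs) @ a # (as' @ [x]))"
      using Cons by (subst (2) pedges_append) auto
    finally show ?thesis using Cons by (simp add: zs_def)
  qed
  have dz: "distinct (x # zs)" "set xs = set (x # zs)" using xs(1) asbs by (auto simp: zs_def)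
  have "y \<in> set zs" using assms U dz by auto
  then obtain cs ds where cd: "zs = cs @ y # ds" by (meson split_list)
  define P where "P = x # cs @ [y]"
  define Q where "Q = x # rev ds @ [y]"
  have "C = pedges ((x # cs) @ y # (ds @ [x]))" using C cd by simp
  also have "\<dots> = pedges P \<union> pedges (y # ds @ [x])" by (subst pedges_append) (simp add: P_def)
  also have "pedges (y # ds @ [x]) = pedges Q" using pedges_rev[of Q] by (simp add: Q_def)
  finally have C': "C = pedges P \<union> pedges Q" .
  have "ispath E x y P" "ispath E x y Q" "set P \<inter> set Q = {x, y}" "set P \<union> set Q = set xs"
    using C' xs(4) dz cd assms(4) by (auto simp: ispath_def P_def Q_def)
  then show ?thesis using C' U by blast
qed

lemma cyc_join:
  assumes "ispath E x y P" "ispath E x y Q" "set P \<inter> set Q = {x, y}" "3 \<le> length P \<or> 3 \<le> length Q"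
  shows "cyc E (pedges P \<union> pedges Q)"
proof -
  obtain ps qs where pq: "P = x # ps @ [y]" "Q = x # qs @ [y]"
    using ispath_decompose assms by metis
  let ?xs = "x # ps @ y # rev qs"
  have "distinct ?xs" using assms unfolding ispath_def pq by auto
  moreover have "3 \<le> length ?xs" using assms(4) pq by auto
  moreover have "pedges (?xs @ [hd ?xs]) = pedges P \<union> pedges Q"
  proof -
    have "pedges (?xs @ [hd ?xs]) = pedges ((x # ps) @ y # (rev qs @ [x]))" by simp
    also have "\<dots> = pedges P \<union> pedges (rev Q)" by (subst pedges_append) (simp add: pq)
    finally show ?thesis by (simp add: pedges_rev)
  qed
  ultimately show ?thesis using assms unfolding cyc_def ispath_def by (metis Un_subset_iff)
qed

lemma rtrancl_imp_simple_path:
  assumes "(a, b) \<in> r\<^sup>*"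
  shows "\<exists>xs. distinct xs \<and> xs \<noteq> [] \<and> hd xs = a \<and> last xs = b \<and> successively (\<lambda>u v. (u, v) \<in> r) xs"
  using assms
proof (induction rule: rtrancl_induct)
  case base
  then show ?case by (intro exI[of _ "[a]"]) simp
next
  case (step b c)
  then obtain xs where xs: "distinct xs" "xs \<noteq> []" "hd xs = a" "last xs = b" "successively (\<lambda>u v. (u, v) \<in> r) xs"
    by blast
  show ?case
  proof (cases "c \<in> set xs")
    case False
    then show ?thesis using xs step(2)
      by (intro exI[of _ "xs @ [c]"]) (auto simp: successively_append_iff)
  next
    case True
    then obtain as bs where "xs = as @ c # bs" by (meson split_list)
    then show ?thesis using xs
      by (intro exI[of _ "as @ [c]"]) (auto simp: successively_append_iff hd_append split: if_splits)
  qed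
qed

section \<open>Cycles and ears in two-connected graphs\<close>

text \<open>\<open>leave\<close> is 2-connectivity in cut form: no vertex \<open>v\<close> separates
  \<open>K\<close> from the vertices outside \<open>insert v K\<close>. This form is convenient both
  for finding ears and for splitting a minimal counterexample.\<close>

locale two_connected_graph =
  fixes V :: "'a set" and E :: "'a set set"
  assumes finV: "finite V"
    and edge: "e \<in> E \<Longrightarrow> \<exists>a b. e = {a, b} \<and> a \<noteq> b \<and> a \<in> V \<and> b \<in> V"
    and leave: "K \<noteq> {} \<Longrightarrow> K \<subseteq> V \<Longrightarrow> v \<in> V - K \<Longrightarrow> insert v K \<noteq> V \<Longrightarrow>
      \<exists>k\<in>K. \<exists>y. y \<notin> insert v K \<and> {k, y} \<in> E"
begin

lemma edge_in_V: "{a, b} \<in> E \<Longrightarrow> a \<noteq> b \<and> a \<in> V \<and> b \<in> V"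
  using edge[of "{a, b}"] by (auto simp: doubleton_eq_iff)

lemma finE: "finite E"
  by (rule finite_subset[of _ "Pow V"]) (use edge finV in auto)

text \<open>An edge a b is not a bridge: \<open>b\<close> is reachable from \<open>a\<close> without
  it, and such a path closes to a cycle with the edge.\<close>

lemma exists_cycle:
  assumes "3 \<le> card V" "E \<noteq> {}"
  shows "\<exists>C. cyc E C"
proof -
  obtain a b where ab: "{a, b} \<in> E" "a \<noteq> b" "a \<in> V" "b \<in> V"
  proof -
    obtain e where e: "e \<in> E" using assms(2) by auto
    then obtain a b where "e = {a, b}" "a \<noteq> b" "a \<in> V" "b \<in> V" using edge[OF e] by (elim exE conjE)
    then show thesis using that e by simp
  qed
  define r where "r = {(u, v). {u, v} \<in> E - {{a, b}}}"
  define K where "K = {v. (a, v) \<in> r\<^sup>*}"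
  have step: "y \<in> K" if "k \<in> K" "{k, y} \<in> E" "{k, y} \<noteq> {a, b}" for k y
    using that by (auto simp: K_def r_def intro: rtrancl.rtrancl_into_rtrancl)
  have KV: "K \<subseteq> V"
  proof
    fix v assume "v \<in> K"
    then have "(a, v) \<in> r\<^sup>*" by (simp add: K_def)
    then show "v \<in> V"
    proof (induction rule: rtrancl_induct)
      case (step y z)
      then have "{y, z} \<in> E" by (simp add: r_def)
      then show ?case using edge_in_V by simp
    qed (use ab in simp)
  qed
  have aK: "a \<in> K" by (simp add: K_def)
  have "b \<in> K"
  proof (rule ccontr)
    assume bK: "b \<notin> K"
    show False
    proof (cases "insert b K = V")
      case False
      have "\<exists>k\<in>K. \<exists>y. y \<notin> insert b K \<and> {k, y} \<in> E"
        by (rule leave) (use aK KV ab bK False in auto)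
      then obtain k y where "k \<in> K" "y \<notin> insert b K" "{k, y} \<in> E" by blast
      then show False using step[of k y] bK by (auto simp: doubleton_eq_iff)
    next
      \<comment> \<open>Everything except \<open>b\<close> is reachable. Taking \<open>a\<close> as
        the cut vertex yields an edge to \<open>b\<close> from a vertex other than
        \<open>a\<close>.\<close>
      case True
      let ?K = "K - {a}"
      have "?K \<noteq> {}"
      proof
        assume "?K = {}"
        then have "V = {a, b}" using True aK by auto
        then show False using assms(1) ab by (simp add: card_insert_if)
      qed
      moreover have "insert a ?K \<noteq> V" using bK ab aK by auto
      ultimately have "\<exists>k\<in>?K. \<exists>y. y \<notin> insert a ?K \<and> {k, y} \<in> E"
        by (intro leave) (use KV ab in auto)
      then obtain k y where k: "k \<in> ?K" "y \<notin> insert a ?K" "{k, y} \<in> E" by blast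
      then have "{k, y} \<noteq> {a, b}" using bK by (auto simp: doubleton_eq_iff)
      then show False using step[of k y] k by auto
    qed
  qed
  then obtain xs where xs: "distinct xs" "xs \<noteq> []" "hd xs = a" "last xs = b" "successively (\<lambda>u v. (u, v) \<in> r) xs"
    using rtrancl_imp_simple_path[of a b r] by (auto simp: K_def)
  have pe: "pedges xs \<subseteq> E - {{a, b}}" using xs(5) pedges_successively[of xs "E - {{a, b}}"] by (simp add: r_def)
  have ip: "ispath E a b xs" using xs pe ab by (auto simp: ispath_def)
  have "3 \<le> length xs"
  proof -
    obtain ps where ps: "xs = a # ps @ [b]" using ispath_decompose[OF ip] by blast
    then have "ps \<noteq> []" using pe by auto
    then show ?thesis using ps by (cases ps) auto
  qed
  moreover have "ispath E a b [a, b]" using ab by (simp add: ispath_def)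
  moreover have "set xs \<inter> set [a, b] = {a, b}" using xs(3,4) hd_in_set[OF xs(2)] last_in_set[OF xs(2)] by auto
  ultimately show ?thesis using cyc_join[OF ip] by blast
qed

text \<open>Intended for the vertices \<open>S\<close> of a cycle, the vertices \<open>I\<close>
  inside it and the edges \<open>J\<close> inside it. If no member of \<open>J\<close> joins two
  vertices of \<open>S\<close>, a component \<open>K\<close> of the subgraph on \<open>I\<close>
  has, by \<open>leave\<close>, neighbours in \<open>S\<close> beyond any single one, hence two
  attachments joined by a path through \<open>K\<close>.\<close>

lemma exists_chord:
  assumes S: "S \<subseteq> V" "2 \<le> card S" and I: "I \<subseteq> V" "I \<inter> S = {}"
    and J: "J \<subseteq> E" "J \<noteq> {}" "\<And>e. e \<in> J \<Longrightarrow> e \<subseteq> S \<union> I" "\<And>e. e \<in> E \<Longrightarrow> e \<inter> I \<noteq> {} \<Longrightarrow> e \<in> J"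
  shows "\<exists>x y R. x \<in> S \<and> y \<in> S \<and> ispath J x y R \<and> set R \<inter> S = {x, y} \<and> set R - {x, y} \<subseteq> I"
proof (cases "\<exists>e\<in>J. e \<subseteq> S")
  case True
  then obtain e where e: "e \<in> J" "e \<subseteq> S" by blast
  then obtain a b where "e = {a, b}" "a \<noteq> b" using edge J(1) by blast
  then show ?thesis using e
    by (intro exI[of _ a] exI[of _ b] exI[of _ "[a, b]"]) (auto simp: ispath_def)
next
  case False
  then obtain a where a: "a \<in> I" using J(2,3) by blast
  define r where "r = {(u, v). {u, v} \<in> E \<and> u \<in> I \<and> v \<in> I}"
  define K where "K = {v. (a, v) \<in> r\<^sup>*}"
  have aK: "a \<in> K" by (simp add: K_def)
  have KI: "K \<subseteq> I"
  proof
    fix v assume "v \<in> K"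
    then have "(a, v) \<in> r\<^sup>*" by (simp add: K_def)
    then show "v \<in> I" by (cases rule: rtrancl.cases) (use a in \<open>auto simp: r_def\<close>)
  qed
  have nb: "y \<in> K \<or> y \<in> S" if "k \<in> K" "{k, y} \<in> E" for k y
  proof -
    have "{k, y} \<in> J" using J(4)[OF that(2)] KI that(1) by auto
    then have "y \<in> S \<or> y \<in> I" using J(3) by auto
    then show ?thesis using that KI by (auto simp: K_def r_def intro: rtrancl.rtrancl_into_rtrancl)
  qed
  have exit: "\<exists>k\<in>K. \<exists>y\<in>S. y \<noteq> v \<and> {k, y} \<in> E" if "v \<in> S" for v
  proof -
    have "insert v K \<noteq> V"
    proof
      assume "insert v K = V"
      then have "S \<subseteq> {v}" using S(1) KI I(2) by blast
      then have "card S \<le> card {v}" by (intro card_mono) auto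
      then show False using S(2) by simp
    qed
    then have "\<exists>k\<in>K. \<exists>y. y \<notin> insert v K \<and> {k, y} \<in> E"
      by (intro leave) (use aK KI I S that in auto)
    then obtain k y where "k \<in> K" "y \<notin> insert v K" "{k, y} \<in> E" by blast
    then show ?thesis using nb[of k y] by auto
  qed
  obtain v where v: "v \<in> S" using S(2) by fastforce
  obtain k y where ky: "k \<in> K" "y \<in> S" "{k, y} \<in> E" using exit[OF v] by blast
  obtain k' x where kx: "k' \<in> K" "x \<in> S" "x \<noteq> y" "{k', x} \<in> E" using exit[OF ky(2)] by blast
  have sym: "sym r" by (auto simp: sym_def r_def insert_commute)
  then have "(k', a) \<in> r\<^sup>*" using kx(1) symD[OF sym_rtrancl[OF sym]] by (simp add: K_def)
  moreover have "(a, k) \<in> r\<^sup>*" using ky(1) by (simp add: K_def)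
  ultimately have "(k', k) \<in> r\<^sup>*" by (rule rtrancl_trans)
  then obtain xs where xs: "distinct xs" "xs \<noteq> []" "hd xs = k'" "last xs = k" "successively (\<lambda>u v. (u, v) \<in> r) xs"
    using rtrancl_imp_simple_path by metis
  have setI: "set xs \<subseteq> I"
  proof (cases xs)
    case (Cons z zs)
    show ?thesis
    proof (cases zs)
      case Nil
      then show ?thesis using xs Cons kx KI by auto
    next
      case (Cons w ws)
      have "2 \<le> length xs" using \<open>xs = z # zs\<close> Cons by simp
      then have "set xs = \<Union>(pedges xs)" by (rule Union_pedges[symmetric])
      moreover have "pedges xs \<subseteq> {e. e \<subseteq> I}"
        unfolding pedges_successively by (rule successively_mono[OF xs(5)]) (auto simp: r_def)
      ultimately show ?thesis by auto
    qed
  qed (use xs in simp)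
  let ?R = "x # xs @ [y]"
  have "pedges ?R \<subseteq> J"
  proof -
    have "successively (\<lambda>a b. {a, b} \<in> J) xs"
      by (rule successively_mono[OF xs(5)]) (use J(4) in \<open>auto simp: r_def\<close>)
    moreover have "{x, hd xs} \<in> J" using J(4)[OF kx(4)] kx(1) KI xs(3) by (auto simp: insert_commute)
    moreover have "{last xs, y} \<in> J" using J(4)[OF ky(3)] ky(1) KI xs(4) by auto
    ultimately show ?thesis
      unfolding pedges_successively using xs(2)
      by (auto simp: successively_Cons successively_append_iff hd_append)
  qed
  then have "ispath J x y ?R" using xs(1) setI I(2) kx ky by (auto simp: ispath_def)
  then show ?thesis using kx ky setI I(2) by (intro exI[of _ x] exI[of _ y] exI[of _ ?R]) auto
qed

end

subsection \<open>Theta curves\<close>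

text \<open>The inverse of the arc maps a disc inside its image injectively and continuously into
  the line. Deleting the point with the middle one of three values leaves the disc connected but its
  image not an interval.\<close>

lemma interior_arc_image_empty:
  fixes g :: "real \<Rightarrow> complex"
  assumes "arc g"
  shows "interior (path_image g) = {}"
proof (rule ccontr)
  assume "interior (path_image g) \<noteq> {}"
  then obtain z r where r: "r > 0" "ball z r \<subseteq> path_image g"
    by (meson ex_in_conv mem_interior)
  define h where "h = inv_into {0..1} g"
  have inj: "inj_on g {0..1}" and cg: "continuous_on {0..1} g" using assms by (auto simp: arc_def path_def)
  have ch: "continuous_on (path_image g) h"
    unfolding h_def path_image_def
    by (rule continuous_on_inv[OF cg]) (auto simp: inj)
  have injh: "inj_on h (ball z r)"
    unfolding h_def by (rule inj_on_subset[OF inj_on_inv_into]) (use r in \<open>auto simp: path_image_def\<close>)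
  have conn: "Topological_Spaces.connected (h ` (ball z r - {w}))" if "w \<in> ball z r" for w
  proof (rule connected_continuous_image)
    show "continuous_on (ball z r - {w}) h" by (rule continuous_on_subset[OF ch]) (use r in auto)
    show "Topological_Spaces.connected (ball z r - {w})" by (rule connected_open_delete) auto
  qed
  have "infinite (ball z r)" using r finite_imp_not_open[of "ball z r"] by auto
  then obtain A where A: "A \<subseteq> ball z r" "card A = 3" "finite A" using infinite_arbitrarily_large by blast
  then have cA: "card (h ` A) = 3" using card_image[OF inj_on_subset[OF injh A(1)]] by simp
  then obtain x y w where xyw: "h ` A = {x, y, w}" "x \<noteq> y" "y \<noteq> w" "x \<noteq> w" by (metis card_3_iff)
  obtain a b c where abc: "a \<in> h ` A" "b \<in> h ` A" "c \<in> h ` A" "a < b" "b < c"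
  proof -
    have m: "x \<in> h ` A" "y \<in> h ` A" "w \<in> h ` A" using xyw(1) by auto
    have "x < y \<and> y < w \<or> x < w \<and> w < y \<or> y < x \<and> x < w \<or> y < w \<and> w < x \<or> w < x \<and> x < y \<or> w < y \<and> y < x"
      using xyw(2-4) by linarith
    then show ?thesis
      using that[OF m(1) m(2) m(3)] that[OF m(1) m(3) m(2)] that[OF m(2) m(1) m(3)]
        that[OF m(2) m(3) m(1)] that[OF m(3) m(1) m(2)] that[OF m(3) m(2) m(1)] by metis
  qed
  obtain b' where b': "b' \<in> ball z r" "h b' = b" using abc(2) A(1) by auto
  let ?S = "h ` (ball z r - {b'})"
  have "a \<in> ?S" "c \<in> ?S" using abc A(1) b' by auto
  then have "b \<in> ?S" using conn[OF b'(1)] abc(4,5) unfolding is_interval_connected_1[symmetric] is_interval_1 by (meson less_imp_le)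
  then show False using injh b' by (auto simp: inj_on_def)
qed

text \<open>Each undirected edge has a single point set \<open>I e\<close>, and a parametrisation in
  either direction exists on demand. Restricting the graph and applying an injective map of the
  plane then act directly on \<open>p\<close> and \<open>I\<close>.\<close>

locale drawing =
  fixes V :: "'a set" and E :: "'a set set" and p :: "'a \<Rightarrow> complex" and I :: "'a set \<Rightarrow> complex set"
  assumes finite_V: "finite V"
    and inj_p: "inj_on p V"
    and edge_ends: "e \<in> E \<Longrightarrow> \<exists>a b. e = {a, b} \<and> a \<noteq> b \<and> a \<in> V \<and> b \<in> V"
    and edge_arc: "{a, b} \<in> E \<Longrightarrow> \<exists>g. arc g \<and> pathstart g = p a \<and> pathfinish g = p b \<and> path_image g = I {a, b}"
    and edge_vertices: "e \<in> E \<Longrightarrow> I e \<inter> p ` V = p ` e"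
    and edges_cross: "e \<in> E \<Longrightarrow> f \<in> E \<Longrightarrow> e \<noteq> f \<Longrightarrow> I e \<inter> I f = p ` (e \<inter> f)"
begin

definition "drawn F = \<Union>(I ` F)"
definition "open_edge e = I e - p ` e"

lemma edge_V: "e \<in> E \<Longrightarrow> e \<subseteq> V"
  using edge_ends by blast

lemma edge_obtain:
  assumes "e \<in> E"
  obtains a b g where "e = {a, b}" "a \<noteq> b" "a \<in> V" "b \<in> V" "arc g" "pathstart g = p a" "pathfinish g = p b" "path_image g = I e"
  using edge_ends[OF assms] edge_arc assms by metis

lemma p_in_I: "e \<in> E \<Longrightarrow> a \<in> e \<Longrightarrow> p a \<in> I e"
  using edge_vertices by blast

lemma p_in_I_iff: "e \<in> E \<Longrightarrow> a \<in> V \<Longrightarrow> p a \<in> I e \<longleftrightarrow> a \<in> e"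
  using edge_vertices[of e] edge_V[of e] inj_p p_in_I by (auto dest: inj_onD)

lemma p_in_drawn_iff: "F \<subseteq> E \<Longrightarrow> a \<in> V \<Longrightarrow> p a \<in> drawn F \<longleftrightarrow> a \<in> \<Union>F"
  unfolding drawn_def using p_in_I_iff by blast

lemma open_edge_props:
  assumes "e \<in> E"
  shows "Topological_Spaces.connected (open_edge e)" "open_edge e \<noteq> {}" "a \<in> e \<Longrightarrow> p a \<in> closure (open_edge e)"
proof -
  obtain a' b g where e: "e = {a', b}" "a' \<noteq> b" "arc g" "pathstart g = p a'" "pathfinish g = p b" "path_image g = I e"
    using edge_obtain[OF assms] by metis
  have sp: "simple_path g" using e(3) by (rule arc_imp_simple_path)
  have open_edge: "open_edge e = path_image g - {pathstart g, pathfinish g}" using e by (auto simp: open_edge_def)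
  show "Topological_Spaces.connected (open_edge e)" unfolding open_edge by (rule connected_simple_path_endless[OF sp])
  show "open_edge e \<noteq> {}" unfolding open_edge by (rule nonempty_simple_path_endless[OF sp])
  show "p a \<in> closure (open_edge e)" if "a \<in> e"
  proof -
    have "p a \<in> I e" using p_in_I assms that by blast
    moreover have "Topological_Spaces.connected (I e)" using e(3,6) connected_arc_image by metis
    moreover have "I e \<noteq> {x}" for x
      using e(4,5,6) arc_distinct_ends[OF e(3)] pathstart_in_path_image[of g] pathfinish_in_path_image[of g] by auto
    \<comment> \<open>A connected set with more than one point has no isolated points; removing the
      two ends does not change limit points.\<close>
    ultimately have "p a islimpt (I e)" by (intro connected_imp_perfect)
    moreover have "I e = p ` e \<union> open_edge e" using p_in_I[OF assms] by (auto simp: open_edge_def)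
    moreover have "finite (p ` e)" using e by simp
    ultimately have "p a islimpt open_edge e" by (metis islimpt_Un_finite)
    then show ?thesis by (simp add: closure_def)
  qed
qed

lemma open_edge_drawn:
  assumes "F \<subseteq> E" "e \<in> E - F" shows "open_edge e \<inter> drawn F = {}"
proof -
  have "I e \<inter> I f \<subseteq> p ` e" if "f \<in> F" for f
    using edges_cross[of e f] assms that by auto
  then show ?thesis unfolding open_edge_def drawn_def by blast
qed

lemma path_arc:
  assumes "ispath E x y P"
  shows "\<exists>g. arc g \<and> pathstart g = p x \<and> pathfinish g = p y \<and> path_image g = drawn (pedges P)"
  using assms
proof (induction P arbitrary: x rule: pedges.induct)
  case (1 a b xs)
  have ax: "a = x" and e: "{a, b} \<in> E" using "1.prems" by (auto simp: ispath_def)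
  obtain g1 where g1: "arc g1" "pathstart g1 = p a" "pathfinish g1 = p b" "path_image g1 = I {a, b}"
    using edge_arc[OF e] by blast
  show ?case
  proof (cases "xs = []")
    case True
    then have "b = y" using "1.prems" by (auto simp: ispath_def)
    then show ?thesis using g1 True ax by (auto simp: drawn_def)
  next
    case False
    have by_ne: "b \<noteq> y" using "1.prems" False by (auto simp: ispath_def)
    then have ip: "ispath E b y (b # xs)" using "1.prems" by (auto simp: ispath_def)
    obtain g2 where g2: "arc g2" "pathstart g2 = p b" "pathfinish g2 = p y" "path_image g2 = drawn (pedges (b # xs))"
      using "1.IH"[OF ip] by blast
    have "path_image g1 \<inter> path_image g2 \<subseteq> {p b}"
    proof
      fix z assume z: "z \<in> path_image g1 \<inter> path_image g2"
      then obtain f where f: "f \<in> pedges (b # xs)" "z \<in> I f" unfolding g2(4) drawn_def by blast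
      have fs: "f \<subseteq> set (b # xs)" using pedges_subset[OF f(1)] .
      have an: "a \<notin> set (b # xs)" using "1.prems" by (auto simp: ispath_def)
      have "f \<noteq> {a, b}" using fs an by auto
      moreover have "f \<in> E" using f(1) ip by (auto simp: ispath_def)
      ultimately have "I {a, b} \<inter> I f = p ` ({a, b} \<inter> f)" using edges_cross[OF e] by auto
      then have "z \<in> p ` ({a, b} \<inter> f)" using z f(2) g1(4) by blast
      then show "z \<in> {p b}" using fs an by auto
    qed
    then have "arc (g1 +++ g2)" using g1 g2 by (intro arc_join) auto
    moreover have "path_image (g1 +++ g2) = drawn (pedges (a # b # xs))"
      using g1 g2 by (simp add: path_image_join drawn_def)
    ultimately show ?thesis using g1 g2 ax by (intro exI[of _ "g1 +++ g2"]) auto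
  qed
qed (auto simp: ispath_def)

lemma paths_meet:
  assumes "ispath E x y P" "ispath E x y Q" "set P \<inter> set Q = {x, y}" "pedges P \<inter> pedges Q = {}"
  shows "drawn (pedges P) \<inter> drawn (pedges Q) = {p x, p y}"
proof
  show "drawn (pedges P) \<inter> drawn (pedges Q) \<subseteq> {p x, p y}"
  proof
    fix z assume "z \<in> drawn (pedges P) \<inter> drawn (pedges Q)"
    then obtain e f where ef: "e \<in> pedges P" "f \<in> pedges Q" "z \<in> I e" "z \<in> I f" unfolding drawn_def by blast
    then have "e \<in> E" "f \<in> E" "e \<noteq> f" using assms by (auto simp: ispath_def)
    then have "z \<in> p ` (e \<inter> f)" using edges_cross ef by blast
    moreover have "e \<inter> f \<subseteq> {x, y}" using pedges_subset[OF ef(1)] pedges_subset[OF ef(2)] assms(3) by blast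
    ultimately show "z \<in> {p x, p y}" by blast
  qed
  have *: "p x \<in> drawn (pedges S) \<and> p y \<in> drawn (pedges S)" if S: "ispath E x y S" for S
    using path_arc[OF S] pathstart_in_path_image pathfinish_in_path_image by metis
  show "{p x, p y} \<subseteq> drawn (pedges P) \<inter> drawn (pedges Q)" using *[OF assms(1)] *[OF assms(2)] by blast
qed

lemma drawn_Un: "drawn (F \<union> G) = drawn F \<union> drawn G" by (auto simp: drawn_def)

lemma ispath_edge:
  assumes "ispath E x y P" "{x, y} \<in> pedges P" shows "P = [x, y]"
proof -
  obtain ps where P: "P = x # ps @ [y]" using ispath_decompose[OF assms(1)] by blast
  show ?thesis
  proof (cases ps)
    case (Cons z zs)
    have d: "x \<notin> set (z # zs @ [y])" "z \<noteq> y" using assms(1) P Cons by (auto simp: ispath_def)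
    have "pedges P = insert {x, z} (pedges (z # zs @ [y]))" using P Cons by simp
    with assms(2) have "{x, y} = {x, z} \<or> {x, y} \<in> pedges (z # zs @ [y])" by (simp del: pedges.simps)
    then show ?thesis
    proof
      assume "{x, y} = {x, z}"
      then have "y = z" by (metis doubleton_eq_iff)
      with d(2) show ?thesis by simp
    next
      assume "{x, y} \<in> pedges (z # zs @ [y])"
      from pedges_subset[OF this] d(1) show ?thesis by (simp del: pedges.simps)
    qed
  qed (use P in simp)
qed

text \<open>A common edge must be {x, y}; then both paths consist of it alone, and the cycle would
  have only two vertices.\<close>

lemma cyc_paths_disjoint:
  assumes "cyc E C" "ispath E x y P" "ispath E x y Q" "C = pedges P \<union> pedges Q" "set P \<inter> set Q = {x, y}"
  shows "pedges P \<inter> pedges Q = {}"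
proof (rule ccontr)
  assume "\<not> ?thesis"
  then obtain e where e: "e \<in> pedges P" "e \<in> pedges Q" by blast
  then have "e \<subseteq> {x, y}" using pedges_subset assms(5) by blast
  moreover have "e \<in> E" using e assms(2) by (auto simp: ispath_def)
  ultimately have "e = {x, y}" using edge_ends by blast
  then have "P = [x, y]" "Q = [x, y]"
    using ispath_edge[OF assms(2)] ispath_edge[OF assms(3)] e by simp_all
  then have "C = {{x, y}}" using assms(4) by simp
  then have "card (\<Union>C) \<le> 2" by (simp add: card_insert_if)
  then show False using cyc_card[OF assms(1)] by simp
qed

lemma cyc_curve:
  assumes "cyc E C"
  shows "\<exists>g. simple_path g \<and> pathfinish g = pathstart g \<and> path_image g = drawn C"
proof -
  have c3: "3 \<le> card (\<Union>C)" using cyc_card assms by blast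
  then have "\<Union>C \<noteq> {}" by (intro notI) simp
  then obtain x where x: "x \<in> \<Union>C" by (metis ex_in_conv)
  have "\<Union>C \<noteq> {x}" using c3 by (intro notI) simp
  then obtain y where y: "y \<in> \<Union>C" "x \<noteq> y" using x by (metis insertI1 singletonI subset_singletonD subsetI empty_iff)
  obtain P Q where PQ: "ispath E x y P" "ispath E x y Q" "C = pedges P \<union> pedges Q" "set P \<inter> set Q = {x, y}"
    using cyc_split[OF assms x y] by blast
  have disj: "pedges P \<inter> pedges Q = {}" using cyc_paths_disjoint assms PQ by blast
  obtain g where g: "arc g" "pathstart g = p x" "pathfinish g = p y" "path_image g = drawn (pedges P)" using path_arc[OF PQ(1)] by blast
  obtain h where h: "arc h" "pathstart h = p x" "pathfinish h = p y" "path_image h = drawn (pedges Q)" using path_arc[OF PQ(2)] by blast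
  have "path_image g \<inter> path_image h = {p x, p y}" using paths_meet[OF PQ(1,2,4) disj] g h by simp
  then have "simple_path (g +++ reversepath h)"
    using g h by (intro simple_path_join_loop) (auto simp: arc_reversepath)
  then show ?thesis using g h PQ(3) by (intro exI[of _ "g +++ reversepath h"]) (auto simp: path_image_join drawn_Un)
qed

lemma cyc_Jordan:
  assumes "cyc E C"
  shows "inside (drawn C) \<noteq> {}" "open (inside (drawn C))" "Topological_Spaces.connected (inside (drawn C))"
    "open (outside (drawn C))" "Topological_Spaces.connected (outside (drawn C))" "bounded (inside (drawn C))" "\<not> bounded (outside (drawn C))"
    "inside (drawn C) \<inter> outside (drawn C) = {}" "inside (drawn C) \<union> outside (drawn C) = - drawn C"
    "frontier (inside (drawn C)) = drawn C" "compact (drawn C)"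
proof -
  obtain g where g: "simple_path g" "pathfinish g = pathstart g" "path_image g = drawn C" using cyc_curve[OF assms] by blast
  show "inside (drawn C) \<noteq> {}" "open (inside (drawn C))" "Topological_Spaces.connected (inside (drawn C))"
    "open (outside (drawn C))" "Topological_Spaces.connected (outside (drawn C))" "bounded (inside (drawn C))" "\<not> bounded (outside (drawn C))"
    "inside (drawn C) \<inter> outside (drawn C) = {}" "inside (drawn C) \<union> outside (drawn C) = - drawn C"
    "frontier (inside (drawn C)) = drawn C"
    using Jordan_inside_outside[OF g(1,2)] unfolding g(3) by blast+
  show "compact (drawn C)" using compact_simple_path_image[OF g(1)] g(3) by simp
qed

section \<open>The inside of a cycle and its division by a chord path\<close>

definition "Ein C = {e \<in> E - C. open_edge e \<subseteq> inside (drawn C)}"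
definition "Vin C = {v \<in> V. p v \<in> inside (drawn C)}"

lemma open_edge_dichotomy:
  assumes C: "cyc E C" and e: "e \<in> E - C"
  shows "open_edge e \<subseteq> inside (drawn C) \<or> open_edge e \<subseteq> outside (drawn C)"
proof -
  note J = cyc_Jordan[OF C]
  have sub: "open_edge e \<subseteq> inside (drawn C) \<union> outside (drawn C)"
    using open_edge_drawn[OF cyc_subset[OF C] e] J(9) by blast
  have "inside (drawn C) \<inter> open_edge e = {} \<or> outside (drawn C) \<inter> open_edge e = {}"
    using connectedD[OF open_edge_props(1)[of e] J(2) J(4)] e sub J(8) by blast
  then show ?thesis using sub by blast
qed

lemma Ein_ends:
  assumes C: "cyc E C" and e: "e \<in> Ein C"
  shows "e \<subseteq> \<Union>C \<union> Vin C"
proof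
  fix a assume a: "a \<in> e"
  have eE: "e \<in> E" and sub: "open_edge e \<subseteq> inside (drawn C)" using e by (auto simp: Ein_def)
  have aV: "a \<in> V" using edge_V[OF eE] a by blast
  have "p a \<in> closure (inside (drawn C))" using open_edge_props(3)[OF eE a] closure_mono[OF sub] by blast
  then have "p a \<in> inside (drawn C) \<or> p a \<in> drawn C"
    using cyc_Jordan(10)[OF C] closure_Un_frontier[of "inside (drawn C)"] by blast
  then show "a \<in> \<Union>C \<union> Vin C"
    using p_in_drawn_iff[OF cyc_subset[OF C] aV] aV by (auto simp: Vin_def)
qed

lemma Vin_disjoint: "cyc E C \<Longrightarrow> Vin C \<inter> \<Union>C = {}"
  using p_in_drawn_iff[of C] cyc_subset[of E C] inside_no_overlap[of "drawn C"] unfolding Vin_def by blast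

lemma Vin_edges:
  assumes C: "cyc E C" and e: "e \<in> E" "e \<inter> Vin C \<noteq> {}"
  shows "e \<in> Ein C"
proof -
  obtain a where a: "a \<in> e" "a \<in> Vin C" using e by blast
  have "e \<notin> C" using Vin_disjoint[OF C] a by blast
  moreover have "\<not> open_edge e \<subseteq> outside (drawn C)"
  proof
    assume "open_edge e \<subseteq> outside (drawn C)"
    then have "p a \<in> closure (outside (drawn C))" using open_edge_props(3)[OF e(1) a(1)] closure_mono by blast
    moreover have "inside (drawn C) \<inter> closure (outside (drawn C)) = {}"
      using open_Int_closure_eq_empty[OF cyc_Jordan(2)[OF C]] cyc_Jordan(8)[OF C] by blast
    ultimately show False using a(2) by (auto simp: Vin_def)
  qed
  ultimately show ?thesis using open_edge_dichotomy[OF C, of e] e by (auto simp: Ein_def)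
qed

text \<open>The chord path divides the inside of \<open>C\<close> into the insides of two cycles
  that both contain \<open>R\<close>. The \<open>length R - 1\<close> edges and
  \<open>length R - 2\<close> inner vertices of \<open>R\<close> leave the inside and appear on both
  new cycles.\<close>

lemma theta_split:
  assumes C: "cyc E C" and R: "ispath (Ein C) x y R" "set R \<inter> \<Union>C = {x, y}"
  shows "\<exists>C1 C2. cyc E C1 \<and> cyc E C2 \<and>
     card (\<Union>C1) + card (\<Union>C2) = card (\<Union>C) + 2 * (length R - 1) \<and>
     card (Ein C) \<le> card (Ein C1) + card (Ein C2) + (length R - 1) \<and>
     card (Vin C1) + card (Vin C2) + (length R - 2) \<le> card (Vin C) \<and>
     Ein C1 \<subset> Ein C \<and> Ein C2 \<subset> Ein C"
proof -
  have R': "ispath E x y R" "pedges R \<subseteq> Ein C" using R(1) by (auto simp: ispath_def Ein_def)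
  have xy: "x \<in> \<Union>C" "y \<in> \<Union>C" "x \<noteq> y" using R by (auto simp: ispath_def)
  obtain P Q where PQ: "ispath E x y P" "ispath E x y Q" "C = pedges P \<union> pedges Q" "set P \<inter> set Q = {x, y}" "set P \<union> set Q = \<Union>C"
    using cyc_split[OF C xy] by blast
  have disj: "pedges P \<inter> pedges Q = {}" "pedges P \<inter> pedges R = {}" "pedges Q \<inter> pedges R = {}"
    using cyc_paths_disjoint[OF C PQ(1-4)] R'(2) PQ(3) by (auto simp: Ein_def)
  have ends: "x \<in> set S" "y \<in> set S" if "ispath E x y S" for S
    using ispath_decompose[OF that] by auto
  have meet: "set P \<inter> set R = {x, y}" "set Q \<inter> set R = {x, y}"
    using R(2) PQ(5) ends[OF PQ(1)] ends[OF PQ(2)] ends[OF R'(1)] by blast+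
  have len: "3 \<le> length S \<or> 3 \<le> length R" if hS: "ispath E x y S" "pedges S \<inter> pedges R = {}" for S
  proof (rule ccontr)
    assume "\<not> ?thesis"
    then have short: "\<not> 3 \<le> length S" "\<not> 3 \<le> length R" by auto
    obtain ps qs where "S = x # ps @ [y]" "R = x # qs @ [y]"
      using ispath_decompose[OF hS(1)] ispath_decompose[OF R'(1)] by blast
    with short have "S = [x, y]" "R = [x, y]" by (cases ps; cases qs; simp)+
    then show False using hS(2) by simp
  qed
  define C1 where "C1 = pedges P \<union> pedges R"
  define C2 where "C2 = pedges Q \<union> pedges R"
  have c1: "cyc E C1" unfolding C1_def by (rule cyc_join[OF PQ(1) R'(1) meet(1) len[OF PQ(1) disj(2)]])
  have c2: "cyc E C2" unfolding C2_def by (rule cyc_join[OF PQ(2) R'(1) meet(2) len[OF PQ(2) disj(3)]])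
  obtain gP where gP: "arc gP" "pathstart gP = p x" "pathfinish gP = p y" "path_image gP = drawn (pedges P)" using path_arc[OF PQ(1)] by blast
  obtain gQ where gQ: "arc gQ" "pathstart gQ = p x" "pathfinish gQ = p y" "path_image gQ = drawn (pedges Q)" using path_arc[OF PQ(2)] by blast
  obtain gR where gR: "arc gR" "pathstart gR = p x" "pathfinish gR = p y" "path_image gR = drawn (pedges R)" using path_arc[OF R'(1)] by blast
  have "pedges R \<noteq> {}" using ispath_length[OF R'(1)] by (cases R rule: pedges.cases) auto
  then obtain e0 where e0: "e0 \<in> pedges R" by blast
  have e0E: "e0 \<in> Ein C" using e0 R'(2) by blast
  then have ne: "drawn (pedges R) \<inter> inside (drawn C) \<noteq> {}"
    using open_edge_props(2)[of e0] e0 unfolding Ein_def drawn_def open_edge_def by blast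
  have "p x \<noteq> p y" using gP arc_distinct_ends by metis
  have in_split: "inside (drawn C1) \<inter> inside (drawn C2) = {} \<and>
     inside (drawn C1) \<union> inside (drawn C2) \<union> (drawn (pedges R) - {p x, p y}) = inside (drawn C)"
  proof (rule split_inside_simple_closed_curve[of gP "p x" "p y" gQ gR])
    show "path_image gP \<inter> path_image gQ = {p x, p y}" using paths_meet[OF PQ(1,2,4) disj(1)] gP gQ by simp
    show "path_image gP \<inter> path_image gR = {p x, p y}" using paths_meet[OF PQ(1) R'(1) meet(1) disj(2)] gP gR by simp
    show "path_image gQ \<inter> path_image gR = {p x, p y}" using paths_meet[OF PQ(2) R'(1) meet(2) disj(3)] gQ gR by simp
    show "path_image gR \<inter> inside (path_image gP \<union> path_image gQ) \<noteq> {}"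
      using ne gP gQ gR PQ(3) by (simp add: drawn_Un)
  qed (use gP gQ gR \<open>p x \<noteq> p y\<close> in \<open>auto simp: arc_imp_simple_path C1_def C2_def drawn_Un PQ(3)\<close>)
  have U1: "\<Union>C1 = set P \<union> set R" and U2: "\<Union>C2 = set Q \<union> set R"
    unfolding C1_def C2_def using Union_pedges ispath_length PQ(1,2) R'(1) by (metis Union_Un_distrib)+
  have lens: "card (set S) = length S" if "ispath E x y S" for S
    using that by (auto simp: ispath_def distinct_card)
  have two: "card {x, y} = 2" using xy by simp
  have cards: "card (\<Union>C) + 2 = length P + length Q" "card (\<Union>C1) + 2 = length P + length R" "card (\<Union>C2) + 2 = length Q + length R"
    using card_Un_Int[of "set P" "set Q"] card_Un_Int[of "set P" "set R"] card_Un_Int[of "set Q" "set R"]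
    by (simp_all add: U1 U2 PQ(5)[symmetric] PQ(4) meet lens[OF PQ(1)] lens[OF PQ(2)] lens[OF R'(1)] two)
  have fE: "finite E" by (rule finite_subset[of _ "Pow V"]) (use edge_V finite_V in auto)
  have fEin: "finite (Ein D)" for D using fE by (simp add: Ein_def)
  have sub1: "Ein D \<subseteq> Ein C" if D: "D = C1 \<or> D = C2" for D
  proof
    fix e assume e: "e \<in> Ein D"
    then have eE: "e \<in> E" "open_edge e \<subseteq> inside (drawn D)" by (auto simp: Ein_def)
    then have s: "open_edge e \<subseteq> inside (drawn C)" using D in_split by blast
    have "e \<notin> C"
    proof
      assume "e \<in> C"
      then have "open_edge e \<subseteq> drawn C" by (auto simp: drawn_def open_edge_def)
      then show False using s open_edge_props(2)[OF eE(1)] inside_no_overlap[of "drawn C"] by blast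
    qed
    then show "e \<in> Ein C" using eE s by (simp add: Ein_def)
  qed
  \<comment> \<open>An edge of \<open>R\<close> is inside \<open>C\<close> but on both smaller
    cycles. This makes the inclusions strict, as the induction over inside edges requires.\<close>
  have e0n: "e0 \<notin> Ein C1" "e0 \<notin> Ein C2" using e0 by (auto simp: Ein_def C1_def C2_def)
  have Ein_sub: "Ein C \<subseteq> (Ein C1 \<union> Ein C2) \<union> pedges R"
  proof
    fix e assume e: "e \<in> Ein C"
    show "e \<in> (Ein C1 \<union> Ein C2) \<union> pedges R"
    proof (cases "e \<in> pedges R")
      case False
      have eE: "e \<in> E - C1" "e \<in> E - C2" "open_edge e \<subseteq> inside (drawn C)"
        using e False PQ(3) by (auto simp: Ein_def C1_def C2_def)
      have "open_edge e \<inter> drawn (pedges R) = {}" using open_edge_drawn[of "pedges R" e] e False R'(2) by (auto simp: Ein_def)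
      then have "open_edge e \<subseteq> inside (drawn C1) \<union> inside (drawn C2)" using eE(3) in_split by blast
      moreover obtain z where "z \<in> open_edge e" using open_edge_props(2) eE by blast
      ultimately have "open_edge e \<inter> inside (drawn C1) \<noteq> {} \<or> open_edge e \<inter> inside (drawn C2) \<noteq> {}" by blast
      then have "open_edge e \<subseteq> inside (drawn C1) \<or> open_edge e \<subseteq> inside (drawn C2)"
        using open_edge_dichotomy[OF c1 eE(1)] open_edge_dichotomy[OF c2 eE(2)] cyc_Jordan(8)[OF c1] cyc_Jordan(8)[OF c2] by blast
      then show ?thesis using eE by (auto simp: Ein_def)
    qed simp
  qed
  have "card (Ein C) \<le> card ((Ein C1 \<union> Ein C2) \<union> pedges R)"
    by (rule card_mono[OF _ Ein_sub]) (use fEin finite_pedges in auto)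
  also have "\<dots> \<le> card (Ein C1 \<union> Ein C2) + card (pedges R)" by (rule card_Un_le)
  also have "card (Ein C1 \<union> Ein C2) \<le> card (Ein C1) + card (Ein C2)" by (rule card_Un_le)
  also have "card (pedges R) \<le> length R - 1" by (rule card_pedges_le)
  finally have i: "card (Ein C) \<le> card (Ein C1) + card (Ein C2) + (length R - 1)" by simp
  have fin_Vin: "finite (Vin D)" for D using finite_V by (simp add: Vin_def)
  have RV: "set R \<subseteq> V"
    using edge_V R'(1) Union_pedges[OF ispath_length[OF R'(1)]] unfolding ispath_def by blast
  have RIn: "set R - {x, y} \<subseteq> Vin C"
  proof
    fix v assume v: "v \<in> set R - {x, y}"
    then obtain e where "e \<in> pedges R" "v \<in> e" using Union_pedges[OF ispath_length[OF R'(1)]] by blast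
    then have "v \<in> \<Union>C \<union> Vin C" using Ein_ends[OF C] R'(2) by blast
    then show "v \<in> Vin C" using v R(2) by blast
  qed
  have Rn: "(set R - {x, y}) \<inter> Vin D = {}" if "D = C1 \<or> D = C2" for D
    using Vin_disjoint[OF c1] Vin_disjoint[OF c2] U1 U2 that by blast
  have "Vin C1 \<inter> Vin C2 = {}" using in_split by (auto simp: Vin_def)
  then have "card (Vin C1 \<union> Vin C2 \<union> (set R - {x, y})) = card (Vin C1) + card (Vin C2) + card (set R - {x, y})"
    using Rn fin_Vin by (subst card_Un_disjoint, auto, subst card_Un_disjoint, auto)
  moreover have "card (Vin C1 \<union> Vin C2 \<union> (set R - {x, y})) \<le> card (Vin C)"
    using RIn in_split fin_Vin by (intro card_mono) (auto simp: Vin_def)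
  moreover have "card (set R - {x, y}) = length R - 2"
    using ends[OF R'(1)] lens[OF R'(1)] two by (subst card_Diff_subset) auto
  ultimately have v: "card (Vin C1) + card (Vin C2) + (length R - 2) \<le> card (Vin C)" by simp
  have "card (\<Union>C1) + card (\<Union>C2) = card (\<Union>C) + 2 * (length R - 1)"
    using cards ispath_length[OF R'(1)] by linarith
  moreover have "Ein C1 \<subset> Ein C" "Ein C2 \<subset> Ein C"
    using sub1[of C1] sub1[of C2] e0n e0E by blast+
  ultimately show ?thesis using c1 c2 i v by (intro exI[of _ C1] exI[of _ C2] conjI)
qed

end

subsection \<open>The edge bound for triangle-free plane drawings\<close>

lemma (in drawing) invert:
  assumes "\<And>e. e \<in> E \<Longrightarrow> a \<notin> I e" "a \<notin> p ` V"
  shows "drawing V E (\<lambda>v. 1 / (p v - a)) (\<lambda>e. (\<lambda>z. 1 / (z - a)) ` I e)"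
proof -
  let ?f = "\<lambda>z. 1 / (z - a)"
  have inj: "inj_on ?f (- {a})" by (auto simp: inj_on_def)
  have subI: "I e \<subseteq> - {a}" if "e \<in> E" for e using assms(1)[OF that] by auto
  have subp: "p ` V \<subseteq> - {a}" using assms(2) by auto
  have img: "?f ` (A \<inter> B) = ?f ` A \<inter> ?f ` B" if "A \<subseteq> - {a}" "B \<subseteq> - {a}" for A B
    using inj_on_image_Int[OF inj that] .
  show ?thesis
  proof
    show "finite V" by (rule finite_V)
    show "inj_on (\<lambda>v. 1 / (p v - a)) V"
      using comp_inj_on[OF inj_p inj_on_subset[OF inj subp]] by (simp add: o_def)
    show "\<exists>a b. e = {a, b} \<and> a \<noteq> b \<and> a \<in> V \<and> b \<in> V" if "e \<in> E" for e by (rule edge_ends[OF that])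
    show "\<exists>g. arc g \<and> pathstart g = 1 / (p x - a) \<and> pathfinish g = 1 / (p y - a) \<and> path_image g = ?f ` I {x, y}"
      if xy: "{x, y} \<in> E" for x y
    proof -
      obtain g where g: "arc g" "pathstart g = p x" "pathfinish g = p y" "path_image g = I {x, y}"
        using edge_arc[OF xy] by blast
      have "path (?f \<circ> g)"
        using g assms(1)[OF xy] by (intro path_continuous_image continuous_intros) (auto simp: arc_imp_path)
      moreover have "inj_on (?f \<circ> g) {0..1}"
        using g subI[OF xy] by (intro comp_inj_on inj_on_subset[OF inj]) (auto simp: arc_def path_image_def)
      ultimately have "arc (?f \<circ> g)" by (simp add: arc_def)
      then show ?thesis using g
        by (intro exI[of _ "?f \<circ> g"]) (auto simp: pathstart_compose pathfinish_compose path_image_compose)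
    qed
    show "?f ` I e \<inter> (\<lambda>v. 1 / (p v - a)) ` V = (\<lambda>v. 1 / (p v - a)) ` e" if e: "e \<in> E" for e
    proof -
      have "?f ` I e \<inter> ?f ` (p ` V) = ?f ` (p ` e)"
        using img[OF subI[OF e] subp] edge_vertices[OF e] by simp
      then show ?thesis by (simp add: image_image)
    qed
    show "?f ` I e \<inter> ?f ` I g = (\<lambda>v. 1 / (p v - a)) ` (e \<inter> g)" if e: "e \<in> E" "g \<in> E" "e \<noteq> g" for e g
    proof -
      have "?f ` I e \<inter> ?f ` I g = ?f ` (p ` (e \<inter> g))"
        using img[OF subI[OF e(1)] subI[OF e(2)]] edges_cross[OF e] by simp
      then show ?thesis by (simp add: image_image)
    qed
  qed
qed

text \<open>The point at infinity goes to 0, so the outside together with 0 becomes an open,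
  connected, bounded set \<open>D\<close>, and the inside without \<open>a\<close> an open set
  \<open>B\<close>. They partition the complement of the new curve; boundedness puts
  \<open>D\<close> inside, and connectedness of the new inside excludes \<open>B\<close>.\<close>

lemma inside_inversion:
  fixes S :: "complex set" and a :: complex
  defines "f \<equiv> \<lambda>z. 1 / (z - a)"
  assumes a: "a \<in> inside S" and S: "open (inside S)" "open (outside S)" "Topological_Spaces.connected (outside S)"
      "inside S \<inter> outside S = {}" "inside S \<union> outside S = - S" "bounded (inside S)" "bounded S"
    and S': "Topological_Spaces.connected (inside (f ` S))" "open (inside (f ` S))"
  shows "f ` outside S \<subseteq> inside (f ` S)"
    and "inside (f ` S) \<subseteq> f ` outside S \<union> {0}"
proof -
  define D where "D = f ` outside S \<union> {0}"
  define B where "B = f ` (inside S - {a})"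
  have aS: "a \<notin> S" "a \<notin> outside S" using a S(4) inside_no_overlap[of S] by blast+
  have inv: "f (a + 1 / w) = w" if "w \<noteq> 0" for w using that by (simp add: f_def)
  have inv': "a + 1 / f z = z" if "z \<noteq> a" for z using that by (simp add: f_def)
  have fnz: "f z \<noteq> 0" if "z \<noteq> a" for z using that by (simp add: f_def)
  have cont: "continuous_on (- {0}) (\<lambda>w. a + 1 / w)" by (intro continuous_intros) auto
  have image: "f ` X = (- {0}) \<inter> (\<lambda>w. a + 1 / w) -` X" if "a \<notin> X" for X
  proof
    show "f ` X \<subseteq> (- {0}) \<inter> (\<lambda>w. a + 1 / w) -` X"
      using that inv' fnz by force
    show "(- {0}) \<inter> (\<lambda>w. a + 1 / w) -` X \<subseteq> f ` X"
    proof
      fix w assume "w \<in> (- {0}) \<inter> (\<lambda>w. a + 1 / w) -` X"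
      then have "w = f (a + 1 / w)" "a + 1 / w \<in> X" using inv by auto
      then show "w \<in> f ` X" by blast
    qed
  qed
  have op: "open (f ` X)" if "a \<notin> X" "open X" for X
    unfolding image[OF that(1)] using continuous_open_preimage[OF cont _ that(2)] by auto
  have oB: "open B" unfolding B_def using S(1) by (intro op) auto
  obtain r where r: "r > 0" "inside S \<union> S \<subseteq> ball a r"
  proof -
    have "bounded (inside S \<union> S)" using S by simp
    from bounded_subset_ballD[OF this] show ?thesis using that by blast
  qed
  \<comment> \<open>A point within 1/r of 0, other than 0, comes from outside a disc about
    \<open>a\<close> that contains the curve and its inside.\<close>
  have near0: "ball 0 (1 / r) \<subseteq> D"
  proof
    fix w :: complex assume w: "w \<in> ball 0 (1 / r)"
    show "w \<in> D"
    proof (cases "w = 0")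
      case False
      then have "norm (1 / w) > r" using w r(1) by (simp add: norm_divide field_simps)
      then have "a + 1 / w \<notin> ball a r" by (simp add: dist_norm)
      then have "a + 1 / w \<in> outside S" using r(2) S(5) by blast
      then show ?thesis using inv[OF False] unfolding D_def by (metis UnI1 imageI)
    qed (simp add: D_def)
  qed
  have oD: "open D"
  proof -
    have "D = f ` outside S \<union> ball 0 (1 / r)"
    proof
      have "(0::complex) \<in> ball 0 (1 / r)" using r(1) by simp
      then show "D \<subseteq> f ` outside S \<union> ball 0 (1 / r)" by (auto simp: D_def)
      show "f ` outside S \<union> ball 0 (1 / r) \<subseteq> D" using near0 by (auto simp: D_def)
    qed
    then show ?thesis using op[OF aS(2) S(2)] by (metis open_Un open_ball)
  qed
  have compl: "- (f ` S) = D \<union> B"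
  proof
    show "- (f ` S) \<subseteq> D \<union> B"
    proof
      fix w assume w: "w \<in> - (f ` S)"
      show "w \<in> D \<union> B"
      proof (cases "w = 0")
        case False
        have "a + 1 / w \<notin> S" using w inv[OF False] by (metis ComplD imageI)
        then have "a + 1 / w \<in> inside S \<or> a + 1 / w \<in> outside S" using S(5) by blast
        moreover have "a + 1 / w \<noteq> a" using False by simp
        ultimately have "a + 1 / w \<in> (inside S - {a}) \<union> outside S" by blast
        then show ?thesis using inv[OF False] unfolding D_def B_def by (metis UnE UnI1 UnI2 imageI)
      qed (simp add: D_def)
    qed
    \<comment> \<open>Since 1 / 0 = 0, the map sends \<open>a\<close> to 0, a value taken nowhere
      else, and is injective on the whole plane.\<close>
    have injf: "inj f" by (auto simp: f_def inj_on_def divide_eq_eq)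
    have "0 \<notin> f ` S" using fnz aS(1) by (metis imageE)
    moreover have "f ` outside S \<inter> f ` S = {}" "f ` (inside S - {a}) \<inter> f ` S = {}"
    proof -
      have "outside S \<inter> S = {}" "(inside S - {a}) \<inter> S = {}" using S(5) by blast+
      then show "f ` outside S \<inter> f ` S = {}" "f ` (inside S - {a}) \<inter> f ` S = {}"
        unfolding image_Int[OF injf, symmetric] by simp_all
    qed
    moreover have "(X \<union> {0}) \<union> Y \<subseteq> - C" if "0 \<notin> C" "X \<inter> C = {}" "Y \<inter> C = {}" for X Y C :: "complex set"
      using that by blast
    ultimately show "D \<union> B \<subseteq> - (f ` S)" unfolding D_def B_def by metis
  qed
  have DB: "D \<inter> B = {}"
  proof -
    have injf: "inj f" by (auto simp: f_def inj_on_def divide_eq_eq)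
    have "outside S \<inter> (inside S - {a}) = {}" using S(4) by blast
    then have "f ` outside S \<inter> B = {}" unfolding B_def image_Int[OF injf, symmetric] by simp
    moreover have "0 \<notin> B" unfolding B_def using fnz by (metis Diff_iff imageE singletonI)
    ultimately show ?thesis unfolding D_def by blast
  qed
  have cD: "Topological_Spaces.connected D"
  proof -
    have "Topological_Spaces.connected (f ` outside S)"
    proof (rule connected_continuous_image[OF _ S(3)])
      show "continuous_on (outside S) f" unfolding f_def using aS(2) by (intro continuous_intros) auto
    qed
    moreover have "f ` outside S \<inter> ball 0 (1 / r) \<noteq> {}"
    proof -
      have "norm (of_real (1 / (2 * r)) :: complex) < 1 / r"
        unfolding norm_of_real using r(1) by (simp add: field_simps)
      then have "of_real (1 / (2 * r)) \<in> ball 0 (1 / r) - {0::complex}" using r(1) by simp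
      then show ?thesis using near0 unfolding D_def by blast
    qed
    moreover have "Topological_Spaces.connected (ball (0::complex) (1 / r))" by simp
    ultimately have "Topological_Spaces.connected (f ` outside S \<union> ball 0 (1 / r))" by (intro connected_Un) auto
    moreover have "f ` outside S \<union> ball 0 (1 / r) = D"
      using near0 r(1) by (auto simp: D_def)
    ultimately show ?thesis by simp
  qed
  have bD: "bounded D"
  proof -
    obtain e where e: "e > 0" "ball a e \<subseteq> inside S" using S(1) a openE by blast
    have "norm w \<le> 1 / e" if "w \<in> D" for w
    proof (cases "w = 0")
      case False
      then obtain z where z: "z \<in> outside S" "w = f z" using \<open>w \<in> D\<close> by (auto simp: D_def)
      then have "z \<notin> ball a e" using e(2) S(4) by blast
      then have "norm (z - a) \<ge> e" by (simp add: dist_norm norm_minus_commute)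
      then show ?thesis using z(2) e(1) by (simp add: f_def norm_divide frac_le)
    qed (use e in simp)
    then show ?thesis unfolding bounded_iff by blast
  qed
  have D_in: "D \<subseteq> inside (f ` S)"
  proof
    fix w assume w: "w \<in> D"
    let ?K = "connected_component_set (- f ` S) w"
    have "?K \<subseteq> D"
    proof -
      have "?K \<subseteq> D \<union> B" using compl connected_component_subset by metis
      moreover have "w \<in> ?K" using w compl by (metis UnI1 connected_component_refl mem_Collect_eq)
      ultimately show ?thesis
        using connectedD[OF connected_connected_component oD oB, of "- f ` S" w] w DB by blast
    qed
    then have "bounded ?K" using bD bounded_subset by blast
    then show "w \<in> inside (f ` S)" using w compl by (auto simp: inside_def)
  qed
  show "f ` outside S \<subseteq> inside (f ` S)" using D_in by (auto simp: D_def)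
  have "inside (f ` S) \<subseteq> D \<union> B" using compl inside_no_overlap[of "f ` S"] by blast
  moreover have "0 \<in> D \<inter> inside (f ` S)" using D_in by (auto simp: D_def)
  ultimately have "inside (f ` S) \<subseteq> D"
    using connectedD[OF S'(1) oD oB] DB by blast
  then show "inside (f ` S) \<subseteq> f ` outside S \<union> {0}" by (simp add: D_def)
qed

section \<open>Edge bounds inside a cycle and for the whole graph\<close>

locale triangle_free_drawing = drawing V E p I + two_connected_graph V E
  for V :: "'a set" and E p I +
  assumes no_triangle: "{a, b} \<in> E \<Longrightarrow> {b, c} \<in> E \<Longrightarrow> {c, a} \<notin> E"
begin

lemma cyc_card_ge_4:
  assumes "cyc E C" shows "4 \<le> card (\<Union>C)"
proof (rule ccontr)
  assume c: "\<not> ?thesis"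
  obtain xs where xs: "distinct xs" "3 \<le> length xs" "C = pedges (xs @ [hd xs])" "C \<subseteq> E"
    using assms by (auto simp: cyc_def)
  then have "length xs = 3" using c Union_cycle[OF xs(2)] distinct_card[OF xs(1)] by simp
  then obtain a b d where "xs = [a, b, d]" by (auto simp: length_Suc_conv numeral_3_eq_3)
  then have "{a, b} \<in> E" "{b, d} \<in> E" "{d, a} \<in> E" using xs by auto
  then show False using no_triangle by blast
qed

text \<open>This is the Euler-type count for a region whose faces have at least four sides. In the
  induction, with r the length of \<open>R\<close>, the additional terms 2(r - 1) from the boundary
  and 2(r - 1) from the edges exceed the 4(r - 2) for inner vertices by 4, which is one of the two
  constants 4.\<close>

lemma cycle_bound: "cyc E C \<Longrightarrow> 2 * card (Ein C) + 4 \<le> card (\<Union>C) + 4 * card (Vin C)"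
proof (induction "card (Ein C)" arbitrary: C rule: less_induct)
  case less
  note C = less.prems
  show ?case
  proof (cases "Ein C = {}")
    case True
    then show ?thesis using cyc_card_ge_4[OF C] by simp
  next
    case False
    have S: "\<Union>C \<subseteq> V" using cyc_subset[OF C] edge_V by blast
    have "\<exists>x y R. x \<in> \<Union>C \<and> y \<in> \<Union>C \<and> ispath (Ein C) x y R \<and> set R \<inter> \<Union>C = {x, y} \<and> set R - {x, y} \<subseteq> Vin C"
    proof (rule exists_chord)
      show "\<Union>C \<subseteq> V" by (rule S)
      show "2 \<le> card (\<Union>C)" using cyc_card[OF C] by linarith
      show "Vin C \<subseteq> V" by (auto simp: Vin_def)
      show "Vin C \<inter> \<Union>C = {}" by (rule Vin_disjoint[OF C])
      show "Ein C \<subseteq> E" by (auto simp: Ein_def)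
      show "Ein C \<noteq> {}" by (rule False)
      show "e \<subseteq> \<Union>C \<union> Vin C" if "e \<in> Ein C" for e by (rule Ein_ends[OF C that])
      show "e \<in> Ein C" if "e \<in> E" "e \<inter> Vin C \<noteq> {}" for e by (rule Vin_edges[OF C that])
    qed
    then obtain x y R where R: "ispath (Ein C) x y R" "set R \<inter> \<Union>C = {x, y}" by blast
    obtain C1 C2 where sp: "cyc E C1" "cyc E C2"
      "card (\<Union>C1) + card (\<Union>C2) = card (\<Union>C) + 2 * (length R - 1)"
      "card (Ein C) \<le> card (Ein C1) + card (Ein C2) + (length R - 1)"
      "card (Vin C1) + card (Vin C2) + (length R - 2) \<le> card (Vin C)"
      "Ein C1 \<subset> Ein C" "Ein C2 \<subset> Ein C"
      using theta_split[OF C R] by blast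
    have "finite (Ein C)" using finE by (simp add: Ein_def)
    then have "card (Ein C1) < card (Ein C)" "card (Ein C2) < card (Ein C)"
      using sp(6,7) by (auto intro: psubset_card_mono)
    then have "2 * card (Ein C1) + 4 \<le> card (\<Union>C1) + 4 * card (Vin C1)"
      "2 * card (Ein C2) + 4 \<le> card (\<Union>C2) + 4 * card (Vin C2)"
      using less.hyps sp(1,2) by blast+
    then show ?thesis using sp(3,4,5) ispath_length[OF R(1)] by linarith
  qed
qed

text \<open>The inequalities for both sides, together with |C| \<le> |\<Union>C|, add up to 2|E| + 8
  \<le> 4|V|. A centre of inversion off the drawing exists because finitely many arcs and points
  have empty interior, while the inside of \<open>C\<close> is open and nonempty.\<close>

lemma edge_bound:
  assumes "3 \<le> card V" "E \<noteq> {}"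
  shows "card E + 4 \<le> 2 * card V"
proof -
  obtain C where C: "cyc E C" using exists_cycle[OF assms] by blast
  note J = cyc_Jordan[OF C]
  have int: "interior (drawn E \<union> p ` V) = {}"
  proof -
    have cl: "closed (I e)" and em: "interior (I e) = {}" if eE: "e \<in> E" for e
    proof -
      obtain g where "arc g" "path_image g = I e" using edge_obtain[OF eE] by metis
      then show "closed (I e)" "interior (I e) = {}"
        using closed_arc_image interior_arc_image_empty by metis+
    qed
    have "interior (\<Union>(I ` F)) = {} \<and> closed (\<Union>(I ` F))" if "finite F" "F \<subseteq> E" for F
      using that
    proof (induction F rule: finite_induct)
      case (insert e F)
      then have "interior (\<Union>(I ` F) \<union> I e) = interior (\<Union>(I ` F))"
        using cl em by (intro interior_closed_Un_empty_interior) auto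
      then show ?case using insert cl by (auto simp: Un_commute)
    qed auto
    then have "interior (drawn E) = {}" "closed (drawn E)" using finE by (auto simp: drawn_def)
    then show ?thesis
      using interior_closed_Un_empty_interior[of "drawn E" "p ` V"] finite_V
      by (simp add: finite_imp_closed empty_interior_finite)
  qed
  have "\<not> inside (drawn C) \<subseteq> drawn E \<union> p ` V"
    using interior_maximal[OF _ J(2)] J(1) int by blast
  then obtain a where a: "a \<in> inside (drawn C)" "a \<notin> drawn E" "a \<notin> p ` V" by blast
  let ?f = "\<lambda>z. 1 / (z - a)"
  have inj_f: "inj ?f" by (auto simp: inj_on_def divide_eq_eq)
  interpret D': drawing V E "\<lambda>v. 1 / (p v - a)" "\<lambda>e. ?f ` I e"
    by (rule invert) (use a in \<open>auto simp: drawn_def\<close>)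
  interpret T': triangle_free_drawing V E "\<lambda>v. 1 / (p v - a)" "\<lambda>e. ?f ` I e"
    by unfold_locales (rule no_triangle)
  have drawn': "D'.drawn C = ?f ` drawn C" by (auto simp: D'.drawn_def drawn_def)
  note J' = D'.cyc_Jordan[OF C, unfolded drawn']
  have out_in: "?f ` outside (drawn C) \<subseteq> inside (?f ` drawn C)"
    and in_out: "inside (?f ` drawn C) \<subseteq> ?f ` outside (drawn C) \<union> {0}"
    using inside_inversion[OF a(1) J(2,4,5,8,9,6) compact_imp_bounded[OF J(11)] J'(3,2)] by blast+
  have open_edge': "D'.open_edge e = ?f ` open_edge e" if "e \<in> E" for e
    unfolding D'.open_edge_def open_edge_def image_set_diff[OF inj_f] by (simp add: image_image)
  have "E \<subseteq> (C \<union> Ein C) \<union> D'.Ein C"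
  proof
    fix e assume e: "e \<in> E"
    show "e \<in> (C \<union> Ein C) \<union> D'.Ein C"
    proof (rule ccontr)
      assume n: "e \<notin> (C \<union> Ein C) \<union> D'.Ein C"
      then have "open_edge e \<subseteq> outside (drawn C)" using open_edge_dichotomy[OF C, of e] e by (auto simp: Ein_def)
      then have "D'.open_edge e \<subseteq> inside (D'.drawn C)" using out_in open_edge'[OF e] drawn' by auto
      then show False using n e by (auto simp: D'.Ein_def)
    qed
  qed
  then have "card E \<le> card ((C \<union> Ein C) \<union> D'.Ein C)"
    using cyc_finite[OF C] finE by (intro card_mono) (auto simp: Ein_def D'.Ein_def)
  also have "\<dots> \<le> card C + card (Ein C) + card (D'.Ein C)"
    by (meson card_Un_le add_le_mono1 order_trans)
  finally have e: "card E \<le> card C + card (Ein C) + card (D'.Ein C)" .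
  have "card (\<Union>C) + card (Vin C) + card (D'.Vin C) \<le> card V"
  proof -
    have f: "finite (\<Union>C)" "finite (Vin C)" "finite (D'.Vin C)"
      using cyc_finite[OF C] finite_V by (auto simp: Vin_def D'.Vin_def)
    have "Vin C \<inter> D'.Vin C = {}"
    proof (rule Int_emptyI)
      fix v assume v: "v \<in> Vin C" "v \<in> D'.Vin C"
      then have "?f (p v) \<in> ?f ` outside (drawn C) \<union> {0}" using in_out by (auto simp: D'.Vin_def drawn')
      moreover have "p v \<noteq> a" using a(3) v by (auto simp: Vin_def)
      ultimately have "?f (p v) \<in> ?f ` outside (drawn C)" by auto
      then have "p v \<in> outside (drawn C)" using inj_f by (auto dest: injD)
      then show False using v(1) J(8) unfolding Vin_def by blast
    qed
    then have "card (\<Union>C \<union> (Vin C \<union> D'.Vin C)) = card (\<Union>C) + (card (Vin C) + card (D'.Vin C))"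
      using f Vin_disjoint[OF C] D'.Vin_disjoint[OF C] by (subst card_Un_disjoint, auto, subst card_Un_disjoint, auto)
    moreover have "card (\<Union>C \<union> (Vin C \<union> D'.Vin C)) \<le> card V"
      using cyc_subset[OF C] edge_V finite_V by (intro card_mono) (auto simp: Vin_def D'.Vin_def)
    ultimately show ?thesis by simp
  qed
  then show ?thesis
    using e cycle_bound[OF C] T'.cycle_bound[OF C] cyc_card[OF C] by linarith
qed

end

lemma (in drawing) restrict:
  assumes "X \<subseteq> V"
  shows "drawing X {e\<in>E. e \<subseteq> X} p I"
proof
  show "finite X" using assms finite_V finite_subset by auto
  show "inj_on p X" using inj_p assms inj_on_subset by blast
  show "\<exists>a b. e = {a, b} \<and> a \<noteq> b \<and> a \<in> X \<and> b \<in> X" if "e \<in> {e\<in>E. e \<subseteq> X}" for e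
    using edge_ends[of e] that by blast
  show "\<exists>g. arc g \<and> pathstart g = p a \<and> pathfinish g = p b \<and> path_image g = I {a, b}" if "{a, b} \<in> {e\<in>E. e \<subseteq> X}" for a b
    using edge_arc that by blast
  show "I e \<inter> p ` X = p ` e" if "e \<in> {e\<in>E. e \<subseteq> X}" for e
    using edge_vertices[of e] that assms by blast
  show "I e \<inter> I f = p ` (e \<inter> f)" if "e \<in> {e\<in>E. e \<subseteq> X}" "f \<in> {e\<in>E. e \<subseteq> X}" "e \<noteq> f" for e f
    using edges_cross that by blast
qed

text \<open>A minimal counterexample is 2-connected: if \<open>v\<close> separated it, its edges
  would lie in two smaller vertex sets with |X| + |Y| = |V| + 1, and the bounds 2|X| - 3 and 2|Y| -
  3 would add up to 2|V| - 4.\<close>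

theorem drawing_edge_bound:
  assumes "drawing V E p I" "\<And>a b c. {a, b} \<in> E \<Longrightarrow> {b, c} \<in> E \<Longrightarrow> {c, a} \<notin> E" "3 \<le> card V"
  shows "card E + 4 \<le> 2 * card V"
  using assms
proof (induction "card V" arbitrary: V E rule: less_induct)
  case less
  interpret drawing V E p I by (rule less.prems)
  have fE: "finite E" by (rule finite_subset[of _ "Pow V"]) (use edge_V finite_V in auto)
  show ?case
  proof (rule ccontr)
    assume n: "\<not> ?thesis"
    then have E: "E \<noteq> {}" using less.prems(3) by auto
    \<comment> \<open>The constant 3 instead of 4 admits sets of two vertices, which may span one
      edge.\<close>
    have small: "card {e\<in>E. e \<subseteq> X} + 3 \<le> 2 * card X" if X: "X \<subset> V" "2 \<le> card X" for X
    proof (cases "card X = 2")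
      case True
      then have "{e\<in>E. e \<subseteq> X} \<subseteq> {X}"
      proof -
        have "e = X" if "e \<in> E" "e \<subseteq> X" for e
        proof (rule card_subset_eq)
          show "finite X" using True card.infinite by fastforce
          show "card e = card X" using edge_ends[OF that(1)] True by auto
        qed (rule that(2))
        then show ?thesis by auto
      qed
      then have "card {e\<in>E. e \<subseteq> X} \<le> card {X}" by (intro card_mono) auto
      then show ?thesis using True by simp
    next
      case False
      have "card {e\<in>E. e \<subseteq> X} + 4 \<le> 2 * card X"
      proof (rule less.hyps)
        show "card X < card V" using X finite_V psubset_card_mono by blast
        show "drawing X {e\<in>E. e \<subseteq> X} p I" using X by (intro restrict) auto
        show "{c, a} \<notin> {e\<in>E. e \<subseteq> X}" if "{a, b} \<in> {e\<in>E. e \<subseteq> X}" "{b, c} \<in> {e\<in>E. e \<subseteq> X}" for a b c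
          using less.prems(2)[of a b c] that by blast
        show "3 \<le> card X" using X False by simp
      qed
      then show ?thesis by simp
    qed
    interpret triangle_free_drawing V E p I
    proof
      show "finite V" by (rule finite_V)
      show "\<exists>a b. e = {a, b} \<and> a \<noteq> b \<and> a \<in> V \<and> b \<in> V" if "e \<in> E" for e by (rule edge_ends[OF that])
      show "{c, a} \<notin> E" if "{a, b} \<in> E" "{b, c} \<in> E" for a b c by (rule less.prems(2)[OF that])
      show "\<exists>k\<in>K. \<exists>y. y \<notin> insert v K \<and> {k, y} \<in> E"
        if K: "K \<noteq> {}" "K \<subseteq> V" "v \<in> V - K" "insert v K \<noteq> V" for K v
      proof (rule ccontr)
        assume no: "\<not> ?thesis"
        let ?X = "insert v K" and ?Y = "V - K"
        have fK: "finite K" using K finite_V finite_subset by blast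
        have "E \<subseteq> {e\<in>E. e \<subseteq> ?X} \<union> {e\<in>E. e \<subseteq> ?Y}"
        proof
          fix e assume e: "e \<in> E"
          then obtain a b where ab: "e = {a, b}" "a \<in> V" "b \<in> V" using edge_ends by blast
          show "e \<in> {e\<in>E. e \<subseteq> ?X} \<union> {e\<in>E. e \<subseteq> ?Y}"
          proof (cases "a \<in> K \<or> b \<in> K")
            case True
            have "b \<in> ?X" if "a \<in> K" using no that e ab by blast
            moreover have "a \<in> ?X" if "b \<in> K"
            proof -
              have "{b, a} \<in> E" using e ab by (simp add: insert_commute)
              then show ?thesis using no that by blast
            qed
            ultimately show ?thesis using True e ab by auto
          qed (use e ab in auto)
        qed
        then have "card E \<le> card ({e\<in>E. e \<subseteq> ?X} \<union> {e\<in>E. e \<subseteq> ?Y})"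
          using fE by (intro card_mono) auto
        also have "\<dots> \<le> card {e\<in>E. e \<subseteq> ?X} + card {e\<in>E. e \<subseteq> ?Y}" by (rule card_Un_le)
        finally have cE: "card E \<le> card {e\<in>E. e \<subseteq> ?X} + card {e\<in>E. e \<subseteq> ?Y}" .
        have cX: "card ?X = card K + 1" using K fK by simp
        have cY: "card ?Y = card V - card K" using K fK by (simp add: card_Diff_subset)
        have kV: "card K \<le> card V" using K finite_V by (intro card_mono) auto
        have k0: "card K > 0" using K fK by (simp add: card_gt_0_iff)
        have XV: "?X \<subset> V" using K by auto
        then have "card ?X < card V" using finite_V by (rule psubset_card_mono[rotated])
        then have c2: "2 \<le> card ?X" "2 \<le> card ?Y" using cX cY k0 by linarith+
        have YV: "?Y \<subset> V" using K by blast
        have "card {e\<in>E. e \<subseteq> ?Y} + 3 \<le> 2 * card ?Y" "card {e\<in>E. e \<subseteq> ?X} + 3 \<le> 2 * card ?X"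
          using small[OF XV c2(1)] small[OF YV c2(2)] by blast+
        then show False using cE n cX cY kV by linarith
      qed
    qed
    show False using edge_bound[OF less.prems(3) E] n by blast
  qed
qed

subsection \<open>From plane graphs to sparse graphs\<close>

lemma num_paths4_eq:
  assumes "pair_graph G"
  shows "num_paths4 G u v = card {(a, x, b). (u, a) \<in> parcs G \<and> (a, x) \<in> parcs G \<and> (x, b) \<in> parcs G \<and>
    (b, v) \<in> parcs G \<and> distinct [u, a, x, b, v]}" (is "_ = card ?S")
proof -
  interpret pair_graph G by (rule assms)
  let ?f = "\<lambda>(a, x, b). [(u, a), (a, x), (x, b), (b, v)]"
  have "{q. pre_digraph.apath (with_proj G) u q v \<and> length q = 4} = ?f ` ?S"
  proof
    show "{q. pre_digraph.apath (with_proj G) u q v \<and> length q = 4} \<subseteq> ?f ` ?S"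
    proof
      fix q assume "q \<in> {q. pre_digraph.apath (with_proj G) u q v \<and> length q = 4}"
      then have q: "pre_digraph.apath (with_proj G) u q v" "length q = 4" by auto
      obtain e1 e2 e3 e4 where e: "q = [e1, e2, e3, e4]"
        using q(2) by (auto simp: length_Suc_conv numeral_eq_Suc)
      then show "q \<in> ?f ` ?S"
        using q(1) unfolding pre_digraph.apath_def pre_digraph.awalk_def
        by (cases e1; cases e2; cases e3; cases e4) force
    qed
    show "?f ` ?S \<subseteq> {q. pre_digraph.apath (with_proj G) u q v \<and> length q = 4}"
      unfolding pre_digraph.apath_def pre_digraph.awalk_def
      by (auto dest: in_arcsD1 in_arcsD2)
  qed
  moreover have "inj_on ?f ?S" by (auto simp: inj_on_def)
  ultimately show ?thesis unfolding num_paths4_def by (simp add: card_image)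
qed

lemma pair_graph_sym:
  assumes "pair_graph G" "(a, b) \<in> parcs G" shows "(b, a) \<in> parcs G"
proof -
  interpret pair_graph G by (rule assms)
  show ?thesis using pair_sym_arcs assms(2) by (auto simp: symmetric_def dest: symD)
qed

lemma doubleton_mem: "{a, b} \<in> {{a, b} | a b. R a b} \<Longrightarrow> R a b \<or> R b a"
  by (auto simp: doubleton_eq_iff)

lemma filter_mem: "x \<in> {e \<in> A. Q e} \<Longrightarrow> x \<in> A"
  by simp

lemma doubleton_obtain:
  assumes "e \<in> {{a, b} | a b. R a b}" obtains a b where "e = {a, b}" "R a b"
  using assms by blast

lemma planar_drawing:
  assumes G: "pair_graph G" and "planar G"
  shows "\<exists>p I. drawing (pverts G) {{a, b} | a b. (a, b) \<in> parcs G} p I"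
proof -
  interpret pair_graph G by (rule G)
  obtain p c where pd: "plane_drawing G p c" using assms(2) unfolding planar_def by blast
  note pd = pd[unfolded plane_drawing_def]
  note inj = pd[THEN conjunct1]
    and arcs = bspec[OF pd[THEN conjunct2, THEN conjunct1]]
    and swap = bspec[OF pd[THEN conjunct2, THEN conjunct2, THEN conjunct1]]
    and vert = bspec[OF pd[THEN conjunct2, THEN conjunct2, THEN conjunct2, THEN conjunct1]]
    and cross = bspec[OF bspec[OF pd[THEN conjunct2, THEN conjunct2, THEN conjunct2, THEN conjunct2]], rule_format]
  \<comment> \<open>The choice may return either of the two arcs of an edge; both have the same
    image by the swap condition.\<close>
  define I where "I S = path_image (c (SOME e. e \<in> parcs G \<and> edge_ends e = S))" for S
  have I: "I {a, b} = path_image (c (a, b))" if ab: "(a, b) \<in> parcs G" for a b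
  proof -
    let ?e = "SOME e. e \<in> parcs G \<and> edge_ends e = {a, b}"
    have "?e \<in> parcs G \<and> edge_ends ?e = {a, b}"
      by (rule someI[of _ "(a, b)"]) (simp add: ab edge_ends_def)
    then have "?e = (a, b) \<or> ?e = prod.swap (a, b)"
      by (cases ?e) (auto simp: edge_ends_def doubleton_eq_iff)
    then show ?thesis
    proof
      assume h: "?e = (a, b)"
      show ?thesis by (simp only: I_def h)
    next
      assume h: "?e = prod.swap (a, b)"
      show ?thesis by (simp only: I_def h swap[OF ab])
    qed
  qed
  have sym: "(b, a) \<in> parcs G" if "(a, b) \<in> parcs G" for a b by (rule pair_graph_sym[OF G that])
  have mem: "(a, b) \<in> parcs G" if "{a, b} \<in> {{a, b} | a b. (a, b) \<in> parcs G}" for a b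
    using doubleton_mem[OF that] by (elim disjE) (assumption, rule sym)
  have "drawing (pverts G) {{a, b} | a b. (a, b) \<in> parcs G} p I"
  proof
    show "finite (pverts G)" by (rule pair_finite_verts)
    show "inj_on p (pverts G)" by (rule inj)
    show "\<exists>a b. e = {a, b} \<and> a \<noteq> b \<and> a \<in> pverts G \<and> b \<in> pverts G"
      if eE: "e \<in> {{a, b} | a b. (a, b) \<in> parcs G}" for e
    proof -
      obtain a b where ab: "e = {a, b}" "(a, b) \<in> parcs G" by (rule doubleton_obtain[OF eE])
      show ?thesis
        using ab(1) in_arcsD1[OF ab(2)] in_arcsD2[OF ab(2)] pair_no_loops[OF ab(2)]
        by (intro exI[of _ a] exI[of _ b]) simp
    qed
    show "\<exists>g. Path_Connected.arc g \<and> pathstart g = p a \<and> pathfinish g = p b \<and> path_image g = I {a, b}"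
      if "{a, b} \<in> {{a, b} | a b. (a, b) \<in> parcs G}" for a b
    proof -
      have ab: "(a, b) \<in> parcs G" by (rule mem[OF that])
      show ?thesis using arcs[OF ab] unfolding I[OF ab] by (intro exI[of _ "c (a, b)"]) simp
    qed
    show "I e \<inter> p ` pverts G = p ` e" if eE: "e \<in> {{a, b} | a b. (a, b) \<in> parcs G}" for e
    proof -
      obtain a b where e: "e = {a, b}" "(a, b) \<in> parcs G" by (rule doubleton_obtain[OF eE])
      show ?thesis using vert[OF e(2)] unfolding e(1) I[OF e(2)] by (simp only: edge_ends_def fst_conv snd_conv)
    qed
    show "I e \<inter> I f = p ` (e \<inter> f)"
      if ef: "e \<in> {{a, b} | a b. (a, b) \<in> parcs G}" "f \<in> {{a, b} | a b. (a, b) \<in> parcs G}" "e \<noteq> f" for e f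
    proof -
      obtain a b where e: "e = {a, b}" "(a, b) \<in> parcs G" by (rule doubleton_obtain[OF ef(1)])
      obtain x y where f: "f = {x, y}" "(x, y) \<in> parcs G" by (rule doubleton_obtain[OF ef(2)])
      have "edge_ends (a, b) \<noteq> edge_ends (x, y)" using ef(3) e(1) f(1) by (simp add: edge_ends_def)
      from cross[OF e(2) f(2) this] show ?thesis
        unfolding e(1) f(1) I[OF e(2)] I[OF f(2)] by (simp only: edge_ends_def fst_conv snd_conv)
    qed
  qed
  then show ?thesis by blast
qed

lemma planar_sparse:
  assumes G: "pair_graph G" and tf: "triangle_free G" and "planar G"
    and U: "{u1, u2, u3} \<subseteq> pverts G" "u1 \<noteq> u2" "u2 \<noteq> u3" "u1 \<noteq> u3"
  shows "sparse_triangle_free (pverts G) (\<lambda>a b. (a, b) \<in> parcs G) u1 u2 u3"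
proof -
  interpret pair_graph G by (rule G)
  let ?E = "{{a, b} | a b. (a, b) \<in> parcs G}"
  obtain p I where D: "drawing (pverts G) ?E p I" using planar_drawing assms by blast
  have sym: "(b, a) \<in> parcs G" if "(a, b) \<in> parcs G" for a b by (rule pair_graph_sym[OF G that])
  have tri: "(c, a) \<notin> parcs G" if "(a, b) \<in> parcs G" "(b, c) \<in> parcs G" for a b c
    using tf that unfolding triangle_free_def by blast
  have mem: "(a, b) \<in> parcs G" if "{a, b} \<in> ?E" for a b
    using doubleton_mem[OF that] by (elim disjE) (assumption, rule sym)
  show ?thesis
  proof
    show "finite (pverts G)" by (rule pair_finite_verts)
    show "a \<in> pverts G" if "(a, b) \<in> parcs G" for a b using that by (rule in_arcsD1)
    show "(b, a) \<in> parcs G" if "(a, b) \<in> parcs G" for a b using that by (rule sym)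
    show "(a, a) \<notin> parcs G" for a using pair_no_loops[of "(a, a)"] by auto
    show "(c, a) \<notin> parcs G" if "(a, b) \<in> parcs G" "(b, c) \<in> parcs G" for a b c using tri that .
    show "card {{a, b} | a b. a \<in> X \<and> b \<in> X \<and> (a, b) \<in> parcs G} + 4 \<le> 2 * card X"
      if X: "X \<subseteq> pverts G" "3 \<le> card X" for X
    proof -
      have eq: "{e\<in>?E. e \<subseteq> X} = {{a, b} | a b. a \<in> X \<and> b \<in> X \<and> (a, b) \<in> parcs G}" by blast
      have "card {e\<in>?E. e \<subseteq> X} + 4 \<le> 2 * card X"
      proof (rule drawing_edge_bound)
        show "drawing X {e\<in>?E. e \<subseteq> X} p I" by (rule drawing.restrict[OF D X(1)])
        show "{c, a} \<notin> {e\<in>?E. e \<subseteq> X}" if "{a, b} \<in> {e\<in>?E. e \<subseteq> X}" "{b, c} \<in> {e\<in>?E. e \<subseteq> X}" for a b c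
        proof
          assume "{c, a} \<in> {e\<in>?E. e \<subseteq> X}"
          then have h1: "{c, a} \<in> ?E" by (rule filter_mem)
          have h2: "{a, b} \<in> ?E" by (rule filter_mem, rule that(1))
          have h3: "{b, c} \<in> ?E" by (rule filter_mem, rule that(2))
          show False by (rule notE[OF tri[OF mem[OF h2] mem[OF h3]] mem[OF h1]])
        qed
      qed (rule X(2))
      then show ?thesis unfolding eq .
    qed
  qed (use U in auto)
qed

section \<open>Graphs with four or five vertices\<close>

lemma of_bool_le_1_nat: "of_bool Q \<le> (1::nat)"
  by (cases Q) simp_all

text \<open>The variables are the adjacencies among u1, u2, u3, a, b; each pair of terminals has six
  candidate paths. If a and b are adjacent, no terminal is adjacent to both, and the twelve
  remaining terms form three groups of four, one for each edge inside \<open>U\<close>, with at most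
  two true terms each. Otherwise only six terms are left.\<close>

lemma five_vertex_path_count:
  fixes x12 x13 x23 x1a x1b x2a x2b x3a x3b xab :: bool
  assumes "\<not> (x12 \<and> x13 \<and> x23)" "\<not> (x12 \<and> x1a \<and> x2a)" "\<not> (x12 \<and> x1b \<and> x2b)" "\<not> (x13 \<and> x1a \<and> x3a)"
    "\<not> (x13 \<and> x1b \<and> x3b)" "\<not> (x23 \<and> x2a \<and> x3a)" "\<not> (x23 \<and> x2b \<and> x3b)" "\<not> (x1a \<and> x1b \<and> xab)"
    "\<not> (x2a \<and> x2b \<and> xab)" "\<not> (x3a \<and> x3b \<and> xab)"
  shows "(of_bool (x13 \<and> x3a \<and> xab \<and> x2b) + of_bool (x13 \<and> x3b \<and> xab \<and> x2a) + of_bool (x1a \<and> x3a \<and> x3b \<and> x2b)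
      + of_bool (x1a \<and> xab \<and> x3b \<and> x23) + of_bool (x1b \<and> x3b \<and> x3a \<and> x2a) + of_bool (x1b \<and> xab \<and> x3a \<and> x23))
    + (of_bool (x12 \<and> x1a \<and> xab \<and> x3b) + of_bool (x12 \<and> x1b \<and> xab \<and> x3a) + of_bool (x2a \<and> x1a \<and> x1b \<and> x3b)
      + of_bool (x2a \<and> xab \<and> x1b \<and> x13) + of_bool (x2b \<and> x1b \<and> x1a \<and> x3a) + of_bool (x2b \<and> xab \<and> x1a \<and> x13))
    + (of_bool (x12 \<and> x2a \<and> xab \<and> x3b) + of_bool (x12 \<and> x2b \<and> xab \<and> x3a) + of_bool (x1a \<and> x2a \<and> x2b \<and> x3b)
      + of_bool (x1a \<and> xab \<and> x2b \<and> x23) + of_bool (x1b \<and> x2b \<and> x2a \<and> x3a) + of_bool (x1b \<and> xab \<and> x2a \<and> x23)) \<le> (6::nat)"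
proof (cases xab)
  case True
  have n: "\<not> (x1a \<and> x1b)" "\<not> (x2a \<and> x2b)" "\<not> (x3a \<and> x3b)" using assms(8-10) True by blast+
  have z: "of_bool (x1a \<and> x3a \<and> x3b \<and> x2b) = (0::nat)" "of_bool (x1b \<and> x3b \<and> x3a \<and> x2a) = (0::nat)"
    "of_bool (x2a \<and> x1a \<and> x1b \<and> x3b) = (0::nat)" "of_bool (x2b \<and> x1b \<and> x1a \<and> x3a) = (0::nat)"
    "of_bool (x1a \<and> x2a \<and> x2b \<and> x3b) = (0::nat)" "of_bool (x1b \<and> x2b \<and> x2a \<and> x3a) = (0::nat)"
    using n by auto
  have "of_bool (x13 \<and> x3a \<and> x2b) + of_bool (x13 \<and> x3b \<and> x2a) + of_bool (x2a \<and> x1b \<and> x13) + of_bool (x2b \<and> x1a \<and> x13) \<le> (2::nat)"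
    using n(2) by (cases x2a; cases x2b; simp add: of_bool_def)
  moreover have "of_bool (x1a \<and> x3b \<and> x23) + of_bool (x1b \<and> x3a \<and> x23) + of_bool (x1a \<and> x2b \<and> x23) + of_bool (x1b \<and> x2a \<and> x23) \<le> (2::nat)"
    using n(1) by (cases x1a; cases x1b; simp add: of_bool_def)
  moreover have "of_bool (x12 \<and> x1a \<and> x3b) + of_bool (x12 \<and> x1b \<and> x3a) + of_bool (x12 \<and> x2a \<and> x3b) + of_bool (x12 \<and> x2b \<and> x3a) \<le> (2::nat)"
    using n(3) by (cases x3a; cases x3b; simp add: of_bool_def)
  ultimately show ?thesis using True unfolding z by (simp only: simp_thms)
next
  case False
  have "of_bool (x1a \<and> x3a \<and> x3b \<and> x2b) \<le> (1::nat)" "of_bool (x1b \<and> x3b \<and> x3a \<and> x2a) \<le> (1::nat)"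
    "of_bool (x2a \<and> x1a \<and> x1b \<and> x3b) \<le> (1::nat)" "of_bool (x2b \<and> x1b \<and> x1a \<and> x3a) \<le> (1::nat)"
    "of_bool (x1a \<and> x2a \<and> x2b \<and> x3b) \<le> (1::nat)" "of_bool (x1b \<and> x2b \<and> x2a \<and> x3a) \<le> (1::nat)"
    by (rule of_bool_le_1_nat)+
  with False show ?thesis by simp
qed

context sparse_triangle_free
begin

lemma card_paths4_five:
  assumes "V = {u, v, c, a, b}"
  shows "card (paths4 u v) \<le> of_bool (adj u c \<and> adj c a \<and> adj a b \<and> adj b v) + of_bool (adj u c \<and> adj c b \<and> adj b a \<and> adj a v)
    + of_bool (adj u a \<and> adj a c \<and> adj c b \<and> adj b v) + of_bool (adj u a \<and> adj a b \<and> adj b c \<and> adj c v)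
    + of_bool (adj u b \<and> adj b c \<and> adj c a \<and> adj a v) + of_bool (adj u b \<and> adj b a \<and> adj a c \<and> adj c v)"
proof -
  define S where "S x y z = (if adj u x \<and> adj x y \<and> adj y z \<and> adj z v then {(x, y, z)} else {})" for x y z
  have cS: "card (S x y z) = of_bool (adj u x \<and> adj x y \<and> adj y z \<and> adj z v)" for x y z by (simp add: S_def)
  have "paths4 u v \<subseteq> S c a b \<union> S c b a \<union> S a c b \<union> S a b c \<union> S b c a \<union> S b a c"
  proof
    fix t assume t: "t \<in> paths4 u v"
    obtain x y z where xyz: "t = (x, y, z)" by (cases t)
    have p: "adj u x" "adj x y" "adj y z" "adj z v" "distinct [u, x, y, z, v]" using t xyz by (auto simp: paths4_def)
    have "x \<in> V" "y \<in> V" "z \<in> V" using adjV p by blast+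
    then have "x \<in> {c, a, b}" "y \<in> {c, a, b}" "z \<in> {c, a, b}" using p(5) assms by auto
    then have "(x = c \<and> y = a \<and> z = b) \<or> (x = c \<and> y = b \<and> z = a) \<or> (x = a \<and> y = c \<and> z = b)
      \<or> (x = a \<and> y = b \<and> z = c) \<or> (x = b \<and> y = c \<and> z = a) \<or> (x = b \<and> y = a \<and> z = c)"
      using p(5) by auto
    moreover have "t \<in> S x y z" using p(1-4) xyz by (simp add: S_def)
    ultimately show "t \<in> S c a b \<union> S c b a \<union> S a c b \<union> S a b c \<union> S b c a \<union> S b a c"
      by (elim disjE conjE) simp_all
  qed
  then have "card (paths4 u v) \<le> card (S c a b \<union> S c b a \<union> S a c b \<union> S a b c \<union> S b c a \<union> S b a c)"
    by (intro card_mono) (auto simp: S_def)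
  also have "\<dots> \<le> card (S c a b) + card (S c b a) + card (S a c b) + card (S a b c) + card (S b c a) + card (S b a c)"
    by (meson card_Un_le add_le_mono1 order_trans)
  finally show ?thesis unfolding cS .
qed

lemma T_le_five:
  assumes "card V = 5"
  shows "T \<le> 6"
proof -
  have "card (V - U) = 2" using U_in_V card_U finU assms by (simp add: card_Diff_subset U_def[symmetric])
  then obtain a b where ab: "V - U = {a, b}" "a \<noteq> b" by (auto simp: card_2_iff)
  have V: "V = {u1, u2, u3, a, b}" using ab(1) U_in_V by (auto simp: U_def)
  have V': "V = {u2, u3, u1, a, b}" "V = {u1, u3, u2, a, b}" using V by auto
  have t: "\<not> (adj x y \<and> adj x z \<and> adj y z)" for x y z using tri[of x y z] sym_iff[of x z] by blast
  have s: "adj u2 u1 = adj u1 u2" "adj u3 u1 = adj u1 u3" "adj u3 u2 = adj u2 u3"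
    "adj a u1 = adj u1 a" "adj a u2 = adj u2 a" "adj a u3 = adj u3 a"
    "adj b u1 = adj u1 b" "adj b u2 = adj u2 b" "adj b u3 = adj u3 b" "adj b a = adj a b"
    by (rule sym_iff)+
  have "card (paths4 u1 u2) + card (paths4 u2 u3) + card (paths4 u1 u3) \<le> 6"
    using card_paths4_five[OF V] card_paths4_five[OF V'(1)] card_paths4_five[OF V'(2)]
      five_vertex_path_count[OF t[of u1 u2 u3] t[of u1 u2 a] t[of u1 u2 b] t[of u1 u3 a] t[of u1 u3 b]
        t[of u2 u3 a] t[of u2 u3 b] t[of u1 a b] t[of u2 a b] t[of u3 a b]]
    unfolding s by linarith
  then show ?thesis unfolding T_def by (simp flip: of_nat_add)
qed

lemma T_zero_four:
  assumes "card V \<le> 4"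
  shows "T = 0"
proof -
  have "paths4 u v = {}" for u v
  proof (rule ccontr)
    assume "paths4 u v \<noteq> {}"
    then obtain a x b where p: "adj u a" "adj a x" "adj x b" "adj b v" "distinct [u, a, x, b, v]"
      by (auto simp: paths4_def)
    then have "set [u, a, x, b, v] \<subseteq> V" using adjV[of u a] adjV[of a x] adjV[of x b] adjV[of b v] adjV[of v b] sym[of b v] by simp
    then have "card (set [u, a, x, b, v]) \<le> card V" by (rule card_mono[OF finV])
    then show False using distinct_card[OF p(5)] assms by simp
  qed
  then show ?thesis by (simp add: T_def)
qed

text \<open>At order 3 the bound is -2/3, below the count 0. At order 4 it is 7/3 against 0, at
  order 5 it is 6, and from 11 on the charging argument applies.\<close>

lemma path_count_le':
  assumes "card V \<notin> {3, 6, 7, 8, 9, 10}"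
  shows "T \<le> 3 * ((real (card V) + 1) / 3)\<^sup>2 - 6"
proof -
  have "3 \<le> card V" using card_mono[OF finV U_in_V] card_U by (simp add: U_def)
  then consider "card V = 4" | "card V = 5" | "card V \<ge> 11" using assms by fastforce
  then show ?thesis
  proof cases
    case 1
    then show ?thesis using T_zero_four by (simp add: power2_eq_square)
  next
    case 2
    then show ?thesis using T_le_five by (simp add: power2_eq_square)
  next
    case 3
    then show ?thesis by (rule path_count_le)
  qed
qed

end

lemma T_num_paths4:
  assumes G: "pair_graph G" and "sparse_triangle_free (pverts G) (\<lambda>a b. (a, b) \<in> parcs G) u1 u2 u3"
  shows "sparse_triangle_free.T (\<lambda>a b. (a, b) \<in> parcs G) u1 u2 u3
    = real (num_paths4 G u1 u2 + num_paths4 G u2 u3 + num_paths4 G u1 u3)"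
proof -
  interpret sparse_triangle_free "pverts G" "\<lambda>a b. (a, b) \<in> parcs G" u1 u2 u3 by (rule assms(2))
  show ?thesis unfolding T_def paths4_def num_paths4_eq[OF G] by simp
qed

subsection \<open>A straight-line drawing of the extremal graph\<close>

text \<open>The terminals lie on the real axis. A and B are stacked at height at most 1/4 over the
  midpoints between neighbouring terminals, below the segments to \<open>Z1\<close>, which have
  height 1/2 there; C is stacked on the imaginary axis above \<open>Z1\<close>.\<close>

fun hpos :: "h_vertex \<Rightarrow> real \<times> real" where
  "hpos U1 = (-1, 0)" | "hpos U2 = (0, 0)" | "hpos U3 = (1, 0)"
| "hpos Z1 = (0, 1)" | "hpos Z2 = (0, -1)"
| "hpos (VA i) = (- 1/2, 1 / (real i + 4))"
| "hpos (VB i) = (1/2, 1 / (real i + 4))"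
| "hpos (VC i) = (0, real i + 2)"

definition hp :: "h_vertex \<Rightarrow> complex" where "hp v = Complex (fst (hpos v)) (snd (hpos v))"

text \<open>The union of the edge sets of all H_n, so that crossings are examined once and for all
  n.\<close>

definition hE :: "h_vertex rel" where
  "hE = {U1, U2, U3} \<times> {Z1, Z2} \<union> range VA \<times> {U1, U2} \<union> range VB \<times> {U2, U3} \<union> range VC \<times> {U1, U3}"

definition joined :: "h_vertex \<Rightarrow> h_vertex \<Rightarrow> bool" where
  "joined u P \<longleftrightarrow> u \<in> {U1, U2, U3} \<and> ((u, P) \<in> hE \<or> (P, u) \<in> hE)"

lemma hp_inj: "inj hp"
proof (rule injI)
  fix v w assume "hp v = hp w"
  then have "hpos v = hpos w" by (simp add: hp_def prod_eq_iff)
  moreover have pos: "0 < 1 / (real i + 4)" for i by simp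
  have "1 / (real i + 4) \<noteq> -1" "1 / (real i + 4) \<noteq> 0" "1 / (real i + 4) \<noteq> 1" for i
    using pos[of i] by (auto simp: field_simps)
  ultimately show "v = w" by (cases v; cases w) auto
qed

lemma on_segment:
  assumes "z \<in> closed_segment (hp u) (hp P)"
  obtains t where "0 \<le> t" "t \<le> 1" "Re z = (1 - t) * fst (hpos u) + t * fst (hpos P)"
    "Im z = (1 - t) * snd (hpos u) + t * snd (hpos P)"
  using assms unfolding closed_segment_def hp_def by force

text \<open>Height divided by horizontal distance to an adjacent terminal. By symmetry of the
  positions the value is the same for both terminals adjacent to a vertex of A, B or C; the vertical
  segments from \<open>U2\<close> form a case of their own.\<close>

definition slope :: "h_vertex \<Rightarrow> real" where
  "slope P = (case P of Z1 \<Rightarrow> 1 | Z2 \<Rightarrow> -1 | VA i \<Rightarrow> 2 / (real i + 4) | VB i \<Rightarrow> 2 / (real i + 4) | VC i \<Rightarrow> real i + 2 | _ \<Rightarrow> 0)"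

lemma slope_VA: "slope (VA i) = 2 / (real i + 4)" "slope (VB i) = 2 / (real i + 4)" "slope Z1 = 1" "slope Z2 = -1" "slope (VC i) = real i + 2"
  by (simp_all add: slope_def)

lemma slope_small: "0 < 2 / (real i + 4)" "2 / (real i + 4) \<le> 1 / 2"
  by (auto simp: field_simps)

lemma joined_cases:
  "joined U1 P \<Longrightarrow> P = Z1 \<or> P = Z2 \<or> (\<exists>i. P = VA i) \<or> (\<exists>i. P = VC i)"
  "joined U2 P \<Longrightarrow> P = Z1 \<or> P = Z2 \<or> (\<exists>i. P = VA i) \<or> (\<exists>i. P = VB i)"
  "joined U3 P \<Longrightarrow> P = Z1 \<or> P = Z2 \<or> (\<exists>i. P = VB i) \<or> (\<exists>i. P = VC i)"
  by (auto simp: joined_def hE_def)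

lemma slope_inj:
  assumes "joined u P" "joined u P'" "u = U1 \<or> u = U3" "slope P = slope P'"
  shows "P = P'"
proof -
  have A: "2 / (real i + 4) \<noteq> 1" "2 / (real i + 4) \<noteq> -1" "2 / (real i + 4) \<noteq> real j + 2" for i j
    using slope_small[of i] by linarith+
  show ?thesis using assms(3)
  proof
    assume u: "u = U1"
    show ?thesis
      using joined_cases(1)[OF assms(1)[unfolded u]] joined_cases(1)[OF assms(2)[unfolded u]] assms(4)
      by (elim disjE exE) (auto simp: slope_def A A[symmetric])
  next
    assume u: "u = U3"
    show ?thesis
      using joined_cases(3)[OF assms(1)[unfolded u]] joined_cases(3)[OF assms(2)[unfolded u]] assms(4)
      by (elim disjE exE) (auto simp: slope_def A A[symmetric])
  qed
qed

lemma seg_U1: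
  assumes "joined U1 P" "z \<in> closed_segment (hp U1) (hp P)"
  shows "Im z = slope P * (Re z + 1)" "-1 \<le> Re z" "Re z \<le> fst (hpos P)" "fst (hpos P) = 0 \<or> (\<exists>i. P = VA i)"
proof -
  obtain t where t: "0 \<le> t" "t \<le> 1" "Re z = (1 - t) * fst (hpos U1) + t * fst (hpos P)"
    "Im z = (1 - t) * snd (hpos U1) + t * snd (hpos P)" by (rule on_segment[OF assms(2)])
  have re: "Re z + 1 = t * (fst (hpos P) + 1)" and im: "Im z = t * snd (hpos P)"
    using t(3,4) by (simp_all add: algebra_simps)
  note PC = joined_cases(1)[OF assms(1)]
  have P1: "slope P * (fst (hpos P) + 1) = snd (hpos P)"
    using PC by (elim disjE exE) (simp_all add: slope_VA field_simps)
  have P2: "0 \<le> fst (hpos P) + 1"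
    using PC by (elim disjE exE) simp_all
  have P3: "fst (hpos P) = 0 \<or> (\<exists>i. P = VA i)"
    using PC by (elim disjE exE) simp_all
  note P = P1 P2 P3
  show "Im z = slope P * (Re z + 1)" unfolding re im P(1)[symmetric] by (simp only: mult_ac)
  have "0 \<le> t * (fst (hpos P) + 1)" using t P by simp
  then show "-1 \<le> Re z" using re by linarith
  have "t * (fst (hpos P) + 1) \<le> 1 * (fst (hpos P) + 1)" using t P by (intro mult_right_mono)
  then show "Re z \<le> fst (hpos P)" using re by argo
  show "fst (hpos P) = 0 \<or> (\<exists>i. P = VA i)" by (rule P(3))
qed

lemma seg_U3:
  assumes "joined U3 P" "z \<in> closed_segment (hp U3) (hp P)"
  shows "Im z = slope P * (1 - Re z)" "Re z \<le> 1" "fst (hpos P) \<le> Re z" "fst (hpos P) = 0 \<or> (\<exists>i. P = VB i)"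
proof -
  obtain t where t: "0 \<le> t" "t \<le> 1" "Re z = (1 - t) * fst (hpos U3) + t * fst (hpos P)"
    "Im z = (1 - t) * snd (hpos U3) + t * snd (hpos P)" by (rule on_segment[OF assms(2)])
  have re: "1 - Re z = t * (1 - fst (hpos P))" and im: "Im z = t * snd (hpos P)"
    using t(3,4) by (simp_all add: algebra_simps)
  note PC = joined_cases(3)[OF assms(1)]
  have P1: "slope P * (1 - fst (hpos P)) = snd (hpos P)"
    using PC by (elim disjE exE) (simp_all add: slope_VA field_simps)
  have P2: "0 \<le> 1 - fst (hpos P)"
    using PC by (elim disjE exE) simp_all
  have P3: "fst (hpos P) = 0 \<or> (\<exists>i. P = VB i)"
    using PC by (elim disjE exE) simp_all
  note P = P1 P2 P3
  show "Im z = slope P * (1 - Re z)" unfolding re im P(1)[symmetric] by (simp only: mult_ac)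
  have "0 \<le> t * (1 - fst (hpos P))" using t P by simp
  then show "Re z \<le> 1" using re by linarith
  have "t * (1 - fst (hpos P)) \<le> 1 * (1 - fst (hpos P))" using t P by (intro mult_right_mono)
  then show "fst (hpos P) \<le> Re z" using re by argo
  show "fst (hpos P) = 0 \<or> (\<exists>i. P = VB i)" by (rule P(3))
qed

lemma seg_U2:
  assumes "joined U2 P" "z \<in> closed_segment (hp U2) (hp P)"
  shows "(P = Z1 \<and> Re z = 0 \<and> 0 \<le> Im z \<and> Im z \<le> 1) \<or> (P = Z2 \<and> Re z = 0 \<and> -1 \<le> Im z \<and> Im z \<le> 0)
    \<or> (\<exists>i. P = VA i \<and> - 1 / 2 \<le> Re z \<and> Re z \<le> 0 \<and> Im z = slope P * (- Re z))
    \<or> (\<exists>i. P = VB i \<and> 0 \<le> Re z \<and> Re z \<le> 1 / 2 \<and> Im z = slope P * Re z)"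
proof -
  obtain t where t: "0 \<le> t" "t \<le> 1" "Re z = (1 - t) * fst (hpos U2) + t * fst (hpos P)"
    "Im z = (1 - t) * snd (hpos U2) + t * snd (hpos P)" by (rule on_segment[OF assms(2)])
  have z: "Re z = t * fst (hpos P)" "Im z = t * snd (hpos P)" using t(3,4) by simp_all
  show ?thesis unfolding z
    using joined_cases(2)[OF assms(1)] t(1,2) by (elim disjE exE) (simp_all add: slope_VA field_simps)
qed

lemma hp_eq: "z = hp v \<longleftrightarrow> Re z = fst (hpos v) \<and> Im z = snd (hpos v)"
  by (simp add: hp_def complex_eq_iff)

lemma slope_VA_small: "0 < slope (VA i)" "slope (VA i) \<le> 1 / 2" "0 < slope (VB i)" "slope (VB i) \<le> 1 / 2"
  unfolding slope_VA using slope_small by auto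

section \<open>Crossings of two segments\<close>

lemma cross_same:
  assumes "joined u P" "joined u P'" "P \<noteq> P'" "z \<in> closed_segment (hp u) (hp P)" "z \<in> closed_segment (hp u) (hp P')"
  shows "z = hp u"
proof -
  have "u = U1 \<or> u = U3 \<or> u = U2" using assms(1) by (auto simp: joined_def)
  then show ?thesis
  proof (elim disjE)
    assume u: "u = U1"
    have "slope P \<noteq> slope P'" using slope_inj[OF assms(1,2)] u assms(3) by auto
    moreover have i1: "Im z = slope P * (Re z + 1)" by (rule seg_U1(1)) (use assms u in auto)
    moreover have "Im z = slope P' * (Re z + 1)" by (rule seg_U1(1)) (use assms u in auto)
    ultimately have z0: "Re z + 1 = 0" by (metis mult_right_cancel)
    have "Im z = 0" unfolding i1 z0 by simp
    moreover have "Re z = -1" using z0 by linarith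
    ultimately show ?thesis using u by (simp add: hp_eq)
  next
    assume u: "u = U3"
    have "slope P \<noteq> slope P'" using slope_inj[OF assms(1,2)] u assms(3) by auto
    moreover have i1: "Im z = slope P * (1 - Re z)" by (rule seg_U3(1)) (use assms u in auto)
    moreover have "Im z = slope P' * (1 - Re z)" by (rule seg_U3(1)) (use assms u in auto)
    ultimately have z0: "1 - Re z = 0" by (metis mult_right_cancel)
    have "Im z = 0" unfolding i1 z0 by simp
    moreover have "Re z = 1" using z0 by linarith
    ultimately show ?thesis using u by (simp add: hp_eq)
  next
    assume u: "u = U2"
    note sP = seg_U2[OF assms(1)[unfolded u] assms(4)[unfolded u]]
      and sP' = seg_U2[OF assms(2)[unfolded u] assms(5)[unfolded u]]
    consider "Re z = 0" | "Re z < 0" | "Re z > 0" by linarith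
    then have "Re z = 0 \<and> Im z = 0"
    proof cases
      case 1
      then show ?thesis using sP sP' assms(3) by (elim disjE exE conjE) auto
    next
      case 2
      from sP 2 obtain i where i: "P = VA i" "Im z = slope P * (- Re z)" by (elim disjE exE conjE) auto
      from sP' 2 obtain j where j: "P' = VA j" "Im z = slope P' * (- Re z)" by (elim disjE exE conjE) auto
      have "slope P * (- Re z) = slope P' * (- Re z)" by (rule trans[OF i(2)[symmetric] j(2)])
      then have "slope P = slope P'" using 2 by (subst (asm) mult_right_cancel) auto
      then have "i = j" using i(1) j(1) by (simp add: slope_VA field_simps)
      then show ?thesis using i(1) j(1) assms(3) by simp
    next
      case 3
      from sP 3 obtain i where i: "P = VB i" "Im z = slope P * Re z" by (elim disjE exE conjE) auto
      from sP' 3 obtain j where j: "P' = VB j" "Im z = slope P' * Re z" by (elim disjE exE conjE) auto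
      have "slope P * Re z = slope P' * Re z" by (rule trans[OF i(2)[symmetric] j(2)])
      then have "slope P = slope P'" using 3 by (subst (asm) mult_right_cancel) auto
      then have "i = j" using i(1) j(1) by (simp add: slope_VA field_simps)
      then show ?thesis using i(1) j(1) assms(3) by simp
    qed
    then show ?thesis using u by (simp add: hp_eq)
  qed
qed

text \<open>To the left of the imaginary axis, segments from \<open>U2\<close> have height between 0
  and 1/4. There, for real part at least -1/2, those from \<open>U1\<close> to C have height at
  least 1 and those to \<open>Z1\<close> at least 1/2, while those to \<open>Z2\<close> are
  negative. What remains are segments to A, which end at real part -1/2.\<close>

lemma cross_12:
  assumes "joined U1 P" "joined U2 P'" "z \<in> closed_segment (hp U1) (hp P)" "z \<in> closed_segment (hp U2) (hp P')"
  shows "P = P' \<and> z = hp P"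
proof -
  note s1 = seg_U1[OF assms(1,3)]
  have C: "1 \<le> Im z" if "P = VC i" "- 1 / 2 \<le> Re z" for i
  proof -
    have "2 * (1 / 2) \<le> (real i + 2) * (Re z + 1)" using that by (intro mult_mono) auto
    then show ?thesis using s1(1) that by (simp add: slope_VA)
  qed
  have A: "Im z \<le> 1 / 4 \<and> 0 \<le> Im z" if "- 1 / 2 \<le> Re z" "Re z \<le> 0" "Im z = slope (VA j) * (- Re z)" for j
  proof -
    have "slope (VA j) * (- Re z) \<le> (1 / 2) * (1 / 2)" using that slope_VA_small[of j] by (intro mult_mono) auto
    moreover have "0 \<le> slope (VA j) * (- Re z)" using that slope_VA_small[of j] by (intro mult_nonneg_nonneg) auto
    ultimately show ?thesis using that by simp
  qed
  from seg_U2[OF assms(2,4)] consider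
      "P' = Z1" "Re z = 0" "0 \<le> Im z" "Im z \<le> 1" | "P' = Z2" "Re z = 0" "-1 \<le> Im z" "Im z \<le> 0"
    | j where "P' = VA j" "- 1 / 2 \<le> Re z" "Re z \<le> 0" "Im z = slope P' * (- Re z)"
    | j where "P' = VB j" "0 \<le> Re z" "Re z \<le> 1 / 2" "Im z = slope P' * Re z" by metis
  then show ?thesis
  proof cases
    case 1
    then show ?thesis using joined_cases(1)[OF assms(1)] s1(1,3) by (elim disjE exE) (auto simp: slope_VA hp_eq)
  next
    case 2
    then show ?thesis using joined_cases(1)[OF assms(1)] s1(1,3) by (elim disjE exE) (auto simp: slope_VA hp_eq)
  next
    case (3 j)
    note Aj = A[of j]
    have im: "Im z \<le> 1 / 4" "0 \<le> Im z" using Aj 3 by auto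
    from joined_cases(1)[OF assms(1)] show ?thesis
    proof (elim disjE exE)
      fix i assume P: "P = VA i"
      then have re: "Re z = - 1 / 2" using s1(3) 3 by simp
      then have "slope (VA i) = slope (VA j)" using s1(1) 3 P by simp
      then have "i = j" by (simp add: slope_VA field_simps)
      then show ?thesis using P 3 re s1(1) by (simp add: hp_eq slope_VA field_simps)
    next
      fix i assume "P = VC i"
      then show ?thesis using C[of i] 3 im by simp
    qed (use s1(1) 3(2) im in \<open>simp_all add: slope_VA\<close>)
  next
    case (4 j)
    have "Re z \<le> 0" using s1(3,4) by auto
    then have z: "Re z = 0" "Im z = 0" using 4 by auto
    then show ?thesis using joined_cases(1)[OF assms(1)] s1(1,3) by (elim disjE exE) (auto simp: slope_VA)
  qed
qed

lemma cross_32: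
  assumes "joined U3 P" "joined U2 P'" "z \<in> closed_segment (hp U3) (hp P)" "z \<in> closed_segment (hp U2) (hp P')"
  shows "P = P' \<and> z = hp P"
proof -
  note s1 = seg_U3[OF assms(1,3)]
  have C: "1 \<le> Im z" if "P = VC i" "Re z \<le> 1 / 2" for i
  proof -
    have "2 * (1 / 2) \<le> (real i + 2) * (1 - Re z)" using that by (intro mult_mono) auto
    then show ?thesis using s1(1) that by (simp add: slope_VA)
  qed
  have A: "Im z \<le> 1 / 4 \<and> 0 \<le> Im z" if "Re z \<le> 1 / 2" "0 \<le> Re z" "Im z = slope (VB j) * Re z" for j
  proof -
    have "slope (VB j) * Re z \<le> (1 / 2) * (1 / 2)" using that slope_VA_small[of j] by (intro mult_mono) auto
    moreover have "0 \<le> slope (VB j) * Re z" using that slope_VA_small[of j] by (intro mult_nonneg_nonneg) auto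
    ultimately show ?thesis using that by simp
  qed
  from seg_U2[OF assms(2,4)] consider
      "P' = Z1" "Re z = 0" "0 \<le> Im z" "Im z \<le> 1" | "P' = Z2" "Re z = 0" "-1 \<le> Im z" "Im z \<le> 0"
    | j where "P' = VA j" "- 1 / 2 \<le> Re z" "Re z \<le> 0" "Im z = slope P' * (- Re z)"
    | j where "P' = VB j" "0 \<le> Re z" "Re z \<le> 1 / 2" "Im z = slope P' * Re z" by metis
  then show ?thesis
  proof cases
    case 1
    then show ?thesis using joined_cases(3)[OF assms(1)] s1(1,3) by (elim disjE exE) (auto simp: slope_VA hp_eq)
  next
    case 2
    then show ?thesis using joined_cases(3)[OF assms(1)] s1(1,3) by (elim disjE exE) (auto simp: slope_VA hp_eq)
  next
    case (4 j)
    note Aj = A[of j]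
    have im: "Im z \<le> 1 / 4" "0 \<le> Im z" using Aj 4 by auto
    from joined_cases(3)[OF assms(1)] show ?thesis
    proof (elim disjE exE)
      fix i assume P: "P = VB i"
      then have re: "Re z = 1 / 2" using s1(3) 4 by simp
      have "slope (VB i) * (1 - Re z) = slope (VB j) * Re z" using s1(1) 4 P by (metis)
      then have "slope (VB i) = slope (VB j)" unfolding re by simp
      then have "i = j" by (simp add: slope_VA field_simps)
      then show ?thesis using P 4 re s1(1) by (simp add: hp_eq slope_VA field_simps)
    next
      fix i assume "P = VC i"
      then show ?thesis using C[of i] 4 im by simp
    qed (use s1(1) 4(3) im in \<open>simp_all add: slope_VA\<close>)
  next
    case (3 j)
    have "0 \<le> Re z" using s1(3,4) by auto
    then have z: "Re z = 0" "Im z = 0" using 3 by auto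
    then show ?thesis using joined_cases(3)[OF assms(1)] s1(1,3) by (elim disjE exE) (auto simp: slope_VA)
  qed
qed

text \<open>Segments from \<open>U1\<close> stay in the left half-plane and those from
  \<open>U3\<close> in the right one. A common point lies on the imaginary axis, where both segments
  have reached their ends.\<close>

lemma cross_13:
  assumes "joined U1 P" "joined U3 P'" "z \<in> closed_segment (hp U1) (hp P)" "z \<in> closed_segment (hp U3) (hp P')"
  shows "P = P' \<and> z = hp P"
proof -
  note s1 = seg_U1[OF assms(1,3)] and s3 = seg_U3[OF assms(2,4)]
  have "Re z \<le> 0" "0 \<le> Re z" using s1(3,4) s3(3,4) by auto
  then have re: "Re z = 0" by simp
  then have im: "Im z = slope P" "Im z = slope P'" using s1(1) s3(1) by auto
  have "P = Z1 \<or> P = Z2 \<or> (\<exists>i. P = VC i)" using joined_cases(1)[OF assms(1)] s1(3) re by auto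
  moreover have "P' = Z1 \<or> P' = Z2 \<or> (\<exists>i. P' = VC i)" using joined_cases(3)[OF assms(2)] s3(3) re by auto
  ultimately have "P = P'" using im by (elim disjE exE) (auto simp: slope_VA)
  moreover have "z = hp P" using \<open>P = Z1 \<or> P = Z2 \<or> (\<exists>i. P = VC i)\<close> im re by (elim disjE exE) (auto simp: slope_VA hp_eq)
  ultimately show ?thesis by simp
qed

lemma cross_diff:
  assumes "joined u P" "joined u' P'" "u \<noteq> u'" "z \<in> closed_segment (hp u) (hp P)" "z \<in> closed_segment (hp u') (hp P')"
  shows "P = P' \<and> z = hp P"
proof -
  have "u \<in> {U1, U2, U3}" "u' \<in> {U1, U2, U3}" using assms by (auto simp: joined_def)
  then consider "u = U1" "u' = U2" | "u = U1" "u' = U3" | "u = U2" "u' = U1" | "u = U2" "u' = U3"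
    | "u = U3" "u' = U1" | "u = U3" "u' = U2" using assms(3) by auto
  then show ?thesis
    using cross_12[of P P' z] cross_12[of P' P z] cross_13[of P P' z] cross_13[of P' P z]
      cross_32[of P P' z] cross_32[of P' P z] assms by cases auto
qed

subsection \<open>The path count of the extremal graph\<close>

lemma joined_simps:
  "joined U1 Z1" "joined U2 Z1" "joined U3 Z1" "joined U1 Z2" "joined U1 (VA i)" "joined U2 (VB i)" "joined U1 (VC i)"
  by (auto simp: joined_def hE_def)

lemma exists_joined: "\<exists>u P. joined u P \<and> w \<in> {u, P}"
  using joined_simps by (cases w) blast+

lemma joined_ne: "joined u P \<Longrightarrow> u \<noteq> P"
  by (auto simp: joined_def hE_def)

lemma joined_meet:
  assumes "joined u P" "joined u' P'" "{u, P} \<noteq> {u', P'}"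
    "z \<in> closed_segment (hp u) (hp P)" "z \<in> closed_segment (hp u') (hp P')"
  shows "z \<in> hp ` ({u, P} \<inter> {u', P'})"
proof (cases "u = u'")
  case True
  then have "P \<noteq> P'" using assms(3) by auto
  then have "z = hp u" using cross_same[of u P P' z] assms True by simp
  then show ?thesis using True by simp
next
  case False
  then have "P = P' \<and> z = hp P" using cross_diff assms by blast
  then show ?thesis by simp
qed

text \<open>Every vertex is an end of some edge of \<open>hE\<close>, so a vertex on a segment
  becomes a meeting of two segments.\<close>

lemma joined_vertex:
  assumes "joined u P" "hp w \<in> closed_segment (hp u) (hp P)"
  shows "w \<in> {u, P}"
proof -
  obtain u' P' where J: "joined u' P'" "w \<in> {u', P'}" using exists_joined by blast
  show ?thesis
  proof (cases "{u, P} = {u', P'}")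
    case False
    have "hp w \<in> closed_segment (hp u') (hp P')" using J(2) by auto
    then have "hp w \<in> hp ` ({u, P} \<inter> {u', P'})" using joined_meet[OF assms(1) J(1) False assms(2)] by simp
    then show ?thesis using hp_inj by (auto dest: injD)
  qed (use J in simp)
qed

lemma h_edge_rep:
  assumes "e \<in> parcs (H_graph n)"
  shows "\<exists>u P. joined u P \<and> edge_ends e = {u, P} \<and>
    closed_segment (hp (fst e)) (hp (snd e)) = closed_segment (hp u) (hp P)"
proof -
  have sub: "h_edges n \<subseteq> hE" unfolding h_edges_def hE_def h_A_def h_B_def h_C_def
    by (intro Un_mono Sigma_mono image_mono order_refl subset_UNIV)
  have split: "a \<in> {U1, U2, U3} \<or> b \<in> {U1, U2, U3}" if "(a, b) \<in> hE" for a b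
    using that unfolding hE_def by blast
  obtain a b where e: "e = (a, b)" by (cases e)
  have "(a, b) \<in> hE \<or> (b, a) \<in> hE" using assms sub e by (auto simp: H_graph_def)
  then have "joined a b \<or> joined b a" using split[of a b] split[of b a] by (auto simp: joined_def)
  then show ?thesis
  proof
    assume "joined a b"
    moreover have "edge_ends e = {a, b}" by (simp add: e edge_ends_def)
    ultimately show ?thesis unfolding e fst_conv snd_conv by blast
  next
    assume "joined b a"
    moreover have "edge_ends e = {b, a}" by (simp add: e edge_ends_def insert_commute)
    moreover have "closed_segment (hp a) (hp b) = closed_segment (hp b) (hp a)"
      by (rule closed_segment_commute)
    ultimately show ?thesis unfolding e fst_conv snd_conv by blast
  qed
qed

lemma H_planar:
  assumes ends: "\<And>e. e \<in> parcs (H_graph n) \<Longrightarrow> edge_ends e \<subseteq> pverts (H_graph n)"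
  shows "planar (H_graph n)"
proof -
  let ?c = "\<lambda>e. linepath (hp (fst e)) (hp (snd e))"
  let ?G = "H_graph n"
  have "plane_drawing ?G hp ?c"
    unfolding plane_drawing_def
  proof (intro conjI ballI impI)
    show "inj_on hp (pverts ?G)" using hp_inj by (rule inj_on_subset) simp
    fix e assume e: "e \<in> parcs ?G"
    obtain u P where uP: "joined u P" "edge_ends e = {u, P}"
      "closed_segment (hp (fst e)) (hp (snd e)) = closed_segment (hp u) (hp P)" using h_edge_rep[OF e] by blast
    have "fst e \<noteq> snd e" using uP(2) joined_ne[OF uP(1)] by (auto simp: edge_ends_def)
    then have "hp (fst e) \<noteq> hp (snd e)" using hp_inj by (auto dest: injD)
    then show "Path_Connected.arc (?c e)" by (rule arc_linepath)
    show "pathstart (?c e) = hp (fst e)" "pathfinish (?c e) = hp (snd e)" by simp_all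
    show "path_image (?c (prod.swap e)) = path_image (?c e)"
      by (simp add: closed_segment_commute)
    show "path_image (?c e) \<inter> hp ` pverts ?G = hp ` edge_ends e"
    proof
      show "path_image (?c e) \<inter> hp ` pverts ?G \<subseteq> hp ` edge_ends e"
        unfolding path_image_linepath uP(2,3) using joined_vertex[OF uP(1)] by blast
      show "hp ` edge_ends e \<subseteq> path_image (?c e) \<inter> hp ` pverts ?G"
        using ends[OF e] by (auto simp: edge_ends_def)
    qed
    fix f assume f: "f \<in> parcs ?G" and ef: "edge_ends e \<noteq> edge_ends f"
    obtain u' P' where uP': "joined u' P'" "edge_ends f = {u', P'}"
      "closed_segment (hp (fst f)) (hp (snd f)) = closed_segment (hp u') (hp P')" using h_edge_rep[OF f] by blast
    show "path_image (?c e) \<inter> path_image (?c f) = hp ` (edge_ends e \<inter> edge_ends f)"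
    proof
      have ne: "{u, P} \<noteq> {u', P'}" using ef uP(2) uP'(2) by simp
      show "path_image (?c e) \<inter> path_image (?c f) \<subseteq> hp ` (edge_ends e \<inter> edge_ends f)"
        unfolding path_image_linepath uP(2,3) uP'(2,3) using joined_meet[OF uP(1) uP'(1) ne] by blast
      show "hp ` (edge_ends e \<inter> edge_ends f) \<subseteq> path_image (?c e) \<inter> path_image (?c f)"
        by (auto simp: edge_ends_def)
    qed
  qed
  then show ?thesis unfolding planar_def by blast
qed

lemma h_bipartite:
  assumes "(x, y) \<in> parcs (H_graph n)"
  shows "(x \<in> {U1, U2, U3}) \<noteq> (y \<in> {U1, U2, U3})"
  using assms by (auto simp: H_graph_def h_edges_def h_A_def h_B_def h_C_def)

lemma H_triangle_free: "triangle_free (H_graph n)"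
  unfolding triangle_free_def using h_bipartite by meson

lemma H_verts_finite: "finite (pverts (H_graph n))"
  by (simp add: H_graph_def h_A_def h_B_def h_C_def)

lemma h_edges_verts: "h_edges n \<subseteq> pverts (H_graph n) \<times> pverts (H_graph n)"
  unfolding h_edges_def H_graph_def pair_pre_digraph.simps by (intro Un_least Sigma_mono) blast+

lemma H_parcs: "parcs (H_graph n) = h_edges n \<union> (h_edges n)\<inverse>"
  by (simp add: H_graph_def)

lemma H_arcs_verts: "parcs (H_graph n) \<subseteq> pverts (H_graph n) \<times> pverts (H_graph n)"
  unfolding H_parcs using h_edges_verts[of n] by blast

lemma H_pair_graph: "pair_graph (H_graph n)"
proof unfold_locales
  fix e assume e: "e \<in> parcs (H_graph n)"
  show "fst e \<in> pverts (H_graph n)" "snd e \<in> pverts (H_graph n)" using subsetD[OF H_arcs_verts e] by (simp_all add: mem_Times_iff)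
  show "fst e \<noteq> snd e" using h_bipartite[of "fst e" "snd e" n] e by auto
next
  show "finite (pverts (H_graph n))" by (rule H_verts_finite)
  show "finite (parcs (H_graph n))"
    by (rule finite_subset[OF H_arcs_verts]) (simp add: H_verts_finite)
  show "symmetric (with_proj (H_graph n))"
    unfolding symmetric_def by (rule symI) (auto simp: arcs_ends_def arc_to_ends_def H_parcs)
qed

lemma H_is_planar: "planar (H_graph n)"
  by (rule H_planar) (use subsetD[OF H_arcs_verts] in \<open>simp add: edge_ends_def mem_Times_iff\<close>)

section \<open>The orders congruent to 2 modulo 3\<close>

lemma h_sets:
  assumes "n = 3 * k + 5"
  shows "h_A n = VA ` {..<k}" "h_B n = VB ` {..<k}" "h_C n = VC ` {..<k}"
proof -
  have "(n - 3) div 3 = k" "(n - 4) div 3 = k" "(n - 5) div 3 = k" using assms by auto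
  then show "h_A n = VA ` {..<k}" "h_B n = VB ` {..<k}" "h_C n = VC ` {..<k}"
    by (simp_all add: h_A_def h_B_def h_C_def)
qed

lemma card_h: "card (VA ` {..<k}) = k" "card (VB ` {..<k}) = k" "card (VC ` {..<k}) = k"
  by (simp_all add: card_image inj_on_def)

lemma H_card:
  assumes "n = 3 * k + 5"
  shows "card (pverts (H_graph n)) = n"
proof -
  have "pverts (H_graph n) = {U1, U2, U3, Z1, Z2} \<union> (VA ` {..<k} \<union> (VB ` {..<k} \<union> VC ` {..<k}))"
    by (auto simp: H_graph_def h_sets[OF assms])
  also have "card \<dots> = card {U1, U2, U3, Z1, Z2} + card (VA ` {..<k} \<union> (VB ` {..<k} \<union> VC ` {..<k}))"
    by (rule card_Un_disjoint) auto
  also have "card (VA ` {..<k} \<union> (VB ` {..<k} \<union> VC ` {..<k})) = card (VA ` {..<k}) + card (VB ` {..<k} \<union> VC ` {..<k})"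
    by (rule card_Un_disjoint) auto
  also have "card (VB ` {..<k} \<union> VC ` {..<k}) = card (VB ` {..<k}) + card (VC ` {..<k})"
    by (rule card_Un_disjoint) auto
  finally show ?thesis using assms by (simp add: card_h)
qed

text \<open>Each pair of terminals has k + 2 common neighbours, there are no edges inside
  \<open>U\<close>, and every other vertex is adjacent to at least two terminals. Hence only paths
  with a terminal in the middle remain, and the 6 is 3|Z|.\<close>

lemma H_path_count:
  assumes n: "n = 3 * k + 5"
  shows "real (num_paths4 (H_graph n) U1 U2 + num_paths4 (H_graph n) U2 U3 + num_paths4 (H_graph n) U1 U3)
    = 3 * (real k + 2)\<^sup>2 - 6"
proof -
  let ?G = "H_graph n"
  let ?adj = "\<lambda>a b. (a, b) \<in> parcs ?G"
  \<comment> \<open>The planarity of H_n gives access to the exact formulas \<open>T_eq\<close> and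
    \<open>TU_eq\<close>, so that no path has to be listed.\<close>
  have sp: "sparse_triangle_free (pverts ?G) ?adj U1 U2 U3"
    by (rule planar_sparse[OF H_pair_graph H_triangle_free H_is_planar]) (auto simp: H_graph_def)
  interpret sparse_triangle_free "pverts ?G" ?adj U1 U2 U3 by (rule sp)
  have adjU: "?adj U1 x \<longleftrightarrow> x \<in> {Z1, Z2} \<union> VA ` {..<k} \<union> VC ` {..<k}"
    "?adj U2 x \<longleftrightarrow> x \<in> {Z1, Z2} \<union> VA ` {..<k} \<union> VB ` {..<k}"
    "?adj U3 x \<longleftrightarrow> x \<in> {Z1, Z2} \<union> VB ` {..<k} \<union> VC ` {..<k}" for x
    unfolding H_parcs h_edges_def h_sets[OF n] by (cases x; simp add: image_iff)+
  have W: "W = {Z1, Z2} \<union> VA ` {..<k} \<union> VB ` {..<k} \<union> VC ` {..<k}"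
    unfolding W_def U_def by (auto simp: H_graph_def h_sets[OF n])
  have com: "common u v = real (card {a\<in>W. ?adj u a \<and> ?adj v a})" for u v
  proof -
    have "common u v = (\<Sum>a\<in>W. if ?adj u a \<and> ?adj v a then 1 else 0)"
      unfolding common_def chi_def by (rule sum.cong) auto
    then show ?thesis using finW by (simp add: sum.If_cases Int_def)
  qed
  have c2: "card ({Z1, Z2} \<union> f ` {..<k}) = k + 2" if "inj f" "Z1 \<notin> range f" "Z2 \<notin> range f" for f :: "nat \<Rightarrow> h_vertex"
  proof -
    have "card ({Z1, Z2} \<union> f ` {..<k}) = card {Z1, Z2} + card (f ` {..<k})"
      using that(2,3) by (intro card_Un_disjoint) auto
    then show ?thesis using card_image[OF inj_on_subset[OF that(1)], of "{..<k}"] by simp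
  qed
  have "{a\<in>W. ?adj U1 a \<and> ?adj U2 a} = {Z1, Z2} \<union> VA ` {..<k}" unfolding W adjU by auto
  then have c12: "common U1 U2 = real k + 2" unfolding com using c2[of VA] by (simp add: inj_def image_iff)
  have "{a\<in>W. ?adj U2 a \<and> ?adj U3 a} = {Z1, Z2} \<union> VB ` {..<k}" unfolding W adjU by auto
  then have c23: "common U2 U3 = real k + 2" unfolding com using c2[of VB] by (simp add: inj_def image_iff)
  have "{a\<in>W. ?adj U1 a \<and> ?adj U3 a} = {Z1, Z2} \<union> VC ` {..<k}" unfolding W adjU by auto
  then have c13: "common U1 U3 = real k + 2" unfolding com using c2[of VC] by (simp add: inj_def image_iff)
  have dval: "real (d a) = (if a \<in> {Z1, Z2} then 3 else 2)" if "a \<in> W" for a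
    using that unfolding d_chi chi_def adjU W by (cases a) auto
  have "Z = {Z1, Z2}"
  proof -
    have "d a = 3 \<longleftrightarrow> a \<in> {Z1, Z2}" if "a \<in> W" for a using dval[OF that] by (auto split: if_splits)
    then show ?thesis unfolding Z_def using W by auto
  qed
  then have cZ: "card Z = 2" by simp
  have "P x = 0" if "x \<in> W" for x
  proof (rule P_eq_0)
    show "2 \<le> d x" using dval[OF that] by (auto split: if_splits)
  qed
  then have "(\<Sum>x\<in>W. P x) = 0" by (intro sum.neutral) auto
  moreover have "extra U1 U2 U3 = 0" "extra U2 U3 U1 = 0" "extra U1 U3 U2 = 0"
    unfolding extra_def adjU by auto
  ultimately have "T = TU" using T_eq by simp
  also have "\<dots> = 3 * (real k + 2)\<^sup>2 - 6"
    unfolding TU_eq c12 c23 c13 cZ by (simp add: power2_eq_square)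
  finally show ?thesis using T_num_paths4[OF H_pair_graph sp] by simp
qed

theorem theorem12:
  shows "(\<forall>(G :: 'a pair_pre_digraph) n u1 u2 u3.
            pair_graph G \<and> triangle_free G \<and> planar G \<and>
            card (pverts G) = n \<and> n \<notin> {3, 6, 7, 8, 9, 10} \<and>
            {u1, u2, u3} \<subseteq> pverts G \<and> u1 \<noteq> u2 \<and> u2 \<noteq> u3 \<and> u1 \<noteq> u3 \<longrightarrow>
            real (num_paths4 G u1 u2 + num_paths4 G u2 u3 + num_paths4 G u1 u3)
              \<le> 3 * ((real n + 1) / 3)\<^sup>2 - 6)
       \<and> (\<forall>n. n \<ge> 6 \<and> n mod 3 = 2 \<longrightarrow>
            pair_graph (H_graph n) \<and> triangle_free (H_graph n) \<and> planar (H_graph n) \<and>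
            card (pverts (H_graph n)) = n \<and>
            real (num_paths4 (H_graph n) U1 U2 + num_paths4 (H_graph n) U2 U3
                  + num_paths4 (H_graph n) U1 U3)
              = 3 * ((real n + 1) / 3)\<^sup>2 - 6)"
proof (intro conjI allI impI)
  fix G :: "'a pair_pre_digraph" and n u1 u2 u3
  assume A: "pair_graph G \<and> triangle_free G \<and> planar G \<and>
            card (pverts G) = n \<and> n \<notin> {3, 6, 7, 8, 9, 10} \<and>
            {u1, u2, u3} \<subseteq> pverts G \<and> u1 \<noteq> u2 \<and> u2 \<noteq> u3 \<and> u1 \<noteq> u3"
  have sp: "sparse_triangle_free (pverts G) (\<lambda>a b. (a, b) \<in> parcs G) u1 u2 u3"
    by (rule planar_sparse) (use A in auto)
  have "real (num_paths4 G u1 u2 + num_paths4 G u2 u3 + num_paths4 G u1 u3)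
      = sparse_triangle_free.T (\<lambda>a b. (a, b) \<in> parcs G) u1 u2 u3"
    by (rule T_num_paths4[symmetric, OF _ sp]) (use A in blast)
  also have "\<dots> \<le> 3 * ((real (card (pverts G)) + 1) / 3)\<^sup>2 - 6"
    by (rule sparse_triangle_free.path_count_le'[OF sp]) (use A in blast)
  finally show "real (num_paths4 G u1 u2 + num_paths4 G u2 u3 + num_paths4 G u1 u3)
      \<le> 3 * ((real n + 1) / 3)\<^sup>2 - 6"
    using A by simp
next
  fix n :: nat
  assume n: "6 \<le> n \<and> n mod 3 = 2"
  then have k: "n = 3 * ((n - 5) div 3) + 5" by presburger
  show "pair_graph (H_graph n)" by (rule H_pair_graph)
  show "triangle_free (H_graph n)" by (rule H_triangle_free)
  show "planar (H_graph n)" by (rule H_is_planar)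
  show "card (pverts (H_graph n)) = n" by (rule H_card[OF k])
  have "(real n + 1) / 3 = real ((n - 5) div 3) + 2" by (subst k) (simp add: field_simps)
  then show "real (num_paths4 (H_graph n) U1 U2 + num_paths4 (H_graph n) U2 U3
          + num_paths4 (H_graph n) U1 U3) = 3 * ((real n + 1) / 3)\<^sup>2 - 6"
    using H_path_count[OF k] by simp
qed

end
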